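(* Let $E$ be any graph, $K$ a field, and let $(H,S)$ and $(G,T)$ be admissible pairs of $E$ with $(H,S)\leq (G,T)$. Then the Leavitt path algebra $L_K((G,T)/(H,S))$ of the porcupine-quotient graph is graded isomorphic (as a $\mathbb{Z}$-graded algebra) to the quotient $I(G,T)/I(H,S)$.
   Context: $E$ is a directed graph of arbitrary cardinality with source and range maps $\mathbf{s},\mathbf{r}$; paths are finite sequences of edges $e_1\dots e_n$ with $\mathbf{r}(e_i)=\mathbf{s}(e_{i+1})$ (or single vertices); a vertex is an infinite emitter if it emits infinitely many edges. $L_K(E)$ is the Leavitt path algebra with its standard $\mathbb{Z}$-grading (vertices in degree 0, edges in degree 1, ghost edges in degree $-1$). A set $H\subseteq E^0$ is hereditary if every vertex reachable by a path from $H$ is in $H$, and saturated if each vertex $v$ emitting finitely many but at least one edge with $\mathbf{r}(\mathbf{s}^{-1}(v))\subseteq H$ lies in $H$. For hereditary saturated $H$, $B_H=\{v\in E^0\setminus H: v\text{ infinite emitter}, 0<|\mathbf{s}^{-1}(v)\cap \mathbf{r}^{-1}(E^0\setminus H)|<\infty\}$ and $v^H=v-\sum_{e\in \mathbf{s}^{-1}(v)\cap\mathbf{r}^{-1}(E^0\setminus H)}ee^*$ for $v\in B_H$. An admissible pair is $(H,S)$ with $H$ hereditary saturated and $S\subseteq B_H$; $I(H,S)$ is the (graded) ideal of $L_K(E)$ generated by $H\cup\{v^H:v\in S\}$; $(H,S)\leq (G,T)$ means $H\subseteq G$ and $S\subseteq G\cup T$. Porcupine-quotient graph. For $(H,S)\le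 (G,T)$ let $B^G_H=\{v\in E^0\setminus H: v \text{ infinite emitter and } 0<|\mathbf{s}^{-1}(v)\cap\mathbf{r}^{-1}(G\setminus H)|<\infty\}$, $F_1=\{e_1\dots e_n \text{ path of } E,\ n\ge 1: \mathbf{r}(e_n)\in G\setminus H,\ \mathbf{s}(e_n)\notin (G\setminus H)\cup(T\setminus S)\}$, and $F_2=\{p \text{ path of } E: |p|>0,\ \mathbf{r}(p)\in T\setminus S\}$. The graph $(G,T)/(H,S)$ has vertex set $(G\setminus H)\cup(T\setminus S)\cup\{w^p: p\in F_1\cup F_2\}\cup\{v': v\in((G\cup T)\setminus S)\cap B^G_H\}$ (with $w^p,v'$ new symbols) and edge set consisting of: (i) edges $e\in E^1$ with $\mathbf{r}(e)\in G\setminus H$ and $\mathbf{s}(e)\in (G\setminus H)\cup (T\setminus S)$, with the same source and range as in $E$; (ii) new edges $f^p$ for $p\in F_1\cup F_2$, where for an edge $e\in F_1\cup F_2$ one sets $\mathbf{s}(f^e)=w^e$, $\mathbf{r}(f^e)=\mathbf{r}(e)$, and for $p=eq$ with $e\in E^1$, $q\in F_1\cup F_2$, $|q|>0$, one sets $\mathbf{s}(f^p)=w^p$, $\mathbf{r}(f^p)=w^q$; (iii) new edges $e'$ for each $e\in E^1$ with $\mathbf{r}(e)\in((G\cup T)\setminus S)\cap B^G_H$, with $\mathbf{r}(e')=\mathbf{r}(e)'$ and: if $\mathbf{r}(e)\in(G\setminus S)\cap B^G_H$ and $\mathbf{s}(e)\in(G\setminus H)\cup(T\setminus S)$ then $\mathbf{s}(e')=\mathbf{s}(e)$;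 if $\mathbf{r}(e)\in(G\setminus S)\cap B^G_H$ and $\mathbf{s}(e)\notin(G\setminus H)\cup(T\setminus S)$ (so $e\in F_1$) then $\mathbf{s}(e')=w^e$; if $\mathbf{r}(e)\in (T\setminus S)\cap B^G_H$ (so $e\in F_2$) then $\mathbf{s}(e')=w^e$. *)

theory Defs
  imports Main
begin

record ('v,'e) graph =
  verts :: "'v set"
  edges :: "'e set"
  src   :: "'e \<Rightarrow> 'v"
  rng   :: "'e \<Rightarrow> 'v"

definition wf_graph :: "('v,'e) graph \<Rightarrow> bool" where
  "wf_graph E \<longleftrightarrow> (\<forall>e\<in>edges E. src E e \<in> verts E \<and> rng E e \<in> verts E)"

definition is_path :: "('v,'e) graph \<Rightarrow> 'e list \<Rightarrow> bool" where
  "is_path E p \<longleftrightarrow> p \<noteq> [] \<and> set p \<subseteq> edges E \<and>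
     (\<forall>i. Suc i < length p \<longrightarrow> rng E (p ! i) = src E (p ! Suc i))"

definition emits :: "('v,'e) graph \<Rightarrow> 'v \<Rightarrow> 'e set" where
  "emits E v = {e \<in> edges E. src E e = v}"

definition inf_emitter :: "('v,'e) graph \<Rightarrow> 'v \<Rightarrow> bool" where
  "inf_emitter E v \<longleftrightarrow> infinite (emits E v)"

definition hereditary :: "('v,'e) graph \<Rightarrow> 'v set \<Rightarrow> bool" where
  "hereditary E H \<longleftrightarrow> H \<subseteq> verts E \<and>
     (\<forall>p. is_path E p \<and> src E (hd p) \<in> H \<longrightarrow> rng E (last p) \<in> H)"

definition saturated :: "('v,'e) graph \<Rightarrow> 'v set \<Rightarrow> bool" where
  "saturated E H \<longleftrightarrow> (\<forall>v\<in>verts E. finite (emits E v) \<and> emits E v \<noteq> {} \<and>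
      rng E ` emits E v \<subseteq> H \<longrightarrow> v \<in> H)"

definition breaking :: "('v,'e) graph \<Rightarrow> 'v set \<Rightarrow> 'v set" where
  "breaking E H = {v \<in> verts E - H. inf_emitter E v \<and>
      finite {e \<in> emits E v. rng E e \<in> verts E - H} \<and> {e \<in> emits E v. rng E e \<in> verts E - H} \<noteq> {}}"

definition admissible :: "('v,'e) graph \<Rightarrow> 'v set \<Rightarrow> 'v set \<Rightarrow> bool" where
  "admissible E H S \<longleftrightarrow> hereditary E H \<and> saturated E H \<and> S \<subseteq> breaking E H"

definition adm_le :: "'v set \<Rightarrow> 'v set \<Rightarrow> 'v set \<Rightarrow> 'v set \<Rightarrow> bool" where
  "adm_le H S G T \<longleftrightarrow> H \<subseteq> G \<and> S \<subseteq> G \<union> T"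

datatype ('v,'e) pq_vert = OldV 'v | WV "'e list" | PrimeV 'v
datatype ('v,'e) pq_edge = OldE 'e | FE "'e list" | PrimeE 'e

definition breaking_rel :: "('v,'e) graph \<Rightarrow> 'v set \<Rightarrow> 'v set \<Rightarrow> 'v set" where
  "breaking_rel E H G = {v \<in> verts E - H. inf_emitter E v \<and>
      finite {e \<in> emits E v. rng E e \<in> G - H} \<and> {e \<in> emits E v. rng E e \<in> G - H} \<noteq> {}}"

definition pqF1 :: "('v,'e) graph \<Rightarrow> 'v set \<Rightarrow> 'v set \<Rightarrow> 'v set \<Rightarrow> 'v set \<Rightarrow> 'e list set" where
  "pqF1 E H S G T = {p. is_path E p \<and> rng E (last p) \<in> G - H \<and>
      src E (last p) \<notin> (G - H) \<union> (T - S)}"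

definition pqF2 :: "('v,'e) graph \<Rightarrow> 'v set \<Rightarrow> 'v set \<Rightarrow> 'v set \<Rightarrow> 'v set \<Rightarrow> 'e list set" where
  "pqF2 E H S G T = {p. is_path E p \<and> rng E (last p) \<in> T - S}"

definition pq_graph :: "('v,'e) graph \<Rightarrow> 'v set \<Rightarrow> 'v set \<Rightarrow> 'v set \<Rightarrow> 'v set
    \<Rightarrow> (('v,'e) pq_vert, ('v,'e) pq_edge) graph" where
  "pq_graph E H S G T =
    \<lparr> verts = OldV ` ((G - H) \<union> (T - S))
             \<union> WV ` (pqF1 E H S G T \<union> pqF2 E H S G T)
             \<union> PrimeV ` (((G \<union> T) - S) \<inter> breaking_rel E H G),
      edges = OldE ` {e \<in> edges E. rng E e \<in> G - H \<and> src E e \<in> (G - H) \<union> (T - S)}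
             \<union> FE ` (pqF1 E H S G T \<union> pqF2 E H S G T)
             \<union> PrimeE ` {e \<in> edges E. rng E e \<in> ((G \<union> T) - S) \<inter> breaking_rel E H G},
      src = (\<lambda>x. case x of
               OldE e \<Rightarrow> OldV (src E e)
             | FE p \<Rightarrow> WV p
             | PrimeE e \<Rightarrow>
                 (if rng E e \<in> (G - S) \<inter> breaking_rel E H G \<and> src E e \<in> (G - H) \<union> (T - S)
                  then OldV (src E e) else WV [e])),
      rng = (\<lambda>x. case x of
               OldE e \<Rightarrow> OldV (rng E e)
             | FE p \<Rightarrow> (if length p = 1 then OldV (rng E (hd p)) else WV (tl p))
             | PrimeE e \<Rightarrow> PrimeV (rng E e)) \<rparr>"

record ('k,'a) kalg =
  acarrier :: "'a set"
  aadd :: "'a \<Rightarrow> 'a \<Rightarrow> 'a"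
  azero :: 'a
  asmul :: "'k \<Rightarrow> 'a \<Rightarrow> 'a"
  amul :: "'a \<Rightarrow> 'a \<Rightarrow> 'a"
  ahomog :: "int \<Rightarrow> 'a set"

inductive_set ideal_gen :: "('k,'a) kalg \<Rightarrow> 'a set \<Rightarrow> 'a set" for A X where
  base: "x \<in> X \<Longrightarrow> x \<in> acarrier A \<Longrightarrow> x \<in> ideal_gen A X"
| zero: "azero A \<in> ideal_gen A X"
| add: "x \<in> ideal_gen A X \<Longrightarrow> y \<in> ideal_gen A X \<Longrightarrow> aadd A x y \<in> ideal_gen A X"
| smul: "x \<in> ideal_gen A X \<Longrightarrow> asmul A c x \<in> ideal_gen A X"
| lmul: "a \<in> acarrier A \<Longrightarrow> x \<in> ideal_gen A X \<Longrightarrow> amul A a x \<in> ideal_gen A X"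
| rmul: "a \<in> acarrier A \<Longrightarrow> x \<in> ideal_gen A X \<Longrightarrow> amul A x a \<in> ideal_gen A X"

definition qclass :: "('k::field,'a) kalg \<Rightarrow> 'a set \<Rightarrow> 'a \<Rightarrow> 'a set" where
  "qclass A I a = {b \<in> acarrier A. aadd A a (asmul A (-1) b) \<in> I}"

definition rep :: "'a set \<Rightarrow> 'a" where
  "rep X = (SOME x. x \<in> X)"

text \<open>Quotient algebra A/I (meaningful when I is an ideal of A), with the induced grading.\<close>
definition quot :: "('k::field,'a) kalg \<Rightarrow> 'a set \<Rightarrow> ('k,'a set) kalg" where
  "quot A I = \<lparr> acarrier = qclass A I ` acarrier A,
      aadd = (\<lambda>X Y. qclass A I (aadd A (rep X) (rep Y))),
      azero = qclass A I (azero A),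
      asmul = (\<lambda>c X. qclass A I (asmul A c (rep X))),
      amul = (\<lambda>X Y. qclass A I (amul A (rep X) (rep Y))),
      ahomog = (\<lambda>n. qclass A I ` ahomog A n) \<rparr>"

definition restr :: "('k,'a) kalg \<Rightarrow> 'a set \<Rightarrow> ('k,'a) kalg" where
  "restr A I = A\<lparr> acarrier := I, ahomog := (\<lambda>n. ahomog A n \<inter> I) \<rparr>"

definition graded_iso :: "('k,'a) kalg \<Rightarrow> ('k,'b) kalg \<Rightarrow> ('a \<Rightarrow> 'b) \<Rightarrow> bool" where
  "graded_iso A B f \<longleftrightarrow> bij_betw f (acarrier A) (acarrier B) \<and>
     (\<forall>x\<in>acarrier A. \<forall>y\<in>acarrier A.
        f (aadd A x y) = aadd B (f x) (f y) \<and> f (amul A x y) = amul B (f x) (f y)) \<and>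
     (\<forall>c. \<forall>x\<in>acarrier A. f (asmul A c x) = asmul B c (f x)) \<and>
     (\<forall>n. f ` ahomog A n = ahomog B n)"

datatype ('v,'e) gen = GV 'v | GE 'e | GS 'e

definition gen_ok :: "('v,'e) graph \<Rightarrow> ('v,'e) gen \<Rightarrow> bool" where
  "gen_ok E g = (case g of GV v \<Rightarrow> v \<in> verts E | GE e \<Rightarrow> e \<in> edges E | GS e \<Rightarrow> e \<in> edges E)"

definition gdeg :: "('v,'e) gen \<Rightarrow> int" where
  "gdeg g = (case g of GV v \<Rightarrow> 0 | GE e \<Rightarrow> 1 | GS e \<Rightarrow> -1)"

definition wdeg :: "('v,'e) gen list \<Rightarrow> int" where
  "wdeg w = sum_list (map gdeg w)"

text \<open>Elements: finitely supported K-valued functions on nonempty words.\<close>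
definition fmul :: "('g list \<Rightarrow> 'k::field) \<Rightarrow> ('g list \<Rightarrow> 'k) \<Rightarrow> 'g list \<Rightarrow> 'k" where
  "fmul f g w = (\<Sum>i\<le>length w. f (take i w) * g (drop i w))"

definition fsub :: "('g list \<Rightarrow> 'k::field) \<Rightarrow> ('g list \<Rightarrow> 'k) \<Rightarrow> 'g list \<Rightarrow> 'k" where
  "fsub f g w = f w - g w"

definition free_carrier :: "('v,'e) graph \<Rightarrow> (('v,'e) gen list \<Rightarrow> 'k::field) set" where
  "free_carrier E = {f. finite {w. f w \<noteq> 0} \<and> f [] = 0 \<and>
      (\<forall>w. f w \<noteq> 0 \<longrightarrow> (\<forall>g\<in>set w. gen_ok E g))}"

definition free_alg :: "('v,'e) graph \<Rightarrow> ('k::field, ('v,'e) gen list \<Rightarrow> 'k) kalg" where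
  "free_alg E = \<lparr> acarrier = free_carrier E,
      aadd = (\<lambda>f g w. f w + g w),
      azero = (\<lambda>w. 0),
      asmul = (\<lambda>c f w. c * f w),
      amul = fmul,
      ahomog = (\<lambda>n. {f \<in> free_carrier E. \<forall>w. f w \<noteq> 0 \<longrightarrow> wdeg w = n}) \<rparr>"

definition wel :: "'g list \<Rightarrow> 'g list \<Rightarrow> 'k::field" where
  "wel w = (\<lambda>u. if u = w then 1 else 0)"

definition gv :: "'v \<Rightarrow> ('v,'e) gen list \<Rightarrow> 'k::field" where "gv v = wel [GV v]"
definition ge :: "'e \<Rightarrow> ('v,'e) gen list \<Rightarrow> 'k::field" where "ge e = wel [GE e]"
definition gs :: "'e \<Rightarrow> ('v,'e) gen list \<Rightarrow> 'k::field" where "gs e = wel [GS e]"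

definition lpa_rels :: "('v,'e) graph \<Rightarrow> (('v,'e) gen list \<Rightarrow> 'k::field) set" where
  "lpa_rels E =
     {fsub (fmul (gv v) (gv u)) (if v = u then gv v else (\<lambda>w. 0)) | v u. v \<in> verts E \<and> u \<in> verts E}
   \<union> {fsub (fmul (gv (src E e)) (ge e)) (ge e) | e. e \<in> edges E}
   \<union> {fsub (fmul (ge e) (gv (rng E e))) (ge e) | e. e \<in> edges E}
   \<union> {fsub (fmul (gv (rng E e)) (gs e)) (gs e) | e. e \<in> edges E}
   \<union> {fsub (fmul (gs e) (gv (src E e))) (gs e) | e. e \<in> edges E}
   \<union> {fsub (fmul (gs e) (ge f)) (if e = f then gv (rng E e) else (\<lambda>w. 0)) | e f. e \<in> edges E \<and> f \<in> edges E}
   \<union> {fsub (gv v) (\<lambda>w. \<Sum>e\<in>emits E v. fmul (ge e) (gs e) w) | v.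
        v \<in> verts E \<and> finite (emits E v) \<and> emits E v \<noteq> {}}"

definition lpa_ideal :: "('v,'e) graph \<Rightarrow> (('v,'e) gen list \<Rightarrow> 'k::field) set" where
  "lpa_ideal E = ideal_gen (free_alg E) (lpa_rels E)"

definition LPA :: "('v,'e) graph \<Rightarrow> ('k::field, (('v,'e) gen list \<Rightarrow> 'k) set) kalg" where
  "LPA E = quot (free_alg E) (lpa_ideal E)"

definition lcls :: "('v,'e) graph \<Rightarrow> (('v,'e) gen list \<Rightarrow> 'k::field) \<Rightarrow> (('v,'e) gen list \<Rightarrow> 'k) set" where
  "lcls E x = qclass (free_alg E) (lpa_ideal E) x"

definition vH :: "('v,'e) graph \<Rightarrow> 'v set \<Rightarrow> 'v \<Rightarrow> ('v,'e) gen list \<Rightarrow> 'k::field" where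
  "vH E H v = fsub (gv v) (\<lambda>w. \<Sum>e\<in>{e \<in> emits E v. rng E e \<in> verts E - H}. fmul (ge e) (gs e) w)"

definition adm_ideal :: "('v,'e) graph \<Rightarrow> 'v set \<Rightarrow> 'v set \<Rightarrow> (('v,'e) gen list \<Rightarrow> 'k::field) set set" where
  "adm_ideal E H S = ideal_gen (LPA E) (lcls E ` ({gv v | v. v \<in> H} \<union> {vH E H v | v. v \<in> S}))"

end

theory Submission
  imports Defs "HOL.Vector_Spaces" "HOL-Library.Function_Algebras" "HOL-Library.Product_Plus"
begin

text \<open>
  Write \<open>P = (G,T)/(H,S)\<close>. There is a graph morphism \<open>P \<rightarrow> E\<close> (\<open>base_vert\<close>, \<open>base_edge\<close>) along which edges
  lift uniquely backwards: for an edge \<open>e\<close> of \<open>E\<close> and a vertex \<open>u\<close> of \<open>P\<close> over \<open>r(e)\<close> exactly one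
  edge over \<open>e\<close> ends in \<open>u\<close>.

  In \<open>L(E)/I(H,S)\<close> put \<open>Q(v') = v\<^sup>H\<close>, \<open>Q(v) + Q(v') = v\<close> for \<open>v \<in> G\<close> and \<open>Q(v) + Q(v') = v\<^sup>G\<close> for
  \<open>v \<in> T\<close> (without \<open>Q(v')\<close> if \<open>v'\<close> is not a vertex), and \<open>Q(w\<^sup>p) = p (Q(v) + Q(v')) p\<^sup>*\<close> for \<open>v = r(p)\<close>.
  These idempotents together with \<open>x \<mapsto> e Q(r(x))\<close> and \<open>x\<^sup>* \<mapsto> Q(r(x)) e\<^sup>*\<close>, for \<open>x\<close> over \<open>e\<close>,
  satisfy the relations of \<open>L(P)\<close>. The resulting image is a two-sided ideal, because a generator
  of \<open>L(E)\<close> times some \<open>Q(u)\<close> is a sum of generators of \<open>L(P)\<close>; it contains the generators of \<open>I(G,T)\<close>.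

  Injectivity does not use a graded uniqueness theorem: by unique lifting, \<open>L(E)\<close> acts on
  \<open>L(P)\<close>-valued functions on the vertices of \<open>P\<close>, this action kills \<open>I(H,S)\<close>, and restricted to
  \<open>L(P)\<close> it is left multiplication, which is faithful because of local units.
\<close>

subsection \<open>Rings of endomorphisms and products of rings\<close>

text \<open>The algebras are records without axioms, their elements are classes of functions, and
  \<open>LPA E\<close> has no unit when \<open>E\<close> has infinitely many vertices. Calculation
  is therefore moved into rings of additive endomorphisms. There \<open>L(P)\<close> and
  \<open>I(G,T)/I(H,S)\<close> are both embedded in one ring and compared degree by degree, so the
  isomorphism never has to be defined on classes. The ring has to detect two kernels,
  \<open>I(H,S)\<close> on the side of \<open>E\<close> and zero on the side of \<open>P\<close>;
  this is why a product of two representations occurs.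

  The choice of idempotents answers two obstacles. A vertex of \<open>T\<close> is not in
  \<open>I(G,T)\<close>; only \<open>v^G\<close>, its share along edges into \<open>G\<close>, is.
  And an infinite emitter of \<open>E\<close> may emit a finite nonzero number of edges into
  \<open>G - H\<close>, so that it becomes regular in \<open>P\<close> although \<open>E\<close>
  imposes no Cuntz-Krieger relation at it. The defect of that relation is \<open>v^H\<close>. It
  vanishes for \<open>v\<close> in \<open>S\<close>; otherwise it annihilates every edge at
  \<open>v\<close>, so it must be the idempotent of an extra sink, which is
  \<open>v'\<close>.\<close>

typedef (overloaded) 'a endo = "{f :: 'a::ab_group_add \<Rightarrow> 'a. \<forall>x y. f (x + y) = f x + f y}"
  morphisms app Endo
  by (rule exI[of _ "\<lambda>x. x"]) simp

setup_lifting type_definition_endo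

text \<open>The identity map acts as a unit even for algebras that have none. \<open>ring_1\<close>
  would demand \<open>0 \<noteq> 1\<close>, which fails for the trivial group; hence the pair
  \<open>{ring, monoid_mult}\<close>.\<close>

instantiation endo :: (ab_group_add) "{ring, monoid_mult}"
begin
lift_definition zero_endo :: "'a endo" is "\<lambda>x. 0" by simp
lift_definition one_endo :: "'a endo" is "\<lambda>x. x" by simp
lift_definition plus_endo :: "'a endo \<Rightarrow> 'a endo \<Rightarrow> 'a endo" is "\<lambda>f g x. f x + g x"
  by (simp add: algebra_simps)
lift_definition minus_endo :: "'a endo \<Rightarrow> 'a endo \<Rightarrow> 'a endo" is "\<lambda>f g x. f x - g x"
  by (simp add: algebra_simps)
lift_definition uminus_endo :: "'a endo \<Rightarrow> 'a endo" is "\<lambda>f x. - f x"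
  by (simp add: algebra_simps)
lift_definition times_endo :: "'a endo \<Rightarrow> 'a endo \<Rightarrow> 'a endo" is "\<lambda>f g x. f (g x)"
  by simp
instance
  by standard (transfer; simp add: algebra_simps fun_eq_iff)+
end

lemma endo_eqI: "(\<And>x. app f x = app g x) \<Longrightarrow> f = g"
  by transfer auto

lemma app_ops [simp]:
  "app 0 x = 0" "app 1 x = x" "app (f + g) x = app f x + app g x"
  "app (f - g) x = app f x - app g x" "app (- f) x = - app f x" "app (f * g) x = app f (app g x)"
  by (transfer; simp)+

lemma app_sum: "app (sum f A) x = (\<Sum>a\<in>A. app (f a) x)"
  by (induction A rule: infinite_finite_induct) simp_all

lemma app_Endo: "(\<And>x y. f (x + y) = f x + f y) \<Longrightarrow> app (Endo f) = f"
  by (simp add: Endo_inverse)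

lemma sum_fun_apply: "(sum f A) x = (\<Sum>a\<in>A. f a x)"
  by (induction A rule: infinite_finite_induct) simp_all

text \<open>The kernel of a pair of homomorphisms is the intersection of the two kernels, so a
  product lets one ring carry two representations at once.\<close>

instantiation prod :: ("{ring, monoid_mult}", "{ring, monoid_mult}") "{ring, monoid_mult}"
begin
definition one_prod :: "'a \<times> 'b" where "one_prod = (1, 1)"
definition times_prod :: "'a \<times> 'b \<Rightarrow> 'a \<times> 'b \<Rightarrow> 'a \<times> 'b"
  where "times_prod x y = (fst x * fst y, snd x * snd y)"
instance
  by standard (simp_all add: one_prod_def times_prod_def prod_eq_iff algebra_simps)
end

lemma fst_times [simp]: "fst (x * y) = fst x * fst y"
  and snd_times [simp]: "snd (x * y) = snd x * snd y"
  and fst_one [simp]: "fst 1 = 1" and snd_one [simp]: "snd 1 = 1"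
  by (simp_all add: one_prod_def times_prod_def)

subsection \<open>Homomorphisms from algebra records to rings\<close>

text \<open>Endomorphisms are only additive, so the field acts through a ring homomorphism whose
  image need not be central. Commutation with \<open>sc\<close> is stated separately where it is
  used.\<close>

definition scalars :: "('k::field \<Rightarrow> 'r::{ring,monoid_mult}) \<Rightarrow> bool" where
  "scalars sc \<longleftrightarrow> sc 1 = 1 \<and> (\<forall>a b. sc (a + b) = sc a + sc b) \<and> (\<forall>a b. sc (a * b) = sc a * sc b)"

lemma scalars_simps:
  assumes "scalars sc"
  shows "sc 1 = 1" "sc (a + b) = sc a + sc b" "sc (a * b) = sc a * sc b" "sc 0 = 0"
    "sc (- a) = - sc a" "sc (a - b) = sc a - sc b"
proof -
  show 1: "sc 1 = 1" "sc (a + b) = sc a + sc b" "sc (a * b) = sc a * sc b" for a b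
    using assms by (auto simp: scalars_def)
  have 0: "sc 0 = 0" using 1(2)[of 0 0] by simp
  have m: "sc (- a) = - sc a" for a
    using 1(2)[of a "- a"] 0 by (simp add: eq_neg_iff_add_eq_0 add.commute)
  show "sc 0 = 0" "sc (- a) = - sc a" by (fact 0, fact m)
  show "sc (a - b) = sc a - sc b" using 1(2)[of a "- b"] m by simp
qed

text \<open>Since \<open>kalg\<close> carries no axioms, closure of the carrier under the operations
  is part of the notion.\<close>

definition alg_hom :: "('k::field,'a) kalg \<Rightarrow> ('k \<Rightarrow> 'r::{ring,monoid_mult}) \<Rightarrow> ('a \<Rightarrow> 'r) \<Rightarrow> bool" where
  "alg_hom A sc h \<longleftrightarrow> scalars sc \<and> azero A \<in> acarrier A \<and> h (azero A) = 0 \<and>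
     (\<forall>x\<in>acarrier A. \<forall>y\<in>acarrier A. aadd A x y \<in> acarrier A \<and> h (aadd A x y) = h x + h y \<and>
        amul A x y \<in> acarrier A \<and> h (amul A x y) = h x * h y) \<and>
     (\<forall>c. \<forall>x\<in>acarrier A. asmul A c x \<in> acarrier A \<and> h (asmul A c x) = sc c * h x)"

lemma alg_homD:
  assumes "alg_hom A sc h"
  shows "scalars sc" "azero A \<in> acarrier A" "h (azero A) = 0"
    "x \<in> acarrier A \<Longrightarrow> y \<in> acarrier A \<Longrightarrow> aadd A x y \<in> acarrier A"
    "x \<in> acarrier A \<Longrightarrow> y \<in> acarrier A \<Longrightarrow> h (aadd A x y) = h x + h y"
    "x \<in> acarrier A \<Longrightarrow> y \<in> acarrier A \<Longrightarrow> amul A x y \<in> acarrier A"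
    "x \<in> acarrier A \<Longrightarrow> y \<in> acarrier A \<Longrightarrow> h (amul A x y) = h x * h y"
    "x \<in> acarrier A \<Longrightarrow> asmul A c x \<in> acarrier A"
    "x \<in> acarrier A \<Longrightarrow> h (asmul A c x) = sc c * h x"
  using assms by (auto simp: alg_hom_def)

lemma alg_hom_diff:
  assumes "alg_hom A sc h" "x \<in> acarrier A" "y \<in> acarrier A"
  shows "aadd A x (asmul A (-1) y) \<in> acarrier A" "h (aadd A x (asmul A (-1) y)) = h x - h y"
  using assms alg_homD[OF assms(1)] scalars_simps(1,5)[OF alg_homD(1)[OF assms(1)]] by simp_all

lemma ideal_gen_carrier:
  assumes "alg_hom A sc h" "x \<in> ideal_gen A X"
  shows "x \<in> acarrier A"
  using assms(2) by induction (use alg_homD[OF assms(1)] in auto)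

lemma alg_hom_ideal_gen_zero:
  assumes h: "alg_hom A sc h" and X: "\<And>x. x \<in> X \<Longrightarrow> x \<in> acarrier A \<Longrightarrow> h x = 0" and x: "x \<in> ideal_gen A X"
  shows "h x = 0"
  using x by induction (use alg_homD[OF h] ideal_gen_carrier[OF h] X in auto)

text \<open>By \<open>refl\<close> a class contains its own element, so \<open>rep\<close> picks a
  genuine member; \<open>h\<close> is constant on classes because it kills \<open>I\<close>.\<close>

lemma alg_hom_quot:
  assumes h: "alg_hom A sc h" and I: "\<And>x. x \<in> acarrier A \<Longrightarrow> x \<in> I \<Longrightarrow> h x = 0"
    and refl: "\<And>x. x \<in> acarrier A \<Longrightarrow> aadd A x (asmul A (-1) x) \<in> I"
  shows "x \<in> acarrier A \<Longrightarrow> rep (qclass A I x) \<in> acarrier A"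
    and "x \<in> acarrier A \<Longrightarrow> h (rep (qclass A I x)) = h x"
    and "alg_hom (quot A I) sc (h \<circ> rep)"
proof -
  have rep: "rep (qclass A I x) \<in> acarrier A \<and> h (rep (qclass A I x)) = h x" if x: "x \<in> acarrier A" for x
  proof -
    have "x \<in> qclass A I x" using refl x by (simp add: qclass_def)
    then have r: "rep (qclass A I x) \<in> qclass A I x" unfolding rep_def by (rule someI)
    then have "rep (qclass A I x) \<in> acarrier A" by (simp add: qclass_def)
    moreover have "h (aadd A x (asmul A (-1) (rep (qclass A I x)))) = 0"
      using r x alg_hom_diff[OF h] by (intro I) (auto simp: qclass_def)
    ultimately show ?thesis using alg_hom_diff[OF h x] by simp
  qed
  then show "x \<in> acarrier A \<Longrightarrow> rep (qclass A I x) \<in> acarrier A"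
    and "x \<in> acarrier A \<Longrightarrow> h (rep (qclass A I x)) = h x" by auto
  show "alg_hom (quot A I) sc (h \<circ> rep)"
    unfolding alg_hom_def quot_def using alg_homD[OF h] rep by (auto simp del: One_nat_def)
qed

text \<open>When \<open>I\<close> is the whole kernel, the classes are exactly the fibres of
  \<open>h\<close>.\<close>

lemma alg_hom_quot_inj:
  assumes h: "alg_hom A sc h" and I: "\<And>x. x \<in> acarrier A \<Longrightarrow> x \<in> I \<longleftrightarrow> h x = 0"
  shows "alg_hom (quot A I) sc (h \<circ> rep)" "inj_on (h \<circ> rep) (acarrier (quot A I))"
    "\<And>x. x \<in> acarrier A \<Longrightarrow> h (rep (qclass A I x)) = h x"
    "\<And>x y. x \<in> acarrier A \<Longrightarrow> y \<in> acarrier A \<Longrightarrow> qclass A I x = qclass A I y \<longleftrightarrow> h x = h y"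
proof -
  have refl: "aadd A x (asmul A (-1) x) \<in> I" if "x \<in> acarrier A" for x
    using alg_hom_diff[OF h that that] I by simp
  note * = alg_hom_quot[where I = I, OF h _ refl]
  show 1: "alg_hom (quot A I) sc (h \<circ> rep)" by (rule *(3)) (use I in auto)
  show 2: "h (rep (qclass A I x)) = h x" if "x \<in> acarrier A" for x by (rule *(2)) (use I that in auto)
  have q: "qclass A I x = {y \<in> acarrier A. h y = h x}" if "x \<in> acarrier A" for x
    using that alg_hom_diff[OF h that] I by (auto simp: qclass_def)
  show 4: "qclass A I x = qclass A I y \<longleftrightarrow> h x = h y" if "x \<in> acarrier A" "y \<in> acarrier A" for x y
    using that q by auto
  show "inj_on (h \<circ> rep) (acarrier (quot A I))"
    by (auto simp: inj_on_def quot_def 2 4)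
qed

text \<open>Every law for the composite of \<open>f\<close> with the inverse of \<open>g\<close> is
  checked after applying \<open>g\<close>, where it becomes a law in the common ring.\<close>

lemma graded_iso_if_same_image:
  assumes f: "alg_hom A sc f" "inj_on f (acarrier A)" and g: "alg_hom B sc g" "inj_on g (acarrier B)"
    and im: "f ` acarrier A = g ` acarrier B"
    and sub: "\<And>n. ahomog A n \<subseteq> acarrier A" "\<And>n. ahomog B n \<subseteq> acarrier B"
    and hom: "\<And>n. f ` ahomog A n = g ` ahomog B n"
  shows "graded_iso A B (inv_into (acarrier B) g \<circ> f)"
proof -
  let ?p = "inv_into (acarrier B) g \<circ> f"
  have p: "?p x \<in> acarrier B" "g (?p x) = f x" if "x \<in> acarrier A" for x
  proof -
    have "f x \<in> g ` acarrier B" using that im by auto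
    then show "?p x \<in> acarrier B" "g (?p x) = f x" by (auto intro: inv_into_into f_inv_into_f)
  qed
  have eq: "?p x = y" if "x \<in> acarrier A" "y \<in> acarrier B" "f x = g y" for x y
    using that p[OF that(1)] g(2) by (auto simp: inj_on_def)
  have "bij_betw ?p (acarrier A) (acarrier B)"
    by (rule bij_betw_trans[OF _ bij_betw_inv_into[of g "acarrier B" "g ` acarrier B"]])
       (use f(2) g(2) im in \<open>auto simp: bij_betw_def\<close>)
  moreover have "?p ` ahomog A n = ahomog B n" for n
  proof (intro equalityI subsetI)
    fix y assume "y \<in> ?p ` ahomog A n"
    then obtain x where x: "x \<in> ahomog A n" "y = ?p x" by auto
    then obtain z where "z \<in> ahomog B n" "f x = g z" using hom[of n] by blast
    then show "y \<in> ahomog B n" using x eq sub by (metis subsetD)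
  next
    fix y assume y: "y \<in> ahomog B n"
    then obtain x where "x \<in> ahomog A n" "f x = g y" using hom[of n] by (metis imageE imageI)
    then show "y \<in> ?p ` ahomog A n" using y eq sub by (metis image_eqI subsetD)
  qed
  moreover have "?p (aadd A x y) = aadd B (?p x) (?p y)" "?p (amul A x y) = amul B (?p x) (?p y)"
    if "x \<in> acarrier A" "y \<in> acarrier A" for x y
    by (rule eq; simp add: that p alg_homD[OF f(1)] alg_homD[OF g(1)] del: o_apply)+
  moreover have "?p (asmul A c x) = asmul B c (?p x)" if "x \<in> acarrier A" for c x
    by (rule eq; simp add: that p alg_homD[OF f(1)] alg_homD[OF g(1)] del: o_apply)
  ultimately show ?thesis
    unfolding graded_iso_def by (intro conjI ballI allI) simp_all
qed

subsection \<open>The free algebra\<close>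

lemma fmul_Nil: "fmul f g [] = f [] * g []"
  by (simp add: fmul_def)

text \<open>Separating the cut before the first letter turns the convolution into a recursion in
  which the left factor is replaced by its derivative \<open>\<lambda>u. f (x # u)\<close>.
  Associativity then needs no reindexing of double sums.\<close>

lemma fmul_Cons: "fmul f g (x # w) = f [] * g (x # w) + fmul (\<lambda>u. f (x # u)) g w"
  unfolding fmul_def by (simp add: sum.atMost_Suc_shift del: sum.atMost_Suc)

lemma fmul_add_left: "fmul (f + g) h = fmul f h + fmul g h"
  and fmul_add_right: "fmul f (g + h) = fmul f g + fmul f h"
  and fmul_scale_left: "fmul (\<lambda>w. c * f w) h = (\<lambda>w. c * fmul f h w)"
  and fmul_scale_right: "fmul f (\<lambda>w. c * h w) = (\<lambda>w. c * fmul f h w)"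
  and fmul_zero_left: "fmul 0 h = 0"
  and fmul_zero_right: "fmul f 0 = 0"
  by (auto simp: fmul_def fun_eq_iff algebra_simps sum.distrib sum_distrib_left)

lemma fmul_assoc: "fmul (fmul f g) h = fmul f (fmul g h)"
proof
  show "fmul (fmul f g) h w = fmul f (fmul g h) w" for w
  proof (induction w arbitrary: f)
    case Nil
    show ?case by (simp add: fmul_Nil mult.assoc)
  next
    case (Cons x w)
    \<comment> \<open>Product rule for the derivative: the cut before \<open>x\<close> contributes
      the constant term of \<open>f\<close> times the derivative of \<open>g\<close>.\<close>
    have "(\<lambda>u. fmul f g (x # u)) = (\<lambda>w. f [] * (\<lambda>u. g (x # u)) w) + fmul (\<lambda>u. f (x # u)) g"
      by (simp add: fun_eq_iff fmul_Cons)
    then show ?case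
      by (simp add: fmul_Cons fmul_Nil fmul_add_left fmul_scale_left Cons.IH algebra_simps)
  qed
qed

lemma fmul_wel_Cons_left: "fmul (wel (x # u)) f (y # w) = (if x = y then fmul (wel u) f w else 0)"
proof -
  have *: "(\<lambda>v. wel (x # u) (y # v)) = (if x = y then wel u else 0)"
    by (auto simp: wel_def)
  have "fmul (\<lambda>v. wel (x # u) (y # v)) f w = (if x = y then fmul (wel u) f w else 0)"
    unfolding * by (simp add: fmul_zero_left)
  then show ?thesis by (simp only: fmul_Cons) (simp add: wel_def)
qed

lemma fmul_wel_Nil_left [simp]: "fmul (wel []) f = f"
proof
  have *: "(\<lambda>u. wel [] (x # u)) = 0" for x by (auto simp: wel_def)
  show "fmul (wel []) f w = f w" for w
    by (cases w) (simp_all add: fmul_Nil fmul_Cons fmul_zero_left *, simp_all add: wel_def)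
qed

lemma fmul_wel_Nil_right [simp]: "fmul f (wel []) = f"
proof
  show "fmul f (wel []) w = f w" for w
    by (induction w arbitrary: f) (auto simp: fmul_Nil fmul_Cons wel_def)
qed

lemma fmul_wel: "fmul (wel u) (wel v) = wel (u @ v)"
proof
  show "fmul (wel u) (wel v) w = wel (u @ v) w" for w
  proof (induction u arbitrary: w)
    case Nil
    show ?case by simp
  next
    case (Cons x u)
    show ?case
    proof (cases w)
      case Nil
      then show ?thesis by (simp add: fmul_Nil wel_def)
    next
      case (Cons y z)
      then show ?thesis using Cons.IH by (simp add: fmul_wel_Cons_left) (simp add: wel_def)
    qed
  qed
qed

lemma fmul_nonzeroD:
  assumes "fmul f g w \<noteq> 0"
  obtains u v where "w = u @ v" "f u \<noteq> 0" "g v \<noteq> 0"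
proof -
  from assms obtain i where "f (take i w) * g (drop i w) \<noteq> 0"
    unfolding fmul_def using sum.not_neutral_contains_not_neutral by blast
  then show ?thesis using that[of "take i w" "drop i w"] by auto
qed

text \<open>The free algebra with the empty word allowed. It contains the unit
  \<open>wel []\<close>, on which faithfulness of left multiplication can be tested;
  \<open>free_carrier\<close> is its augmentation ideal.\<close>

definition ufree_carrier :: "('v,'e) graph \<Rightarrow> (('v,'e) gen list \<Rightarrow> 'k::field) set" where
  "ufree_carrier E = {f. finite {w. f w \<noteq> 0} \<and> (\<forall>w. f w \<noteq> 0 \<longrightarrow> (\<forall>g\<in>set w. gen_ok E g))}"

lemma free_carrier_iff: "f \<in> free_carrier E \<longleftrightarrow> f \<in> ufree_carrier E \<and> f [] = 0"
  by (auto simp: free_carrier_def ufree_carrier_def)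

lemma ufree_carrier_add: "f \<in> ufree_carrier E \<Longrightarrow> g \<in> ufree_carrier E \<Longrightarrow> f + g \<in> ufree_carrier E"
  unfolding ufree_carrier_def
  by (auto intro: finite_subset[of _ "{w. f w \<noteq> 0} \<union> {w. g w \<noteq> 0}"])
     (metis add_0)

lemma ufree_carrier_scale: "f \<in> ufree_carrier E \<Longrightarrow> (\<lambda>w. c * f w) \<in> ufree_carrier E"
  unfolding ufree_carrier_def by (auto intro: finite_subset[of _ "{w. f w \<noteq> 0}"])

lemma ufree_carrier_mult:
  assumes "f \<in> ufree_carrier E" "g \<in> ufree_carrier E"
  shows "fmul f g \<in> ufree_carrier E"
proof -
  have "{w. fmul f g w \<noteq> 0} \<subseteq> (\<lambda>(u, v). u @ v) ` ({w. f w \<noteq> 0} \<times> {w. g w \<noteq> 0})"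
    by (auto elim!: fmul_nonzeroD)
  moreover have "finite ((\<lambda>(u, v). u @ v) ` ({w. f w \<noteq> 0} \<times> {w. g w \<noteq> 0}))"
    using assms by (auto simp: ufree_carrier_def)
  ultimately have "finite {w. fmul f g w \<noteq> 0}" by (rule finite_subset)
  then show ?thesis using assms unfolding ufree_carrier_def
    by (auto elim!: fmul_nonzeroD)
qed

lemma ufree_carrier_zero: "0 \<in> ufree_carrier E"
  by (simp add: ufree_carrier_def)

lemma ufree_carrier_wel: "(\<forall>g\<in>set w. gen_ok E g) \<Longrightarrow> wel w \<in> ufree_carrier E"
  by (auto simp: ufree_carrier_def wel_def split: if_splits)

lemma free_alg_simps [simp]:
  "acarrier (free_alg E) = free_carrier E" "aadd (free_alg E) f g = f + g" "azero (free_alg E) = 0"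
  "asmul (free_alg E) c f = (\<lambda>w. c * f w)" "amul (free_alg E) = fmul"
  "ahomog (free_alg E) n = {f \<in> free_carrier E. \<forall>w. f w \<noteq> 0 \<longrightarrow> wdeg w = n}"
  by (auto simp: free_alg_def fun_eq_iff)

lemma free_carrier_closed:
  "0 \<in> free_carrier E"
  "f \<in> free_carrier E \<Longrightarrow> g \<in> free_carrier E \<Longrightarrow> f + g \<in> free_carrier E"
  "f \<in> free_carrier E \<Longrightarrow> (\<lambda>w. c * f w) \<in> free_carrier E"
  "f \<in> free_carrier E \<Longrightarrow> g \<in> ufree_carrier E \<Longrightarrow> fmul f g \<in> free_carrier E"
  "f \<in> ufree_carrier E \<Longrightarrow> g \<in> free_carrier E \<Longrightarrow> fmul f g \<in> free_carrier E"
  "w \<noteq> [] \<Longrightarrow> (\<forall>g\<in>set w. gen_ok E g) \<Longrightarrow> wel w \<in> free_carrier E"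
  by (simp_all add: free_carrier_iff ufree_carrier_add ufree_carrier_scale ufree_carrier_mult
      ufree_carrier_zero ufree_carrier_wel fmul_Nil)
     (auto simp: wel_def)

lemma free_carrier_subset: "f \<in> free_carrier E \<Longrightarrow> f \<in> ufree_carrier E"
  by (simp add: free_carrier_iff)

lemma free_carrier_diff:
  "f \<in> free_carrier E \<Longrightarrow> g \<in> free_carrier E \<Longrightarrow> f - g \<in> free_carrier E"
  using free_carrier_closed(2)[OF _ free_carrier_closed(3)[of g E "-1"], of f]
  by (auto simp: fun_diff_def plus_fun_def)

lemma free_carrier_sum:
  "(\<And>i. i \<in> I \<Longrightarrow> f i \<in> free_carrier E) \<Longrightarrow> (\<lambda>w. \<Sum>i\<in>I. f i w) \<in> free_carrier E"
proof -
  assume *: "\<And>i. i \<in> I \<Longrightarrow> f i \<in> free_carrier E"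
  have "sum f I \<in> free_carrier E"
    using * by (induction I rule: infinite_finite_induct) (auto simp: free_carrier_closed)
  moreover have "sum f I = (\<lambda>w. \<Sum>i\<in>I. f i w)" by (simp add: fun_eq_iff sum_fun_apply)
  ultimately show ?thesis by simp
qed

lemma free_carrier_expand:
  assumes "f \<in> free_carrier E"
  shows "f = (\<Sum>w\<in>{w. f w \<noteq> 0}. (\<lambda>u. f w * wel w u))"
proof
  fix u
  have "(\<Sum>w\<in>{w. f w \<noteq> 0}. f w * wel w u) = (\<Sum>w\<in>{w. f w \<noteq> 0}. if w = u then f u else 0)"
    by (rule sum.cong) (auto simp: wel_def)
  also have "\<dots> = f u" using assms by (auto simp: free_carrier_def)
  finally show "f u = (\<Sum>w\<in>{w. f w \<noteq> 0}. (\<lambda>u. f w * wel w u)) u" by (simp add: sum_fun_apply)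
qed

lemma free_carrier_induct [consumes 1, case_names zero add wel]:
  assumes f: "f \<in> free_carrier E" and "P 0"
    and add: "\<And>f g. f \<in> free_carrier E \<Longrightarrow> g \<in> free_carrier E \<Longrightarrow> P f \<Longrightarrow> P g \<Longrightarrow> P (f + g)"
    and wel: "\<And>c w. w \<noteq> [] \<Longrightarrow> \<forall>g\<in>set w. gen_ok E g \<Longrightarrow> P (\<lambda>u. c * wel w u)"
  shows "P f"
proof -
  have "P (\<Sum>w\<in>W. (\<lambda>u. f w * wel w u)) \<and> (\<Sum>w\<in>W. (\<lambda>u. f w * wel w u)) \<in> free_carrier E"
    if "finite W" "W \<subseteq> {w. f w \<noteq> 0}" for W
    using that
  proof (induction W)
    case empty
    show ?case using \<open>P 0\<close> free_carrier_closed(1) unfolding sum.empty by blast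
  next
    case (insert w W)
    then have "w \<noteq> []" "\<forall>g\<in>set w. gen_ok E g" using f by (auto simp: free_carrier_def)
    then have "P (\<lambda>u. f w * wel w u)" "(\<lambda>u. f w * wel w u) \<in> free_carrier E"
      by (auto intro: wel free_carrier_closed)
    then show ?case using insert
      by (simp add: add free_carrier_closed(2) del: plus_fun_apply)
  qed
  from this[of "{w. f w \<noteq> 0}"] show ?thesis
    using f free_carrier_expand[OF f] by (auto simp: free_carrier_def)
qed

subsection \<open>Faithful homomorphisms modulo an ideal\<close>

text \<open>A linear projection \<open>\<theta>\<close> onto a complement of \<open>J\<close> in the unital free algebra turns left
  multiplication into a faithful action of the quotient on a type; this makes the quotient
  accessible to the type class machinery.\<close>

lemma exists_alg_hom_with_kernel:
  fixes J :: "(('v,'e) gen list \<Rightarrow> 'k::field) set"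
  assumes J: "J = ideal_gen (free_alg E) X" and X: "X \<subseteq> free_carrier E"
  shows "\<exists>(sc :: 'k \<Rightarrow> (('v,'e) gen list \<Rightarrow> 'k) endo) h.
    alg_hom (free_alg E) sc h \<and> (\<forall>c a. h a * sc c = sc c * h a) \<and>
    (\<forall>a\<in>free_carrier E. a \<in> J \<longleftrightarrow> h a = 0)"
proof -
  define U :: "(('v,'e) gen list \<Rightarrow> 'k) set" where "U = ufree_carrier E"
  have JF: "a \<in> free_carrier E" if "a \<in> J" for a
    using that unfolding J
    by (induction rule: ideal_gen.induct; unfold free_alg_simps)
       (use X in blast, (rule free_carrier_closed; blast intro: free_carrier_subset)+)
  have J0: "0 \<in> J" and Jadd: "a \<in> J \<Longrightarrow> b \<in> J \<Longrightarrow> a + b \<in> J" and Jsc: "a \<in> J \<Longrightarrow> (\<lambda>w. c * a w) \<in> J"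
    and Jl: "a \<in> free_carrier E \<Longrightarrow> b \<in> J \<Longrightarrow> fmul a b \<in> J"
    and Jr: "a \<in> free_carrier E \<Longrightarrow> b \<in> J \<Longrightarrow> fmul b a \<in> J" for a b c
    using ideal_gen.intros(2-6)[where A = "free_alg E" and X = X] unfolding J free_alg_simps by blast+
  have Jdiff: "a - b \<in> J" if "a \<in> J" "b \<in> J" for a b
  proof -
    have "a - b = a + (\<lambda>w. (-1) * b w)" by (simp add: fun_eq_iff)
    then show ?thesis using Jadd Jsc that by metis
  qed
  \<comment> \<open>An element with a constant term is an element of \<open>free_carrier\<close>
    plus a scalar, and the scalar only rescales \<open>b\<close>.\<close>
  have JrU: "fmul b a \<in> J" if "a \<in> U" "b \<in> J" for a b
  proof -
    let ?a = "a + (\<lambda>w. (- a []) * wel [] w)"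
    have "?a \<in> free_carrier E"
      using that(1) unfolding free_carrier_iff U_def
      by (intro conjI ufree_carrier_add ufree_carrier_scale ufree_carrier_wel) (simp_all add: wel_def)
    then have "fmul b ?a + (\<lambda>w. a [] * b w) \<in> J" using Jr Jadd Jsc that by simp
    also have "fmul b ?a + (\<lambda>w. a [] * b w) = fmul b a"
      by (subst fmul_add_right, subst fmul_scale_right) (simp add: fun_eq_iff)
    finally show ?thesis .
  qed
  interpret vs: vector_space "\<lambda>(c::'k) (f::('v,'e) gen list \<Rightarrow> 'k) w. c * f w"
    by standard (auto simp: fun_eq_iff algebra_simps)
  interpret vp: vector_space_pair "\<lambda>(c::'k) (f::('v,'e) gen list \<Rightarrow> 'k) w. c * f w"
      "\<lambda>(c::'k) (f::('v,'e) gen list \<Rightarrow> 'k) w. c * f w" ..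
  have proj: "\<exists>g. range g \<subseteq> S \<and> (\<forall>x y. g (x + y) = g x + g y) \<and>
      (\<forall>c x. g (\<lambda>w. c * x w) = (\<lambda>w. c * g x w)) \<and> (\<forall>x\<in>S. g x = x)"
    if "vs.subspace S" for S :: "(('v,'e) gen list \<Rightarrow> 'k) set"
  proof -
    have "\<exists>g. range g \<subseteq> S \<and> Vector_Spaces.linear (\<lambda>c f w. c * f w) (\<lambda>c f w. c * f w) g \<and> (\<forall>v\<in>S. g (id v) = v)"
      by (rule vp.linear_exists_left_inverse_on[OF vs.linear_id that]) simp
    then show ?thesis by (auto simp: Vector_Spaces.linear_iff)
  qed
  have sU: "vs.subspace U" unfolding vs.subspace_def U_def
    using ufree_carrier_zero ufree_carrier_add ufree_carrier_scale by auto
  have sJ: "vs.subspace J" unfolding vs.subspace_def using J0 Jadd Jsc by auto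
  obtain p where p: "range p \<subseteq> U" "\<And>x y. p (x + y) = p x + p y"
      "\<And>c x. p (\<lambda>w. c * x w) = (\<lambda>w. c * p x w)" "\<And>x. x \<in> U \<Longrightarrow> p x = x"
    using proj[OF sU] by auto
  obtain q where q: "range q \<subseteq> J" "\<And>x y. q (x + y) = q x + q y"
      "\<And>c x. q (\<lambda>w. c * x w) = (\<lambda>w. c * q x w)" "\<And>x. x \<in> J \<Longrightarrow> q x = x"
    using proj[OF sJ] by auto
  \<comment> \<open>\<open>p\<close> projects the space of all functions onto \<open>U\<close> and
    \<open>q\<close> projects it onto \<open>J\<close>. Hence \<open>t\<close> is defined
    everywhere, takes values in \<open>U\<close>, kills \<open>J\<close>, and moves an element of
    \<open>U\<close> only by an element of \<open>J\<close>.\<close>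
  define t where "t x = p x - q (p x)" for x
  have JU: "J \<subseteq> U" using JF free_carrier_subset unfolding U_def by auto
  have Udiff: "a - b \<in> U" if "a \<in> U" "b \<in> U" for a b
    using sU that by (rule vs.subspace_diff)
  have t_add: "t (x + y) = t x + t y" for x y by (simp add: t_def p q)
  have t_sc: "t (\<lambda>w. c * x w) = (\<lambda>w. c * t x w)" for c x
    unfolding t_def p(3) q(3) by (simp add: fun_eq_iff right_diff_distrib)
  have tU: "t x \<in> U" for x unfolding t_def using p(1) q(1) JU by (intro Udiff) auto
  have tJ: "x - t x \<in> J" if "x \<in> U" for x using that q(1) p(4) by (auto simp: t_def)
  have t_diff: "t (x - y) = t x - t y" for x y
    using t_add[of "x - y" y] by (simp add: eq_diff_eq)
  have t0: "x \<in> J \<Longrightarrow> t x = 0" for x using JU p(4) q(4) by (auto simp: t_def)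
  have tt: "t x = t y" if "x - y \<in> J" for x y using t0[OF that] t_diff by simp
  have t0D: "x \<in> J" if "x \<in> U" "t x = 0" for x using tJ[OF that(1)] that(2) by simp
  define sc :: "'k \<Rightarrow> (('v,'e) gen list \<Rightarrow> 'k) endo" where "sc c = Endo (\<lambda>f w. c * f w)" for c
  \<comment> \<open>The inner \<open>t\<close> brings an arbitrary function into \<open>U\<close>,
    where left multiplication by \<open>a\<close> respects congruence modulo \<open>J\<close>; the
    outer \<open>t\<close> picks the chosen representative of the result.\<close>
  define h where "h a = Endo (\<lambda>x. t (fmul a (t x)))" for a
  have sc: "app (sc c) f = (\<lambda>w. c * f w)" for c f
    unfolding sc_def by (subst app_Endo) (auto simp: fun_eq_iff algebra_simps)
  have h: "app (h a) x = t (fmul a (t x))" for a x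
    unfolding h_def by (subst app_Endo) (auto simp: t_add fmul_add_right)
  have h_mult: "h (fmul a b) = h a * h b" if a: "a \<in> free_carrier E" and b: "b \<in> free_carrier E" for a b
  proof (rule endo_eqI)
    fix x
    let ?y = "fmul b (t x)"
    have y: "?y \<in> U" using b tU unfolding U_def by (meson free_carrier_subset ufree_carrier_mult)
    have "t (t ?y) = t ?y" by (rule tt) (use tJ[OF y] Jdiff[OF J0] in fastforce)
    moreover have "fmul a ?y - fmul a (t ?y) = fmul a (?y - t ?y)"
      using fmul_add_right[of a "?y - t ?y" "t ?y"] by simp
    then have "t (fmul a ?y) = t (fmul a (t ?y))" using Jl[OF a tJ[OF y]] by (intro tt) simp
    ultimately show "app (h (fmul a b)) x = app (h a * h b) x" by (simp add: h fmul_assoc)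
  qed
  have h_add: "h (a + b) = h a + h b" for a b
    by (rule endo_eqI) (simp add: h fmul_add_left t_add)
  have h_sc: "h (\<lambda>w. c * a w) = sc c * h a" for c a
    by (rule endo_eqI) (simp add: h sc fmul_scale_left t_sc)
  have "h a * sc c = sc c * h a" for c a
    by (rule endo_eqI) (simp only: app_ops h sc fmul_scale_right t_sc)
  moreover have "h 0 = 0" using h_add[of 0 0] by simp
  moreover have "scalars sc"
  proof -
    have "sc 1 = 1" by (rule endo_eqI) (simp add: sc)
    moreover have "sc (a + b) = sc a + sc b" for a b
      by (rule endo_eqI) (simp add: sc fun_eq_iff distrib_right)
    moreover have "sc (a * b) = sc a * sc b" for a b
      by (rule endo_eqI) (simp only: app_ops sc mult.assoc)
    ultimately show ?thesis by (simp add: scalars_def)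
  qed
  moreover from calculation have "alg_hom (free_alg E) sc h"
    unfolding alg_hom_def free_alg_simps
    by (intro conjI ballI allI) (simp_all add: free_carrier_closed free_carrier_subset h_mult h_add h_sc)
  ultimately have "alg_hom (free_alg E) sc h \<and> (\<forall>c a. h a * sc c = sc c * h a)" by blast
  moreover have "a \<in> J \<longleftrightarrow> h a = 0" if a: "a \<in> free_carrier E" for a
  proof
    assume "a \<in> J"
    then show "h a = 0" by (intro endo_eqI) (simp add: h t0 JrU tU)
  next
    assume "h a = 0"
    \<comment> \<open>Evaluation at the unit: both \<open>a\<close> times \<open>t (wel [])\<close>
      and \<open>a\<close> times the remainder \<open>wel [] - t (wel [])\<close> lie in
      \<open>J\<close>, and their sum is \<open>a\<close>.\<close>
    then have "t (fmul a (t (wel []))) = 0" using h[of a "wel []"] by simp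
    moreover have "fmul a (t (wel [])) \<in> U" "a \<in> U"
      using a tU unfolding U_def by (auto intro: free_carrier_subset ufree_carrier_mult)
    moreover have "wel [] \<in> U" unfolding U_def by (rule ufree_carrier_wel) simp
    then have "fmul a (wel [] - t (wel [])) \<in> J" using Jl a tJ by blast
    moreover have "fmul a (wel [] - t (wel [])) + fmul a (t (wel [])) = a"
      by (simp add: fmul_add_right[symmetric])
    ultimately show "a \<in> J" using t0D Jadd by metis
  qed
  ultimately show ?thesis by blast
qed

subsection \<open>The porcupine-quotient graph as a graph over \<open>E\<close>\<close>

fun base_vert :: "('v,'e) graph \<Rightarrow> ('v,'e) pq_vert \<Rightarrow> 'v" where
  "base_vert E (OldV v) = v"
| "base_vert E (WV p) = src E (hd p)"
| "base_vert E (PrimeV v) = v"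

fun base_edge :: "('v,'e) pq_edge \<Rightarrow> 'e" where
  "base_edge (OldE e) = e"
| "base_edge (FE p) = hd p"
| "base_edge (PrimeE e) = e"

lemma is_path_single: "is_path E [e] \<longleftrightarrow> e \<in> edges E"
  by (simp add: is_path_def)

lemma is_path_Cons:
  "q \<noteq> [] \<Longrightarrow> is_path E (e # q) \<longleftrightarrow> e \<in> edges E \<and> rng E e = src E (hd q) \<and> is_path E q"
  unfolding is_path_def
  by (cases q) (auto simp: nth_Cons split: nat.splits)

lemma hereditary_edge: "hereditary E H \<Longrightarrow> e \<in> edges E \<Longrightarrow> src E e \<in> H \<Longrightarrow> rng E e \<in> H"
  unfolding hereditary_def by (metis is_path_single last.simps list.sel(1))

locale porcupine =
  fixes E :: "('v,'e) graph" and H S G T :: "'v set"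
  assumes wf: "wf_graph E" and HS: "admissible E H S" and GT: "admissible E G T"
    and le: "adm_le H S G T"
begin

abbreviation P :: "(('v,'e) pq_vert, ('v,'e) pq_edge) graph" where
  "P \<equiv> pq_graph E H S G T"

definition old :: "'v set" where "old = (G - H) \<union> (T - S)"

definition porc :: "'e list set" where "porc = pqF1 E H S G T \<union> pqF2 E H S G T"

definition primed :: "'v set" where "primed = ((G \<union> T) - S) \<inter> breaking_rel E H G"

section \<open>Vertices of the admissible pairs and porcupine paths\<close>

lemma wfE: "e \<in> edges E \<Longrightarrow> src E e \<in> verts E" "e \<in> edges E \<Longrightarrow> rng E e \<in> verts E"
  using wf by (auto simp: wf_graph_def)

lemma H_edge: "e \<in> edges E \<Longrightarrow> src E e \<in> H \<Longrightarrow> rng E e \<in> H"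
  and G_edge: "e \<in> edges E \<Longrightarrow> src E e \<in> G \<Longrightarrow> rng E e \<in> G"
  using HS GT hereditary_edge by (auto simp: admissible_def)

lemma HG: "H \<subseteq> G"
  using le by (auto simp: adm_le_def)

lemma G_verts: "v \<in> G \<Longrightarrow> v \<in> verts E"
  using GT by (auto simp: admissible_def hereditary_def)

lemma TD:
  assumes "v \<in> T"
  shows "v \<in> verts E" "v \<notin> G" "v \<notin> H" "infinite (emits E v)"
    "finite {e \<in> emits E v. rng E e \<in> verts E - G}" "{e \<in> emits E v. rng E e \<in> verts E - G} \<noteq> {}"
  using GT assms HG unfolding admissible_def breaking_def inf_emitter_def by blast+

lemma SD:
  assumes "v \<in> S"
  shows "v \<in> verts E" "v \<notin> H" "infinite (emits E v)"
    "finite {e \<in> emits E v. rng E e \<in> verts E - H}" "{e \<in> emits E v. rng E e \<in> verts E - H} \<noteq> {}"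
  using HS assms unfolding admissible_def breaking_def inf_emitter_def by blast+

text \<open>The last claim makes \<open>v^H\<close> a usable element: \<open>breaking_rel\<close>
  bounds only the edges into \<open>G - H\<close>. For \<open>v\<close> in \<open>G\<close> heredity
  leaves no other edges outside \<open>H\<close>; for \<open>v\<close> in \<open>T\<close> the
  remaining ones leave \<open>G\<close> and are bounded because \<open>v\<close> is a breaking
  vertex of \<open>G\<close>.\<close>

lemma primedD:
  assumes "v \<in> primed"
  shows "v \<in> old" "v \<notin> S" "finite {e \<in> emits E v. rng E e \<in> G - H}"
    "{e \<in> emits E v. rng E e \<in> G - H} \<noteq> {}" "finite {e \<in> emits E v. rng E e \<in> verts E - H}"
proof -
  show "v \<in> old" "v \<notin> S" and fin: "finite {e \<in> emits E v. rng E e \<in> G - H}"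
    and "{e \<in> emits E v. rng E e \<in> G - H} \<noteq> {}"
    using assms by (auto simp: primed_def breaking_rel_def old_def)
  show "finite {e \<in> emits E v. rng E e \<in> verts E - H}"
  proof (cases "v \<in> G")
    case True
    then have "{e \<in> emits E v. rng E e \<in> verts E - H} \<subseteq> {e \<in> emits E v. rng E e \<in> G - H}"
      using G_edge by (auto simp: emits_def)
    then show ?thesis using fin by (rule finite_subset)
  next
    case False
    then have "finite {e \<in> emits E v. rng E e \<in> verts E - G}"
      using assms TD by (auto simp: primed_def)
    with fin have "finite ({e \<in> emits E v. rng E e \<in> G - H} \<union> {e \<in> emits E v. rng E e \<in> verts E - G})"
      by simp
    then show ?thesis by (rule rev_finite_subset) auto
  qed
qed

lemma primed_iff:
  "v \<in> primed \<longleftrightarrow> v \<in> old \<and> v \<notin> S \<and> infinite (emits E v) \<and>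
     finite {e \<in> emits E v. rng E e \<in> G - H} \<and> {e \<in> emits E v. rng E e \<in> G - H} \<noteq> {}"
  using HG G_verts TD by (auto simp: primed_def breaking_rel_def old_def inf_emitter_def)

lemma old_verts: "v \<in> old \<Longrightarrow> v \<in> verts E" "v \<in> old \<Longrightarrow> v \<notin> H"
  using TD G_verts by (auto simp: old_def)

lemma porc_single:
  "[e] \<in> porc \<longleftrightarrow> e \<in> edges E \<and> (rng E e \<in> G - H \<and> src E e \<notin> old \<or> rng E e \<in> T - S)"
  by (auto simp: porc_def pqF1_def pqF2_def is_path_single old_def)

text \<open>Apart from composability, membership in F1 or F2 depends on the last edge alone, so
  nonempty suffixes stay inside. All inductions on \<open>w^p\<close> rest on this.\<close>

lemma porc_Cons: "q \<noteq> [] \<Longrightarrow> e # q \<in> porc \<longleftrightarrow> e \<in> edges E \<and> rng E e = src E (hd q) \<and> q \<in> porc"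
  by (auto simp: porc_def pqF1_def pqF2_def is_path_Cons)

lemma porc_Nil: "[] \<notin> porc"
  by (simp add: porc_def pqF1_def pqF2_def is_path_def)

lemma porc_induct [consumes 1, case_names single Cons]:
  assumes "p \<in> porc"
    and "\<And>e. [e] \<in> porc \<Longrightarrow> Q [e]"
    and "\<And>e f q. e # f # q \<in> porc \<Longrightarrow> e \<in> edges E \<Longrightarrow> rng E e = src E f \<Longrightarrow> f # q \<in> porc \<Longrightarrow>
      Q (f # q) \<Longrightarrow> Q (e # f # q)"
  shows "Q p"
  using assms(1)
proof (induction p rule: induct_list012)
  case (3 e f q)
  then show ?case using assms(3) porc_Cons[of "f # q" e] by simp
qed (use assms(2) porc_Nil in auto)

lemma porc_hd: "p \<in> porc \<Longrightarrow> hd p \<in> edges E"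
  by (induction rule: porc_induct) (auto simp: porc_single)

text \<open>Heredity read backwards: a path starting in \<open>G\<close> can neither reach
  \<open>T\<close>, which is disjoint from \<open>G\<close>, nor enter \<open>G - H\<close> from a
  vertex that is not old. Hence over a vertex of \<open>G\<close> the only vertices of
  \<open>P\<close> are \<open>v\<close> and possibly \<open>v'\<close>.\<close>

lemma porc_src: "p \<in> porc \<Longrightarrow> src E (hd p) \<notin> G"
proof (induction rule: porc_induct)
  case (single e)
  then show ?case using G_edge H_edge TD(2) by (auto simp: porc_single old_def)
next
  case (Cons e f q)
  then show ?case using G_edge[of e] by auto
qed

text \<open>F1 excludes a single edge with old source, F2 ends in \<open>T\<close>, and a longer
  path continues with one that starts outside \<open>G\<close>. This is what separates
  \<open>w^p\<close> from an old vertex below it: the latter sees only edges into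
  \<open>G\<close>.\<close>

lemma porc_rng:
  assumes "p \<in> porc" "src E (hd p) \<in> old"
  shows "rng E (hd p) \<notin> G"
proof (cases "tl p = []")
  case True
  then have "p = [hd p]" using assms(1) porc_Nil by (cases p) auto
  then have "[hd p] \<in> porc" using assms(1) by simp
  then show ?thesis using assms(2) TD(2) porc_single[of "hd p"] by blast
next
  case False
  then have "hd p # tl p \<in> porc" using assms(1) by (cases p) auto
  then show ?thesis using porc_Cons[OF False] porc_src by auto
qed

section \<open>Edges of \<open>P\<close> and their unique lifting from \<open>E\<close>\<close>

lemma P_verts [simp]:
  "OldV v \<in> verts P \<longleftrightarrow> v \<in> old" "WV p \<in> verts P \<longleftrightarrow> p \<in> porc" "PrimeV v \<in> verts P \<longleftrightarrow> v \<in> primed"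
  by (auto simp: pq_graph_def old_def porc_def primed_def)

lemma P_edges [simp]:
  "OldE e \<in> edges P \<longleftrightarrow> e \<in> edges E \<and> rng E e \<in> G - H \<and> src E e \<in> old"
  "FE p \<in> edges P \<longleftrightarrow> p \<in> porc" "PrimeE e \<in> edges P \<longleftrightarrow> e \<in> edges E \<and> rng E e \<in> primed"
  by (auto simp: pq_graph_def old_def porc_def primed_def)

lemma P_src [simp]:
  "src P (OldE e) = OldV (src E e)" "src P (FE p) = WV p"
  "rng E e \<in> primed \<Longrightarrow>
     src P (PrimeE e) = (if rng E e \<in> G \<and> src E e \<in> old then OldV (src E e) else WV [e])"
  by (auto simp: pq_graph_def primed_def old_def)

lemma P_rng [simp]:
  "rng P (OldE e) = OldV (rng E e)" "rng P (FE [e]) = OldV (rng E e)"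
  "q \<noteq> [] \<Longrightarrow> rng P (FE (e # q)) = WV q" "rng P (PrimeE e) = PrimeV (rng E e)"
  by (auto simp: pq_graph_def)

text \<open>Guarantees that the source \<open>w^e\<close> given to \<open>e'\<close> in the second
  branch of its definition is a vertex.\<close>

lemma prime_porc:
  "e \<in> edges E \<Longrightarrow> rng E e \<in> primed \<Longrightarrow> \<not> (rng E e \<in> G \<and> src E e \<in> old) \<Longrightarrow> [e] \<in> porc"
  using primedD(1)[of "rng E e"] by (auto simp: porc_single old_def)

lemma base_vert_verts: "u \<in> verts P \<Longrightarrow> base_vert E u \<in> verts E \<and> base_vert E u \<notin> H"
proof (cases u)
  case (WV p)
  then show "u \<in> verts P \<Longrightarrow> ?thesis" using porc_hd[of p] porc_src[of p] wfE HG by auto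
qed (use old_verts primedD(1) in auto)

lemma edge_props:
  assumes "x \<in> edges P"
  shows "base_edge x \<in> edges E" "src P x \<in> verts P" "rng P x \<in> verts P"
    "base_vert E (src P x) = src E (base_edge x)" "base_vert E (rng P x) = rng E (base_edge x)"
proof -
  have "base_edge x \<in> edges E \<and> src P x \<in> verts P \<and> rng P x \<in> verts P \<and>
    base_vert E (src P x) = src E (base_edge x) \<and> base_vert E (rng P x) = rng E (base_edge x)"
  proof (cases x)
    case (OldE e)
    then show ?thesis using assms by (auto simp: old_def)
  next
    case (PrimeE e)
    then show ?thesis using assms prime_porc[of e] by auto
  next
    case (FE p)
    with assms have p: "p \<in> porc" by simp
    show ?thesis
    proof (cases "tl p = []")
      case True
      then obtain e where "p = [e]" using p porc_Nil by (cases p) auto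
      then show ?thesis using FE p by (auto simp: porc_single old_def)
    next
      case False
      then obtain e q where "p = e # q" "q \<noteq> []" using p porc_Nil by (cases p) auto
      then show ?thesis using FE p by (auto simp: porc_Cons)
    qed
  qed
  then show "base_edge x \<in> edges E" "src P x \<in> verts P" "rng P x \<in> verts P"
    "base_vert E (src P x) = src E (base_edge x)" "base_vert E (rng P x) = rng E (base_edge x)"
    by auto
qed

lemma wf_P: "wf_graph P"
  using edge_props by (auto simp: wf_graph_def)

text \<open>For \<open>v\<close> in \<open>T - S\<close> the lift is \<open>f^e\<close> even if the
  source of \<open>e\<close> is old, since edges inherited from \<open>E\<close> end in
  \<open>G - H\<close>.\<close>

fun lift :: "'e \<Rightarrow> ('v,'e) pq_vert \<Rightarrow> ('v,'e) pq_edge" where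
  "lift e (OldV v) = (if src E e \<in> old \<and> v \<in> G then OldE e else FE [e])"
| "lift e (WV q) = FE (e # q)"
| "lift e (PrimeV v) = PrimeE e"

lemma lift_props:
  assumes "e \<in> edges E" "u \<in> verts P" "base_vert E u = rng E e"
  shows "lift e u \<in> edges P" "base_edge (lift e u) = e" "rng P (lift e u) = u"
proof -
  have "lift e u \<in> edges P \<and> base_edge (lift e u) = e \<and> rng P (lift e u) = u"
  proof (cases u)
    case (WV q)
    then have "q \<noteq> []" using assms(2) porc_Nil by auto
    then show ?thesis using assms WV by (simp add: porc_Cons)
  qed (use assms TD(2) in \<open>auto simp: porc_single old_def\<close>)
  then show "lift e u \<in> edges P" "base_edge (lift e u) = e" "rng P (lift e u) = u" by auto
qed

lemma lift_unique:
  assumes "x \<in> edges P"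
  shows "lift (base_edge x) (rng P x) = x"
proof (cases x)
  case (OldE e)
  then show ?thesis using assms by auto
next
  case (PrimeE e)
  then show ?thesis by auto
next
  case (FE p)
  with assms have p: "p \<in> porc" by simp
  show ?thesis
  proof (cases "tl p = []")
    case True
    then obtain e where "p = [e]" using p porc_Nil by (cases p) auto
    then show ?thesis using FE p TD(2) by (auto simp: porc_single)
  next
    case False
    then obtain e q where "p = e # q" "q \<noteq> []" using p porc_Nil by (cases p) auto
    then show ?thesis using FE p by auto
  qed
qed

lemma edge_eqI: "x \<in> edges P \<Longrightarrow> y \<in> edges P \<Longrightarrow> base_edge x = base_edge y \<Longrightarrow> rng P x = rng P y \<Longrightarrow> x = y"
  using lift_unique by metis

lemma emits_WV_Cons:
  assumes "e # f # q \<in> porc"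
  shows "emits P (WV (e # f # q)) = {FE (e # f # q)}"
proof -
  have "x = FE (e # f # q)" if "x \<in> edges P" "src P x = WV (e # f # q)" for x
    using that by (cases x) (auto split: if_splits)
  then show ?thesis using assms by (auto simp: emits_def)
qed

lemma emits_WV_single:
  assumes "[e] \<in> porc"
  shows "emits P (WV [e]) = insert (FE [e]) (if rng E e \<in> primed then {PrimeE e} else {})"
proof -
  have "x = FE [e] \<or> x = PrimeE e \<and> rng E e \<in> primed" if "x \<in> edges P" "src P x = WV [e]" for x
    using that by (cases x) (auto split: if_splits)
  moreover have "\<not> (rng E e \<in> G \<and> src E e \<in> old)"
    using assms TD(2) by (auto simp: porc_single)
  ultimately show ?thesis using assms by (auto simp: emits_def porc_single)
qed

lemma emits_OldV:
  assumes "v \<in> old"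
  shows "emits P (OldV v) = OldE ` {e \<in> emits E v. rng E e \<in> G - H} \<union>
    PrimeE ` {e \<in> emits E v. rng E e \<in> G \<and> rng E e \<in> primed}"
proof -
  have "x \<in> OldE ` {e \<in> emits E v. rng E e \<in> G - H} \<union>
    PrimeE ` {e \<in> emits E v. rng E e \<in> G \<and> rng E e \<in> primed}" if "x \<in> edges P" "src P x = OldV v" for x
    using that by (cases x) (auto simp: emits_def split: if_splits)
  then show ?thesis using assms by (auto simp: emits_def)
qed

lemma emits_PrimeV: "emits P (PrimeV v) = {}"
proof -
  have "src P x \<noteq> PrimeV v" if "x \<in> edges P" for x
    using that by (cases x) (auto split: if_splits)
  then show ?thesis by (auto simp: emits_def)
qed

text \<open>Unique lifting holds for a prescribed end only. For a prescribed start there may be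
  several lifts, but never infinitely many, even at an infinite emitter; operators summing over them
  are therefore well behaved.\<close>

lemma finite_lifts: "u \<in> verts P \<Longrightarrow> finite {x \<in> emits P u. base_edge x = e}"
proof (rule finite_subset)
  show "{x \<in> emits P u. base_edge x = e} \<subseteq> {OldE e, PrimeE e} \<union> (case u of WV p \<Rightarrow> {FE p} | _ \<Rightarrow> {})"
  proof
    fix x assume "x \<in> {x \<in> emits P u. base_edge x = e}"
    then show "x \<in> {OldE e, PrimeE e} \<union> (case u of WV p \<Rightarrow> {FE p} | _ \<Rightarrow> {})"
      by (cases x) (auto simp: emits_def)
  qed
qed (simp split: pq_vert.split)

end

subsection \<open>Leavitt families\<close>

lemma fsub_eq_diff: "fsub f g = f - g"
  by (simp add: fsub_def fun_eq_iff)

lemma gen_carrier: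
  "v \<in> verts E \<Longrightarrow> gv v \<in> free_carrier E" "e \<in> edges E \<Longrightarrow> ge e \<in> free_carrier E"
  "e \<in> edges E \<Longrightarrow> gs e \<in> free_carrier E"
  unfolding gv_def ge_def gs_def by (rule free_carrier_closed; simp add: gen_ok_def)+

lemma free_carrier_mult: "f \<in> free_carrier E \<Longrightarrow> g \<in> free_carrier E \<Longrightarrow> fmul f g \<in> free_carrier E"
  by (rule free_carrier_closed(4)) (auto intro: free_carrier_subset)

lemma free_carrier_fsub: "f \<in> free_carrier E \<Longrightarrow> g \<in> free_carrier E \<Longrightarrow> fsub f g \<in> free_carrier E"
  unfolding fsub_eq_diff by (rule free_carrier_diff)

lemma zero_carrier: "(\<lambda>w. 0) \<in> free_carrier E"
  using free_carrier_closed(1) unfolding zero_fun_def .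

lemma lpa_rels_carrier:
  assumes "wf_graph E"
  shows "lpa_rels E \<subseteq> free_carrier E"
  using assms unfolding lpa_rels_def wf_graph_def
  by (auto intro!: free_carrier_fsub free_carrier_mult gen_carrier zero_carrier free_carrier_sum
      simp: emits_def)

lemma lpa_rels_mem:
  "v \<in> verts E \<Longrightarrow> u \<in> verts E \<Longrightarrow> fsub (fmul (gv v) (gv u)) (if v = u then gv v else (\<lambda>w. 0)) \<in> lpa_rels E"
  "e \<in> edges E \<Longrightarrow> fsub (fmul (gv (src E e)) (ge e)) (ge e) \<in> lpa_rels E"
  "e \<in> edges E \<Longrightarrow> fsub (fmul (ge e) (gv (rng E e))) (ge e) \<in> lpa_rels E"
  "e \<in> edges E \<Longrightarrow> fsub (fmul (gv (rng E e)) (gs e)) (gs e) \<in> lpa_rels E"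
  "e \<in> edges E \<Longrightarrow> fsub (fmul (gs e) (gv (src E e))) (gs e) \<in> lpa_rels E"
  "e \<in> edges E \<Longrightarrow> f \<in> edges E \<Longrightarrow>
     fsub (fmul (gs e) (ge f)) (if e = f then gv (rng E e) else (\<lambda>w. 0)) \<in> lpa_rels E"
  "v \<in> verts E \<Longrightarrow> finite (emits E v) \<Longrightarrow> emits E v \<noteq> {} \<Longrightarrow>
     fsub (gv v) (\<lambda>w. \<Sum>e\<in>emits E v. fmul (ge e) (gs e) w) \<in> lpa_rels E"
  unfolding lpa_rels_def by blast+

context
  fixes E :: "('v,'e) graph" and sc :: "'k::field \<Rightarrow> 'r::{ring,monoid_mult}" and h
  assumes h: "alg_hom (free_alg E) sc h"
begin

lemma hom_add: "f \<in> free_carrier E \<Longrightarrow> g \<in> free_carrier E \<Longrightarrow> h (f + g) = h f + h g"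
  and hom_mult: "f \<in> free_carrier E \<Longrightarrow> g \<in> free_carrier E \<Longrightarrow> h (fmul f g) = h f * h g"
  and hom_scale: "f \<in> free_carrier E \<Longrightarrow> h (\<lambda>w. c * f w) = sc c * h f"
  and hom_zero: "h 0 = 0"
  using alg_homD[OF h] by simp_all

lemma hom_diff: "f \<in> free_carrier E \<Longrightarrow> g \<in> free_carrier E \<Longrightarrow> h (f - g) = h f - h g"
  using hom_add[OF free_carrier_diff[of f E g], of g] by (simp add: eq_diff_eq)

lemma hom_fsub: "f \<in> free_carrier E \<Longrightarrow> g \<in> free_carrier E \<Longrightarrow> h (fsub f g) = h f - h g"
  unfolding fsub_eq_diff by (rule hom_diff)

lemma hom_sum:
  assumes "\<And>i. i \<in> I \<Longrightarrow> f i \<in> free_carrier E"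
  shows "h (\<lambda>w. \<Sum>i\<in>I. f i w) = (\<Sum>i\<in>I. h (f i))"
proof -
  have "(\<lambda>w. \<Sum>i\<in>I. f i w) = sum f I" by (simp add: fun_eq_iff sum_fun_apply)
  moreover have "h (sum f I) = (\<Sum>i\<in>I. h (f i)) \<and> sum f I \<in> free_carrier E"
    using assms
  proof (induction I rule: infinite_finite_induct)
    case (insert i I)
    then have "h (f i + sum f I) = h (f i) + h (sum f I)" by (intro hom_add) auto
    moreover have "f i + sum f I \<in> free_carrier E" using insert by (intro free_carrier_closed(2)) auto
    ultimately show ?case using insert by (simp del: plus_fun_apply)
  qed (use hom_zero free_carrier_closed(1) in auto)
  ultimately show ?thesis by simp
qed

lemma hom_zero': "h (\<lambda>w. 0) = 0"
  using hom_zero unfolding zero_fun_def .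

end

text \<open>The commutation axioms let coefficients move past words, without which evaluation would
  not be multiplicative.\<close>

locale leavitt_family =
  fixes E :: "('v,'e) graph" and sc :: "'k::field \<Rightarrow> 'r::{ring,monoid_mult}"
    and V :: "'v \<Rightarrow> 'r" and A B :: "'e \<Rightarrow> 'r"
  assumes wf_E: "wf_graph E" and scalars: "scalars sc"
    and comm: "v \<in> verts E \<Longrightarrow> V v * sc c = sc c * V v" "e \<in> edges E \<Longrightarrow> A e * sc c = sc c * A e"
      "e \<in> edges E \<Longrightarrow> B e * sc c = sc c * B e"
    and VV: "v \<in> verts E \<Longrightarrow> u \<in> verts E \<Longrightarrow> V v * V u = (if v = u then V v else 0)"
    and VA: "e \<in> edges E \<Longrightarrow> V (src E e) * A e = A e"
    and AV: "e \<in> edges E \<Longrightarrow> A e * V (rng E e) = A e"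
    and VB: "e \<in> edges E \<Longrightarrow> V (rng E e) * B e = B e"
    and BV: "e \<in> edges E \<Longrightarrow> B e * V (src E e) = B e"
    and BA: "e \<in> edges E \<Longrightarrow> f \<in> edges E \<Longrightarrow> B e * A f = (if e = f then V (rng E e) else 0)"
    and CK: "v \<in> verts E \<Longrightarrow> finite (emits E v) \<Longrightarrow> emits E v \<noteq> {} \<Longrightarrow> V v = (\<Sum>e\<in>emits E v. A e * B e)"
begin

lemma src_rng_verts: "e \<in> edges E \<Longrightarrow> src E e \<in> verts E" "e \<in> edges E \<Longrightarrow> rng E e \<in> verts E"
  using wf_E by (auto simp: wf_graph_def)

section \<open>Evaluation of the free algebra at a Leavitt family\<close>

definition gval :: "('v,'e) gen \<Rightarrow> 'r" where
  "gval g = (case g of GV v \<Rightarrow> V v | GE e \<Rightarrow> A e | GS e \<Rightarrow> B e)"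

definition wval :: "('v,'e) gen list \<Rightarrow> 'r" where
  "wval w = prod_list (map gval w)"

definition ev :: "(('v,'e) gen list \<Rightarrow> 'k) \<Rightarrow> 'r" where
  "ev f = (\<Sum>w\<in>{w. f w \<noteq> 0}. sc (f w) * wval w)"

lemma gval_comm: "gen_ok E g \<Longrightarrow> gval g * sc c = sc c * gval g"
  by (auto simp: gval_def gen_ok_def comm split: gen.splits)

lemma wval_comm: "\<forall>g\<in>set w. gen_ok E g \<Longrightarrow> wval w * sc c = sc c * wval w"
proof (induction w)
  case (Cons g w)
  have "wval (g # w) * sc c = gval g * (wval w * sc c)" by (simp add: wval_def mult.assoc)
  also have "\<dots> = (gval g * sc c) * wval w" using Cons by (simp add: mult.assoc)
  also have "\<dots> = sc c * wval (g # w)" using Cons by (simp add: gval_comm wval_def mult.assoc)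
  finally show ?case .
qed (simp add: wval_def)

lemma ev_superset: "finite W \<Longrightarrow> {w. f w \<noteq> 0} \<subseteq> W \<Longrightarrow> ev f = (\<Sum>w\<in>W. sc (f w) * wval w)"
  unfolding ev_def by (rule sum.mono_neutral_left) (auto simp: scalars_simps[OF scalars])

lemma ev_add:
  assumes "f \<in> free_carrier E" "g \<in> free_carrier E"
  shows "ev (f + g) = ev f + ev g"
proof -
  let ?W = "{w. f w \<noteq> 0} \<union> {w. g w \<noteq> 0}"
  have W: "finite ?W" using assms by (auto simp: free_carrier_def)
  have "ev (f + g) = (\<Sum>w\<in>?W. sc ((f + g) w) * wval w)" by (rule ev_superset[OF W]) auto
  also have "\<dots> = (\<Sum>w\<in>?W. sc (f w) * wval w) + (\<Sum>w\<in>?W. sc (g w) * wval w)"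
    by (simp add: scalars_simps[OF scalars] distrib_right sum.distrib)
  also have "\<dots> = ev f + ev g" using ev_superset[OF W, of f] ev_superset[OF W, of g] by auto
  finally show ?thesis .
qed

lemma ev_scale:
  assumes "f \<in> free_carrier E"
  shows "ev (\<lambda>w. c * f w) = sc c * ev f"
proof -
  let ?W = "{w. f w \<noteq> 0}"
  have W: "finite ?W" using assms by (auto simp: free_carrier_def)
  have "ev (\<lambda>w. c * f w) = (\<Sum>w\<in>?W. sc (c * f w) * wval w)" by (rule ev_superset[OF W]) auto
  then show ?thesis by (simp add: scalars_simps[OF scalars] ev_def sum_distrib_left mult.assoc)
qed

lemma ev_zero: "ev 0 = 0"
  by (simp add: ev_def)

lemma ev_wel: "ev (wel w) = wval w"
proof -
  have "ev (wel w) = (\<Sum>u\<in>{w}. sc (wel w u) * wval u)"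
    by (rule ev_superset) (auto simp: wel_def)
  then show ?thesis by (simp add: wel_def scalars_simps[OF scalars])
qed

lemma ev_gens: "ev (gv v) = V v" "ev (ge e) = A e" "ev (gs e) = B e"
  by (simp_all add: gv_def ge_def gs_def ev_wel wval_def gval_def)

lemma ev_mult:
  assumes f: "f \<in> free_carrier E" and g: "g \<in> free_carrier E"
  shows "ev (fmul f g) = ev f * ev g"
  using f
proof (induction f rule: free_carrier_induct)
  case zero
  show ?case by (simp only: fmul_zero_left ev_zero mult_zero_left)
next
  case (add f f')
  then show ?case
    by (simp only: fmul_add_left ev_add free_carrier_mult g distrib_right)
next
  case (wel c u)
  have wu: "wel u \<in> free_carrier E" by (rule free_carrier_closed(6)[OF wel])
  show ?case
    unfolding fmul_scale_left ev_scale[OF wu] ev_scale[OF free_carrier_mult[OF wu g]] mult.assoc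
  proof (rule arg_cong[of _ _ "(*) (sc c)"])
    show "ev (fmul (wel u) g) = ev (wel u) * ev g"
      using g
    proof (induction g rule: free_carrier_induct)
      case zero
      show ?case by (simp only: fmul_zero_right ev_zero mult_zero_right)
    next
      case (add g g')
      then show ?case
        by (simp only: fmul_add_right ev_add free_carrier_mult wu distrib_left)
    next
      case (wel d v)
      have wv: "wel v \<in> free_carrier E" by (rule free_carrier_closed(6)[OF wel])
      have "ev (fmul (wel u) (\<lambda>w. d * wel v w)) = sc d * (wval u * wval v)"
        unfolding fmul_scale_right ev_scale[OF free_carrier_mult[OF wu wv]]
        by (simp add: fmul_wel ev_wel wval_def)
      also have "\<dots> = wval u * (sc d * wval v)"
        using wval_comm[of u d] \<open>\<forall>g\<in>set u. gen_ok E g\<close> by (simp add: mult.assoc[symmetric])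
      finally show ?case unfolding ev_scale[OF wv] ev_wel .
    qed
  qed
qed

lemma ev_hom: "alg_hom (free_alg E) sc ev"
  unfolding alg_hom_def free_alg_simps
  by (intro conjI ballI allI; (rule scalars ev_zero ev_add ev_mult ev_scale free_carrier_closed free_carrier_mult)?;
      assumption?)

lemma ev_rels: "r \<in> lpa_rels E \<Longrightarrow> ev r = 0"
proof -
  note ev = hom_fsub[OF ev_hom] hom_mult[OF ev_hom] hom_sum[OF ev_hom] hom_zero'[OF ev_hom] ev_gens
      free_carrier_mult gen_carrier zero_carrier free_carrier_sum src_rng_verts
  have CK': "ev (fsub (gv v) (\<lambda>w. \<Sum>e\<in>emits E v. fmul (ge e) (gs e) w)) = 0"
    if "v \<in> verts E" "finite (emits E v)" "x \<in> emits E v" for v x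
  proof -
    have e: "e \<in> emits E v \<Longrightarrow> e \<in> edges E" for e by (simp add: emits_def)
    show ?thesis using CK[OF that(1,2)] that by (auto simp: ev e)
  qed
  assume "r \<in> lpa_rels E"
  then show ?thesis
    unfolding lpa_rels_def by (auto simp: CK') (auto simp: ev VV VA AV VB BV BA split: if_splits)
qed

context
  fixes h
  assumes hom: "alg_hom (free_alg E) sc h"
    and h_gens: "\<And>v. h (gv v) = V v" "\<And>e. h (ge e) = A e" "\<And>e. h (gs e) = B e"
begin

lemma hom_wel: "w \<noteq> [] \<Longrightarrow> \<forall>g\<in>set w. gen_ok E g \<Longrightarrow> h (wel w) = wval w"
proof (induction w)
  case (Cons g w)
  have g: "h (wel [g]) = gval g"
    using h_gens unfolding gv_def ge_def gs_def by (cases g) (auto simp: gval_def)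
  show ?case
  proof (cases "w = []")
    case False
    have "wel [g] \<in> free_carrier E" "wel w \<in> free_carrier E"
      using Cons.prems False by (auto intro!: free_carrier_closed(6))
    then show ?thesis
      using hom_mult[OF hom, of "wel [g]" "wel w"] Cons False g by (simp add: fmul_wel wval_def)
  qed (simp add: g wval_def)
qed simp

text \<open>Uniqueness half of the universal property: a homomorphism given abstractly, such as one
  with a prescribed kernel, is the evaluation at its own values on generators.\<close>

lemma hom_eq_ev: "f \<in> free_carrier E \<Longrightarrow> h f = ev f"
proof (induction f rule: free_carrier_induct)
  case zero
  show ?case by (simp only: hom_zero[OF hom] ev_zero)
next
  case (add f g)
  then show ?case by (simp only: hom_add[OF hom] ev_add)
next
  case (wel c w)
  note w = free_carrier_closed(6)[OF wel]
  show ?case unfolding hom_scale[OF hom w] ev_scale[OF w] hom_wel[OF wel] ev_wel ..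
qed

end

end

text \<open>Converse of the universal property; it makes the family calculus available for the
  abstract homomorphisms with prescribed kernel.\<close>

lemma leavitt_family_of_hom:
  assumes wf: "wf_graph E" and h: "alg_hom (free_alg E) sc h"
    and comm: "\<And>c a. a \<in> free_carrier E \<Longrightarrow> h a * sc c = sc c * h a"
    and rels: "\<And>r. r \<in> lpa_rels E \<Longrightarrow> h r = 0"
  shows "leavitt_family E sc (\<lambda>v. h (gv v)) (\<lambda>e. h (ge e)) (\<lambda>e. h (gs e))"
proof -
  have v: "src E e \<in> verts E" "rng E e \<in> verts E" if "e \<in> edges E" for e
    using wf that by (auto simp: wf_graph_def)
  note H = hom_fsub[OF h] hom_mult[OF h] hom_sum[OF h] hom_zero'[OF h]
      free_carrier_mult gen_carrier zero_carrier free_carrier_sum v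
  note R = rels[OF lpa_rels_mem(1)] rels[OF lpa_rels_mem(2)] rels[OF lpa_rels_mem(3)] rels[OF lpa_rels_mem(4)]
      rels[OF lpa_rels_mem(5)] rels[OF lpa_rels_mem(6)] rels[OF lpa_rels_mem(7)]
  show ?thesis
  proof
    show "h (gv v) * h (gv u) = (if v = u then h (gv v) else 0)" if "v \<in> verts E" "u \<in> verts E" for v u
      using R(1)[OF that] that by (simp add: H split: if_splits)
    show "h (gv (src E e)) * h (ge e) = h (ge e)" if "e \<in> edges E" for e
      using R(2)[OF that] that by (simp add: H)
    show "h (ge e) * h (gv (rng E e)) = h (ge e)" if "e \<in> edges E" for e
      using R(3)[OF that] that by (simp add: H)
    show "h (gv (rng E e)) * h (gs e) = h (gs e)" if "e \<in> edges E" for e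
      using R(4)[OF that] that by (simp add: H)
    show "h (gs e) * h (gv (src E e)) = h (gs e)" if "e \<in> edges E" for e
      using R(5)[OF that] that by (simp add: H)
    show "h (gs e) * h (ge f) = (if e = f then h (gv (rng E e)) else 0)"
      if "e \<in> edges E" "f \<in> edges E" for e f
      using R(6)[OF that] that by (simp add: H split: if_splits)
    show "h (gv v) = (\<Sum>e\<in>emits E v. h (ge e) * h (gs e))"
      if "v \<in> verts E" "finite (emits E v)" "emits E v \<noteq> {}" for v
    proof -
      have e: "e \<in> emits E v \<Longrightarrow> e \<in> edges E" for e by (simp add: emits_def)
      show ?thesis using R(7)[OF that] that(1) by (simp add: H e)
    qed
  qed (use wf alg_homD(1)[OF h] in \<open>auto intro: comm gen_carrier\<close>)
qed

subsection \<open>The family of the porcupine-quotient graph inside a family of \<open>E\<close>\<close>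

context leavitt_family
begin

definition sAB :: "'e set \<Rightarrow> 'r" where
  "sAB D = (\<Sum>e\<in>D. A e * B e)"

text \<open>The value of \<open>v^X\<close>. If infinitely many edges at \<open>v\<close> leave
  \<open>X\<close>, the sum is \<open>0\<close> by convention and the value is just
  \<open>V v\<close>; hence the finiteness hypotheses below.\<close>

definition gap :: "'v set \<Rightarrow> 'v \<Rightarrow> 'r" where
  "gap X v = V v - sAB {e \<in> emits E v. rng E e \<in> verts E - X}"

lemma emits_edge: "e \<in> emits E v \<longleftrightarrow> e \<in> edges E \<and> src E e = v"
  by (simp add: emits_def)

lemma V_A: "v \<in> verts E \<Longrightarrow> e \<in> edges E \<Longrightarrow> V v * A e = (if src E e = v then A e else 0)"
  using VA[of e] VV[of v "src E e"] src_rng_verts[of e] by (metis mult.assoc mult_zero_left)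

lemma V_B: "v \<in> verts E \<Longrightarrow> e \<in> edges E \<Longrightarrow> V v * B e = (if rng E e = v then B e else 0)"
  using VB[of e] VV[of v "rng E e"] src_rng_verts[of e] by (metis mult.assoc mult_zero_left)

lemma B_V: "v \<in> verts E \<Longrightarrow> e \<in> edges E \<Longrightarrow> B e * V v = (if src E e = v then B e else 0)"
  using BV[of e] VV[of "src E e" v] src_rng_verts[of e] by (metis mult.assoc mult_zero_right)

lemma BA_assoc: "e \<in> edges E \<Longrightarrow> f \<in> edges E \<Longrightarrow> B e * (A f * x) = (if e = f then V (rng E e) * x else 0)"
  by (simp add: mult.assoc[symmetric] BA)

lemma sAB_A: "finite D \<Longrightarrow> D \<subseteq> edges E \<Longrightarrow> f \<in> edges E \<Longrightarrow> sAB D * A f = (if f \<in> D then A f else 0)"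
proof -
  assume D: "finite D" "D \<subseteq> edges E" and f: "f \<in> edges E"
  have "sAB D * A f = (\<Sum>e\<in>D. if e = f then A f else 0)"
    unfolding sAB_def sum_distrib_right using D(2) f
    by (intro sum.cong) (auto simp: mult.assoc BA AV)
  then show ?thesis using D(1) by simp
qed

lemma B_sAB: "finite D \<Longrightarrow> D \<subseteq> edges E \<Longrightarrow> f \<in> edges E \<Longrightarrow> B f * sAB D = (if f \<in> D then B f else 0)"
proof -
  assume D: "finite D" "D \<subseteq> edges E" and f: "f \<in> edges E"
  have "B f * sAB D = (\<Sum>e\<in>D. if e = f then B f else 0)"
    unfolding sAB_def sum_distrib_left using D(2) f
    by (intro sum.cong) (auto simp: BA_assoc VB)
  then show ?thesis using D(1) by simp
qed

lemma V_sAB: "v \<in> verts E \<Longrightarrow> D \<subseteq> emits E v \<Longrightarrow> V v * sAB D = sAB D"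
  unfolding sAB_def sum_distrib_left
  by (intro sum.cong) (auto simp: mult.assoc[symmetric] V_A emits_edge)

lemma sAB_V: "v \<in> verts E \<Longrightarrow> D \<subseteq> emits E v \<Longrightarrow> sAB D * V v = sAB D"
  unfolding sAB_def sum_distrib_right
  by (intro sum.cong) (auto simp: mult.assoc B_V emits_edge)

lemma V_gap: "v \<in> verts E \<Longrightarrow> V v * gap X v = gap X v" and gap_V: "v \<in> verts E \<Longrightarrow> gap X v * V v = gap X v"
  by (simp_all add: gap_def algebra_simps VV) (subst V_sAB sAB_V; auto)+

text \<open>\<open>B f * A e\<close> selects one summand: an edge leaving \<open>X\<close> cancels
  against \<open>V v\<close>, an edge into \<open>X\<close> meets no summand.\<close>

lemma gap_A:
  assumes "v \<in> verts E" "finite {e \<in> emits E v. rng E e \<in> verts E - X}" "e \<in> edges E"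
  shows "gap X v * A e = (if src E e = v \<and> rng E e \<in> X then A e else 0)"
proof -
  have "{e \<in> emits E v. rng E e \<in> verts E - X} \<subseteq> edges E" by (auto simp: emits_edge)
  then show ?thesis
    using assms sAB_A[OF assms(2) _ assms(3)] src_rng_verts
    by (auto simp: gap_def left_diff_distrib V_A emits_edge)
qed

lemma B_gap:
  assumes "v \<in> verts E" "finite {e \<in> emits E v. rng E e \<in> verts E - X}" "e \<in> edges E"
  shows "B e * gap X v = (if src E e = v \<and> rng E e \<in> X then B e else 0)"
proof -
  have "{e \<in> emits E v. rng E e \<in> verts E - X} \<subseteq> edges E" by (auto simp: emits_edge)
  then show ?thesis
    using assms B_sAB[OF assms(2) _ assms(3)] src_rng_verts
    by (auto simp: gap_def right_diff_distrib B_V emits_edge)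
qed

lemma gap_sAB:
  assumes "v \<in> verts E" "finite {e \<in> emits E v. rng E e \<in> verts E - X}" "finite D" "D \<subseteq> emits E v"
  shows "gap X v * sAB D = sAB {e \<in> D. rng E e \<in> X}" "sAB D * gap X v = sAB {e \<in> D. rng E e \<in> X}"
proof -
  have "gap X v * sAB D = (\<Sum>e\<in>D. if rng E e \<in> X then A e * B e else 0)"
    unfolding sAB_def sum_distrib_left using assms
    by (intro sum.cong) (auto simp: mult.assoc[symmetric] gap_A emits_edge)
  then show "gap X v * sAB D = sAB {e \<in> D. rng E e \<in> X}"
    using assms(3) by (simp add: sAB_def sum.inter_filter)
  have "sAB D * gap X v = (\<Sum>e\<in>D. if rng E e \<in> X then A e * B e else 0)"
    unfolding sAB_def sum_distrib_right using assms
    by (intro sum.cong) (auto simp: mult.assoc B_gap emits_edge)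
  then show "sAB D * gap X v = sAB {e \<in> D. rng E e \<in> X}"
    using assms(3) by (simp add: sAB_def sum.inter_filter)
qed

lemma sAB_Un: "finite C \<Longrightarrow> finite D \<Longrightarrow> C \<inter> D = {} \<Longrightarrow> sAB (C \<union> D) = sAB C + sAB D"
  unfolding sAB_def by (rule sum.union_disjoint)

text \<open>As idempotents \<open>v^X\<close> lies below \<open>v^Y\<close>: their difference is the
  sum of \<open>A e * B e\<close> over the edges from \<open>v\<close> into \<open>Y - X\<close>,
  which is the part of the larger sum that \<open>v^Y\<close> keeps.\<close>

lemma gap_gap:
  assumes v: "v \<in> verts E" and XY: "X \<subseteq> Y" and fin: "finite {e \<in> emits E v. rng E e \<in> verts E - X}"
  shows "gap Y v * gap X v = gap X v" "gap X v * gap Y v = gap X v"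
proof -
  let ?X = "{e \<in> emits E v. rng E e \<in> verts E - X}" and ?Y = "{e \<in> emits E v. rng E e \<in> verts E - Y}"
  have finY: "finite ?Y" by (rule finite_subset[OF _ fin]) (use XY in auto)
  have X: "sAB ?X = sAB ?Y + sAB {e \<in> ?X. rng E e \<in> Y}"
  proof -
    have "?X = ?Y \<union> {e \<in> ?X. rng E e \<in> Y}" using XY by auto
    then have "sAB ?X = sAB (?Y \<union> {e \<in> ?X. rng E e \<in> Y})" by (rule arg_cong)
    also have "\<dots> = sAB ?Y + sAB {e \<in> ?X. rng E e \<in> Y}" by (rule sAB_Un[OF finY finite_subset[OF _ fin]]) auto
    finally show ?thesis .
  qed
  have "gap Y v * gap X v = gap Y v * V v - gap Y v * sAB ?X"
    by (simp add: gap_def[of X] right_diff_distrib)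
  also have "\<dots> = gap Y v - sAB {e \<in> ?X. rng E e \<in> Y}"
    by (subst gap_sAB(1)[OF v finY fin]) (auto simp: gap_V v)
  also have "\<dots> = gap X v" unfolding gap_def X by (simp only: diff_diff_eq)
  finally show "gap Y v * gap X v = gap X v" .
  have "gap X v * gap Y v = V v * gap Y v - sAB ?X * gap Y v"
    by (simp add: gap_def[of X] left_diff_distrib)
  also have "\<dots> = gap Y v - sAB {e \<in> ?X. rng E e \<in> Y}"
    by (subst gap_sAB(2)[OF v finY fin]) (auto simp: V_gap v)
  also have "\<dots> = gap X v" unfolding gap_def X by (simp only: diff_diff_eq)
  finally show "gap X v * gap Y v = gap X v" .
qed

lemma hom_vH:
  assumes hom: "alg_hom (free_alg E) sc h"
    and h_gens: "\<And>v. h (gv v) = V v" "\<And>e. h (ge e) = A e" "\<And>e. h (gs e) = B e"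
    and v: "v \<in> verts E"
  shows "h (vH E X v) = gap X v"
proof -
  let ?D = "{e \<in> emits E v. rng E e \<in> verts E - X}"
  have g: "ge e \<in> free_carrier E" "gs e \<in> free_carrier E" if "e \<in> ?D" for e
    using that by (auto simp: emits_def intro: gen_carrier)
  have m: "fmul (ge e) (gs e) \<in> free_carrier E" if "e \<in> ?D" for e
    by (rule free_carrier_mult[OF g[OF that]])
  have "h (vH E X v) = h (gv v) - h (\<lambda>w. \<Sum>e\<in>?D. fmul (ge e) (gs e) w)"
    unfolding vH_def by (rule hom_fsub[OF hom gen_carrier(1)[OF v] free_carrier_sum[OF m]])
  also have "h (\<lambda>w. \<Sum>e\<in>?D. fmul (ge e) (gs e) w) = (\<Sum>e\<in>?D. h (fmul (ge e) (gs e)))"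
    by (rule hom_sum[OF hom m])
  also have "\<dots> = sAB ?D"
    unfolding sAB_def by (rule sum.cong[OF refl]) (simp only: hom_mult[OF hom g] h_gens)
  finally show ?thesis by (simp only: gap_def h_gens)
qed

text \<open>Only commutation with scalars is meant, not with the whole ring.\<close>

definition central :: "'r \<Rightarrow> bool" where "central x \<longleftrightarrow> (\<forall>c. x * sc c = sc c * x)"

lemma central_gens: "v \<in> verts E \<Longrightarrow> central (V v)" "e \<in> edges E \<Longrightarrow> central (A e)" "e \<in> edges E \<Longrightarrow> central (B e)"
  by (simp_all add: central_def comm)

lemma central_ops: "central 0" "central x \<Longrightarrow> central y \<Longrightarrow> central (x - y)" "central x \<Longrightarrow> central y \<Longrightarrow> central (x * y)"
  by (simp_all add: central_def algebra_simps) (metis mult.assoc)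

lemma central_sAB: "D \<subseteq> edges E \<Longrightarrow> central (sAB D)"
  unfolding central_def sAB_def sum_distrib_left sum_distrib_right
  using central_ops(3) central_gens unfolding central_def by (intro allI sum.cong) auto

lemma central_gap: "v \<in> verts E \<Longrightarrow> central (gap X v)"
  unfolding gap_def by (intro central_ops central_gens central_sAB) (auto simp: emits_edge)

end

text \<open>The two additional axioms say that the family factors through
  \<open>L(E)/I(H,S)\<close>.\<close>

locale porcupine_family =
  porcupine E H S G T + leavitt_family E sc V A B
  for E :: "('v,'e) graph" and H S G T and sc :: "'k::field \<Rightarrow> 'r::{ring,monoid_mult}" and V A B +
  assumes V_H: "v \<in> H \<Longrightarrow> V v = 0" and gap_S: "v \<in> S \<Longrightarrow> gap H v = 0"
begin

text \<open>For old \<open>v\<close> this is the part of \<open>v\<close> inside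
  \<open>I(G,T)\<close>, to be shared between the vertices \<open>v\<close> and \<open>v'\<close> of
  \<open>P\<close>.\<close>

definition loc :: "'v \<Rightarrow> 'r" where "loc v = (if v \<in> G then V v else gap G v)"

definition Qo :: "'v \<Rightarrow> 'r" where "Qo v = loc v - (if v \<in> primed then gap H v else 0)"

text \<open>Conjugation by one edge at a time mirrors the edge \<open>f^p\<close> from
  \<open>w^p\<close> to \<open>w^q\<close>. The empty path is not in \<open>porc\<close>, so its
  value is a dummy.\<close>

fun Qw :: "'e list \<Rightarrow> 'r" where
  "Qw [] = 0"
| "Qw [e] = A e * loc (rng E e) * B e"
| "Qw (e # f # p) = A e * Qw (f # p) * B e"

definition Q :: "('v,'e) pq_vert \<Rightarrow> 'r" where
  "Q u = (case u of OldV v \<Rightarrow> Qo v | WV p \<Rightarrow> Qw p | PrimeV v \<Rightarrow> gap H v)"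

lemma Q_simps [simp]: "Q (OldV v) = Qo v" "Q (WV p) = Qw p" "Q (PrimeV v) = gap H v"
  by (simp_all add: Q_def)

definition PA :: "('v,'e) pq_edge \<Rightarrow> 'r" where "PA x = A (base_edge x) * Q (rng P x)"
definition PB :: "('v,'e) pq_edge \<Rightarrow> 'r" where "PB x = Q (rng P x) * B (base_edge x)"

section \<open>Multiplication rules for the idempotents \<open>Q\<close>\<close>

lemma AB_H: "e \<in> edges E \<Longrightarrow> rng E e \<in> H \<Longrightarrow> A e = 0" "e \<in> edges E \<Longrightarrow> rng E e \<in> H \<Longrightarrow> B e = 0"
  using AV[of e] VB[of e] V_H by auto

lemma old_fin: "v \<in> old \<Longrightarrow> v \<notin> G \<Longrightarrow> finite {e \<in> emits E v. rng E e \<in> verts E - G}"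
  using TD by (auto simp: old_def)

lemma V_loc: "v \<in> old \<Longrightarrow> V v * loc v = loc v" and loc_V: "v \<in> old \<Longrightarrow> loc v * V v = loc v"
  using old_verts by (auto simp: loc_def V_gap gap_V VV)

lemma loc_A: "v \<in> old \<Longrightarrow> e \<in> edges E \<Longrightarrow> loc v * A e = (if src E e = v \<and> rng E e \<in> G then A e else 0)"
  using gap_A[OF old_verts(1) old_fin, of v e] old_verts G_edge V_A by (auto simp: loc_def)

lemma B_loc: "v \<in> old \<Longrightarrow> e \<in> edges E \<Longrightarrow> B e * loc v = (if src E e = v \<and> rng E e \<in> G then B e else 0)"
  using B_gap[OF old_verts(1) old_fin, of v e] old_verts G_edge B_V by (auto simp: loc_def)

lemma loc_loc: "v \<in> old \<Longrightarrow> loc v * loc v = loc v"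
  using gap_gap[OF old_verts(1) order.refl old_fin, of v] old_verts by (auto simp: loc_def VV)

text \<open>Edges ending outside \<open>H\<close> are cancelled by the subtracted sum, and edges
  ending in \<open>H\<close> are zero because their range is. This is the algebraic form of
  \<open>v'\<close> being a sink.\<close>

lemma gapH_A: "v \<in> primed \<Longrightarrow> e \<in> edges E \<Longrightarrow> gap H v * A e = 0"
  and B_gapH: "v \<in> primed \<Longrightarrow> e \<in> edges E \<Longrightarrow> B e * gap H v = 0"
  using gap_A[of v H e] B_gap[of v H e] primedD[of v] old_verts AB_H by auto

lemma loc_gapH: "v \<in> primed \<Longrightarrow> loc v * gap H v = gap H v"
  and gapH_loc: "v \<in> primed \<Longrightarrow> gap H v * loc v = gap H v"
  and gapH_gapH: "v \<in> primed \<Longrightarrow> gap H v * gap H v = gap H v"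
  using gap_gap[OF old_verts(1) HG primedD(5), of v] gap_gap[OF old_verts(1) order.refl primedD(5), of v]
    primedD(1)[of v] old_verts by (auto simp: loc_def V_gap gap_V)

lemma Qo_A: "v \<in> old \<Longrightarrow> e \<in> edges E \<Longrightarrow> Qo v * A e = (if src E e = v \<and> rng E e \<in> G then A e else 0)"
  by (simp add: Qo_def left_diff_distrib loc_A gapH_A)

lemma B_Qo: "v \<in> old \<Longrightarrow> e \<in> edges E \<Longrightarrow> B e * Qo v = (if src E e = v \<and> rng E e \<in> G then B e else 0)"
  by (simp add: Qo_def right_diff_distrib B_loc B_gapH)

lemma Qo_idem: "v \<in> old \<Longrightarrow> Qo v * Qo v = Qo v"
  and loc_Qo: "v \<in> old \<Longrightarrow> loc v * Qo v = Qo v" and Qo_loc: "v \<in> old \<Longrightarrow> Qo v * loc v = Qo v"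
  by (simp_all add: Qo_def algebra_simps loc_loc loc_gapH gapH_loc gapH_gapH)

lemma Qo_gapH: "v \<in> primed \<Longrightarrow> Qo v * gap H v = 0" and gapH_Qo: "v \<in> primed \<Longrightarrow> gap H v * Qo v = 0"
  by (simp_all add: Qo_def algebra_simps loc_gapH gapH_loc gapH_gapH)

lemma loc_split: "loc v = Qo v + (if v \<in> primed then gap H v else 0)"
  by (simp add: Qo_def)

lemma porc_rng_old: "[e] \<in> porc \<Longrightarrow> rng E e \<in> old"
  by (auto simp: porc_single old_def)

lemma Qw_form: "p \<in> porc \<Longrightarrow> \<exists>m. Qw p = A (hd p) * m * B (hd p)"
  by (induction rule: porc_induct) auto

lemma V_Q: "u \<in> verts P \<Longrightarrow> V (base_vert E u) * Q u = Q u"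
  and Q_V: "u \<in> verts P \<Longrightarrow> Q u * V (base_vert E u) = Q u"
proof -
  assume u: "u \<in> verts P"
  have "V (base_vert E u) * Q u = Q u \<and> Q u * V (base_vert E u) = Q u"
  proof (cases u)
    case (OldV v)
    then show ?thesis using u old_verts
      by (simp add: Qo_def algebra_simps V_loc loc_V V_gap gap_V)
  next
    case (PrimeV v)
    then show ?thesis using u old_verts primedD(1) by (simp add: V_gap gap_V)
  next
    case (WV p)
    then have p: "p \<in> porc" using u by simp
    then obtain m where "Qw p = A (hd p) * m * B (hd p)" using Qw_form by blast
    then show ?thesis using WV VA[OF porc_hd[OF p]] BV[OF porc_hd[OF p]]
      by (simp add: mult.assoc) (simp add: mult.assoc[symmetric])
  qed
  then show "V (base_vert E u) * Q u = Q u" "Q u * V (base_vert E u) = Q u" by auto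
qed

lemma V_Q': "v \<in> verts E \<Longrightarrow> u \<in> verts P \<Longrightarrow> V v * Q u = (if base_vert E u = v then Q u else 0)"
  using V_Q[of u] VV[of v "base_vert E u"] base_vert_verts[of u] by (metis mult.assoc mult_zero_left)

lemma Q_V': "v \<in> verts E \<Longrightarrow> u \<in> verts P \<Longrightarrow> Q u * V v = (if base_vert E u = v then Q u else 0)"
  using Q_V[of u] VV[of "base_vert E u" v] base_vert_verts[of u] by (metis mult.assoc mult_zero_right)

text \<open>The left factor keeps only edges into \<open>G\<close>, whereas \<open>Qw p\<close>
  begins and ends with the first edge of \<open>p\<close>, which leaves \<open>G\<close> by
  \<open>porc_rng\<close>.\<close>

lemma Qw_zero:
  assumes "p \<in> porc" "v \<in> old" "src E (hd p) = v"
  shows "loc v * Qw p = 0" "Qw p * loc v = 0" "Qo v * Qw p = 0" "Qw p * Qo v = 0"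
proof -
  obtain m where m: "Qw p = A (hd p) * m * B (hd p)" using Qw_form assms(1) by blast
  have *: "rng E (hd p) \<notin> G" using porc_rng assms by blast
  show "loc v * Qw p = 0" "Qo v * Qw p = 0"
    unfolding m mult.assoc[symmetric] using assms * porc_hd by (simp_all add: loc_A Qo_A)
  show "Qw p * loc v = 0" "Qw p * Qo v = 0"
    unfolding m mult.assoc using assms * porc_hd by (simp_all add: B_loc B_Qo)
qed

lemma gapH_Qw:
  assumes "p \<in> porc" "v \<in> primed"
  shows "gap H v * Qw p = 0" "Qw p * gap H v = 0"
proof -
  obtain m where m: "Qw p = A (hd p) * m * B (hd p)" using Qw_form assms(1) by blast
  show "gap H v * Qw p = 0"
    unfolding m mult.assoc[symmetric] using assms porc_hd by (simp add: gapH_A)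
  show "Qw p * gap H v = 0"
    unfolding m mult.assoc using assms porc_hd by (simp add: B_gapH)
qed

lemma porc_cases [consumes 1, case_names single Cons]:
  assumes "q \<in> porc"
  obtains f where "q = [f]" "[f] \<in> porc" "f \<in> edges E" "rng E f \<in> old"
  | f g r where "q = f # g # r" "f \<in> edges E" "rng E f = src E g" "g # r \<in> porc" "f # g # r \<in> porc"
  using assms
  by (induction rule: porc_induct) (use porc_rng_old porc_single in blast)+

lemma V_Qw: "f # p \<in> porc \<Longrightarrow> V (src E f) * Qw (f # p) = Qw (f # p)"
  "f # p \<in> porc \<Longrightarrow> Qw (f # p) * V (src E f) = Qw (f # p)"
  using V_Q[of "WV (f # p)"] Q_V[of "WV (f # p)"] by auto

lemma B_Qw_single: "e \<in> edges E \<Longrightarrow> [f] \<in> porc \<Longrightarrow> B e * Qw [f] = (if e = f then loc (rng E f) * B f else 0)"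
  and Qw_A_single: "e \<in> edges E \<Longrightarrow> [f] \<in> porc \<Longrightarrow> Qw [f] * A e = (if e = f then A f * loc (rng E f) else 0)"
proof -
  assume e: "e \<in> edges E" and f: "[f] \<in> porc"
  then have "f \<in> edges E" "rng E f \<in> old" by (auto simp: porc_single old_def)
  then show "B e * Qw [f] = (if e = f then loc (rng E f) * B f else 0)"
    and "Qw [f] * A e = (if e = f then A f * loc (rng E f) else 0)"
    using e by (auto simp: mult.assoc BA_assoc BA loc_V) (simp add: mult.assoc[symmetric] V_loc)
qed

lemma B_Qw_Cons:
    "e \<in> edges E \<Longrightarrow> f # g # r \<in> porc \<Longrightarrow> B e * Qw (f # g # r) = (if e = f then Qw (g # r) * B f else 0)"
  and Qw_A_Cons:
    "e \<in> edges E \<Longrightarrow> f # g # r \<in> porc \<Longrightarrow> Qw (f # g # r) * A e = (if e = f then A f * Qw (g # r) else 0)"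
proof -
  assume e: "e \<in> edges E" and p: "f # g # r \<in> porc"
  then have f: "f \<in> edges E" "rng E f = src E g" "g # r \<in> porc" using porc_Cons[of "g # r" f] by auto
  have "B e * Qw (f # g # r) = B e * (A f * Qw (g # r)) * B f" by (simp add: mult.assoc)
  then show "B e * Qw (f # g # r) = (if e = f then Qw (g # r) * B f else 0)"
    using e f by (auto simp: BA_assoc V_Qw)
  have "Qw (f # g # r) * A e = A f * (Qw (g # r) * (B f * A e))" by (simp add: mult.assoc)
  then show "Qw (f # g # r) * A e = (if e = f then A f * Qw (g # r) else 0)"
    using e f by (auto simp: BA V_Qw)
qed

text \<open>\<open>B e * A g\<close> compares the first edges and, if they agree, disappears. When
  one path is exhausted before the other, an old vertex meets a remaining path that starts there,
  and \<open>Qw_zero\<close> applies.\<close>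

lemma Qw_Qw: "p \<in> porc \<Longrightarrow> q \<in> porc \<Longrightarrow> Qw p * Qw q = (if p = q then Qw p else 0)"
proof (induction p arbitrary: q rule: porc_induct)
  case (single e)
  then have e: "e \<in> edges E" "rng E e \<in> old" using porc_rng_old by (auto simp: porc_single)
  from single(2) show ?case
  proof (cases rule: porc_cases)
    case (single f)
    have "Qw [e] * Qw q = A e * (loc (rng E e) * ((B e * A f) * loc (rng E f))) * B f"
      using single by (simp add: mult.assoc)
    then show ?thesis using single e by (auto simp: BA V_loc loc_loc)
  next
    case (Cons f g r)
    have "Qw [e] * Qw q = A e * (loc (rng E e) * ((B e * A f) * Qw (g # r))) * B f"
      using Cons by (simp add: mult.assoc)
    then show ?thesis using Cons e Qw_zero(1)[of "g # r" "rng E e"] by (auto simp: BA V_Qw)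
  qed
next
  case (Cons e f p)
  from Cons.prems show ?case
  proof (cases rule: porc_cases)
    case (single g)
    have "Qw (e # f # p) * Qw q = A e * (Qw (f # p) * ((B e * A g) * loc (rng E g))) * B g"
      using single by (simp add: mult.assoc)
    then show ?thesis using single Cons Qw_zero(2)[of "f # p" "rng E g"] by (auto simp: BA V_loc)
  next
    case *: (Cons g h r)
    have "Qw (e # f # p) * Qw q = A e * (Qw (f # p) * ((B e * A g) * Qw (h # r))) * B g"
      using * by (simp add: mult.assoc)
    moreover have "B e * A g * Qw (h # r) = (if e = g then Qw (h # r) else 0)"
      using * Cons.hyps by (simp add: BA V_Qw)
    moreover have "Qw (f # p) * Qw (h # r) = (if f # p = h # r then Qw (f # p) else 0)"
      by (rule Cons.IH) (fact *)
    ultimately show ?thesis using * by auto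
  qed
qed

lemma Q_Q:
  assumes u: "u \<in> verts P" and u': "u' \<in> verts P"
  shows "Q u * Q u' = (if u = u' then Q u else 0)"
proof (cases "base_vert E u = base_vert E u'")
  case False
  have "Q u * Q u' = Q u * (V (base_vert E u) * Q u')"
    using Q_V[OF u] by (simp add: mult.assoc[symmetric])
  also have "\<dots> = 0" using V_Q'[OF _ u'] base_vert_verts[OF u] False by auto
  finally show ?thesis using False by auto
next
  case True
  then show ?thesis using u u'
    by (cases u; cases u')
       (auto simp: Qo_idem Qo_gapH gapH_Qo gapH_gapH Qw_zero gapH_Qw Qw_Qw)
qed

lemma Q_PA: "x \<in> edges P \<Longrightarrow> Q (src P x) * PA x = PA x"
  and PB_Q: "x \<in> edges P \<Longrightarrow> PB x * Q (src P x) = PB x"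
proof -
  assume x: "x \<in> edges P"
  let ?e = "base_edge x" and ?u = "rng P x"
  note e = edge_props[OF x]
  have *: "Q (src P x) * A ?e * Q ?u = A ?e * Q ?u \<and> Q ?u * (B ?e * Q (src P x)) = Q ?u * B ?e"
  proof (cases "src P x")
    case (OldV v)
    then have "rng E ?e \<in> G" using x by (cases x) (auto split: if_splits)
    then show ?thesis using OldV e by (simp add: Qo_A B_Qo)
  next
    case (PrimeV v)
    then show ?thesis using x by (cases x) (auto split: if_splits)
  next
    case (WV p)
    then have p: "p \<in> porc" using e by simp
    then show ?thesis
    proof (cases rule: porc_cases)
      case (single f)
      have x': "x = FE [f] \<or> x = PrimeE f \<and> rng E f \<in> primed"
        using x WV single(1) emits_WV_single[OF single(2)] by (auto simp: emits_def split: if_splits)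
      \<comment> \<open>The edges at \<open>w^f\<close> end in \<open>v\<close> and possibly in
        \<open>v'\<close>, and both idempotents lie below \<open>loc\<close>.\<close>
      then have "Q ?u = loc (rng E f) * Q ?u" "Q ?u = Q ?u * loc (rng E f)" "?e = f"
        using single by (auto simp: loc_Qo Qo_loc loc_gapH gapH_loc)
      then have "Qw [f] * A ?e * Q ?u = A ?e * Q ?u" "Q ?u * (B ?e * Qw [f]) = Q ?u * B ?e"
        using Qw_A_single[OF single(3,2)] B_Qw_single[OF single(3,2)]
        by (simp_all only: if_True simp_thms mult.assoc) (simp add: mult.assoc[symmetric])
      then show ?thesis using WV single by simp
    next
      case (Cons f g r)
      have "x = FE p" using x WV Cons emits_WV_Cons[of f g r] by (auto simp: emits_def)
      then show ?thesis using WV Cons Qw_Qw[OF Cons(4,4)]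
        by (simp only: Q_simps base_edge.simps list.sel B_Qw_Cons Qw_A_Cons P_rng if_True simp_thms mult.assoc)
           (simp add: mult.assoc[symmetric])
    qed
  qed
  then show "Q (src P x) * PA x = PA x" "PB x * Q (src P x) = PB x"
    by (simp_all add: PA_def PB_def mult.assoc)
qed

lemma PA_PB: "x \<in> edges P \<Longrightarrow> PA x * PB x = A (base_edge x) * Q (rng P x) * B (base_edge x)"
  using Q_Q[of "rng P x" "rng P x"] edge_props(3)[of x]
  by (simp add: PA_def PB_def mult.assoc) (simp add: mult.assoc[symmetric])

text \<open>If \<open>v\<close> is primed, the subtraction of \<open>v^H\<close> leaves exactly the
  sum over edges into \<open>G - H\<close>. Otherwise \<open>v\<close> is in \<open>S\<close>, where
  \<open>v^H = 0\<close> yields the same sum, or a finite emitter, where the relation of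
  \<open>E\<close> applies and edges into \<open>H\<close> vanish. A vertex of \<open>T - S\<close>
  is an infinite emitter and so falls under the first case.\<close>

lemma Qo_regular:
  assumes v: "v \<in> old" and X: "finite {e \<in> emits E v. rng E e \<in> G - H}" "{e \<in> emits E v. rng E e \<in> G - H} \<noteq> {}"
  shows "Qo v = sAB {e \<in> emits E v. rng E e \<in> G - H}"
proof -
  let ?X = "{e \<in> emits E v. rng E e \<in> G - H}"
  have G: "{e \<in> emits E v. rng E e \<in> verts E - H} = ?X" if "v \<in> G"
    using that G_edge src_rng_verts by (auto simp: emits_edge)
  show ?thesis
  proof (cases "v \<in> primed")
    case True
    show ?thesis
    proof (cases "v \<in> G")
      case True
      then show ?thesis using \<open>v \<in> primed\<close> G by (simp add: Qo_def loc_def gap_def)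
    next
      case False
      have "{e \<in> emits E v. rng E e \<in> verts E - H} = {e \<in> emits E v. rng E e \<in> verts E - G} \<union> ?X"
        using src_rng_verts HG by (auto simp: emits_edge)
      moreover have "sAB ({e \<in> emits E v. rng E e \<in> verts E - G} \<union> ?X) =
          sAB {e \<in> emits E v. rng E e \<in> verts E - G} + sAB ?X"
        using old_fin[OF v False] X by (intro sAB_Un) auto
      ultimately show ?thesis using \<open>v \<in> primed\<close> False by (simp add: Qo_def loc_def gap_def)
    qed
  next
    case False
    with v X have "v \<in> S \<or> finite (emits E v)" by (auto simp: primed_iff)
    then have "v \<in> G" using v TD(4)[of v] by (auto simp: old_def)
    have "V v = sAB ?X"
    proof (cases "v \<in> S")
      case True
      then show ?thesis using gap_S[OF True] G[OF \<open>v \<in> G\<close>] by (simp add: gap_def)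
    next
      case False
      then have "finite (emits E v)" using \<open>v \<in> S \<or> finite (emits E v)\<close> by simp
      moreover have "emits E v \<noteq> {}" using X by auto
      ultimately have "V v = sAB (emits E v)" using CK[of v] old_verts[OF v] by (simp add: sAB_def)
      also have "\<dots> = sAB ?X" unfolding sAB_def
        using \<open>finite (emits E v)\<close> \<open>v \<in> G\<close> AB_H G_edge
        by (intro sum.mono_neutral_right) (auto simp: emits_edge)
      finally show ?thesis .
    qed
    then show ?thesis using False \<open>v \<in> G\<close> by (simp add: Qo_def loc_def)
  qed
qed

text \<open>The pair of edges over \<open>e\<close>, one ending in \<open>v\<close> and one in
  \<open>v'\<close>, restores the sum \<open>Q(v) + Q(v') = loc v\<close>. So the sum over edges of
  \<open>P\<close> collapses to one over edges of \<open>E\<close>.\<close>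

lemma PA_PB_sum:
  assumes u: "u \<in> verts P" and fin: "finite (emits P u)" and ne: "emits P u \<noteq> {}"
  shows "Q u = (\<Sum>x\<in>emits P u. PA x * PB x)"
proof -
  have "(\<Sum>x\<in>emits P u. PA x * PB x) = (\<Sum>x\<in>emits P u. A (base_edge x) * Q (rng P x) * B (base_edge x))"
    by (rule sum.cong) (auto simp: PA_PB emits_def)
  also have "\<dots> = Q u"
  proof (cases u)
    case (PrimeV v)
    then show ?thesis using ne by (simp add: emits_PrimeV)
  next
    case (WV p)
    then have "p \<in> porc" using u by simp
    then show ?thesis
    proof (cases rule: porc_cases)
      case (single f)
      then show ?thesis unfolding WV single emits_WV_single[OF single(2)]
        by (auto simp: loc_split distrib_left distrib_right)
    next
      case (Cons f g r)
      then show ?thesis unfolding WV Cons emits_WV_Cons[OF Cons(5)] by simp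
    qed
  next
    case (OldV v)
    then have v: "v \<in> old" using u by simp
    let ?X = "{e \<in> emits E v. rng E e \<in> G - H}" and ?Y = "{e \<in> emits E v. rng E e \<in> G \<and> rng E e \<in> primed}"
    let ?f = "\<lambda>x. A (base_edge x) * Q (rng P x) * B (base_edge x)"
    have em: "emits P u = OldE ` ?X \<union> PrimeE ` ?Y" using emits_OldV[OF v] OldV by simp
    \<comment> \<open>A primed range is old and hence outside \<open>H\<close>, so each
      \<open>e'\<close> at \<open>v\<close> is accompanied by the edge \<open>e\<close>
      itself.\<close>
    have YX: "?Y \<subseteq> ?X" using primedD(1) old_verts by auto
    have X: "finite ?X" using fin unfolding em by (auto dest: finite_imageD simp: inj_on_def)
    have Y: "finite ?Y" using YX X by (rule finite_subset)
    have X0: "?X \<noteq> {}" using ne YX unfolding em by auto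
    have "sum ?f (emits P u) = sum ?f (OldE ` ?X) + sum ?f (PrimeE ` ?Y)"
      unfolding em using X Y by (intro sum.union_disjoint) auto
    also have "sum ?f (OldE ` ?X) = (\<Sum>e\<in>?X. A e * Qo (rng E e) * B e)"
      by (subst sum.reindex) (auto simp: inj_on_def)
    also have "sum ?f (PrimeE ` ?Y) = (\<Sum>e\<in>?Y. A e * gap H (rng E e) * B e)"
      by (subst sum.reindex) (auto simp: inj_on_def)
    also have "\<dots> = (\<Sum>e\<in>?X. if rng E e \<in> primed then A e * gap H (rng E e) * B e else 0)"
    proof -
      have "?Y = {e \<in> ?X. rng E e \<in> primed}" using YX by auto
      then show ?thesis using sum.inter_filter[OF X] by simp
    qed
    also have "(\<Sum>e\<in>?X. A e * Qo (rng E e) * B e) + \<dots> = sAB ?X"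
      unfolding sAB_def sum.distrib[symmetric]
    proof (rule sum.cong)
      fix e assume e: "e \<in> ?X"
      have "A e * Qo (rng E e) * B e + (if rng E e \<in> primed then A e * gap H (rng E e) * B e else 0)
         = A e * loc (rng E e) * B e"
        by (simp add: loc_split distrib_left distrib_right)
      also have "\<dots> = A e * B e" using e AV[of e] by (simp add: loc_def emits_edge)
      finally show "A e * Qo (rng E e) * B e + (if rng E e \<in> primed then A e * gap H (rng E e) * B e else 0)
         = A e * B e" .
    qed simp
    also have "\<dots> = Q u" using Qo_regular[OF v X X0] OldV by simp
    finally show ?thesis .
  qed
  finally show ?thesis by simp
qed

lemma central_loc: "v \<in> old \<Longrightarrow> central (loc v)"
  using old_verts by (auto simp: loc_def intro: central_gap central_gens)

lemma central_Q: "u \<in> verts P \<Longrightarrow> central (Q u)"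
proof (cases u)
  case (WV p)
  have "p \<in> porc \<Longrightarrow> central (Qw p)"
    by (induction rule: porc_induct)
       (auto simp: porc_single intro!: central_ops central_gens central_loc dest: porc_rng_old, auto simp: old_def)
  then show "u \<in> verts P \<Longrightarrow> ?thesis" using WV by simp
qed (use old_verts primedD(1) in \<open>auto simp: Qo_def intro!: central_ops central_gens central_loc central_gap\<close>)

lemma family_P: "leavitt_family P sc Q PA PB"
proof
  show "wf_graph P" by (rule wf_P)
  show "scalars sc" by (rule scalars)
  fix c
  show "Q u * sc c = sc c * Q u" if "u \<in> verts P" for u
    using central_Q[OF that] by (simp add: central_def)
  show "PA x * sc c = sc c * PA x" if "x \<in> edges P" for x
    using central_ops(3)[OF central_gens(2) central_Q, of "base_edge x" "rng P x"] edge_props[OF that]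
    by (simp add: central_def PA_def)
  show "PB x * sc c = sc c * PB x" if "x \<in> edges P" for x
    using central_ops(3)[OF central_Q central_gens(3), of "rng P x" "base_edge x"] edge_props[OF that]
    by (simp add: central_def PB_def)
next
  show "PA x * Q (rng P x) = PA x" if "x \<in> edges P" for x
    using Q_Q edge_props[OF that] by (simp add: PA_def mult.assoc)
  show "Q (rng P x) * PB x = PB x" if "x \<in> edges P" for x
    using Q_Q edge_props[OF that] by (simp add: PB_def mult.assoc[symmetric])
  show "PB x * PA y = (if x = y then Q (rng P x) else 0)" if xy: "x \<in> edges P" "y \<in> edges P" for x y
  proof (cases "base_edge x = base_edge y")
    case True
    \<comment> \<open>Over a common base edge the product reduces to range idempotents, and by
      unique lifting these have the same index only for \<open>x = y\<close>.\<close>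
    have "PB x * PA y = Q (rng P x) * (V (rng E (base_edge x)) * Q (rng P y))"
      using True edge_props[OF xy(2)] by (simp add: PA_def PB_def mult.assoc BA_assoc)
    also have "\<dots> = Q (rng P x) * Q (rng P y)"
      using True edge_props[OF xy(2)] V_Q[of "rng P y"] by simp
    finally show ?thesis using Q_Q edge_props[OF xy(1)] edge_props[OF xy(2)] edge_eqI[OF xy True] by auto
  next
    case False
    then show ?thesis using edge_props[OF xy(1)] edge_props[OF xy(2)]
      by (auto simp: PA_def PB_def mult.assoc BA_assoc)
  qed
qed (fact Q_Q Q_PA PB_Q PA_PB_sum)+

section \<open>Generators of \<open>E\<close> times idempotents \<open>Q\<close>: the image absorbs
  \<open>L(E)\<close>\<close>

lemma A_Q:
  "e \<in> edges E \<Longrightarrow> u \<in> verts P \<Longrightarrow> A e * Q u = (if base_vert E u = rng E e then PA (lift e u) else 0)"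
proof -
  assume e: "e \<in> edges E" and u: "u \<in> verts P"
  have "A e * Q u = A e * (V (rng E e) * Q u)" using AV[OF e] by (simp add: mult.assoc[symmetric])
  then show ?thesis
    using V_Q'[OF src_rng_verts(2)[OF e] u] lift_props[OF e u]
    by (cases "base_vert E u = rng E e") (simp_all add: PA_def)
qed

lemma Q_B:
  "e \<in> edges E \<Longrightarrow> u \<in> verts P \<Longrightarrow> Q u * B e = (if base_vert E u = rng E e then PB (lift e u) else 0)"
proof -
  assume e: "e \<in> edges E" and u: "u \<in> verts P"
  have "Q u * B e = Q u * V (rng E e) * B e" using VB[OF e] by (simp add: mult.assoc)
  then show ?thesis
    using Q_V'[OF src_rng_verts(2)[OF e] u] lift_props[OF e u]
    by (cases "base_vert E u = rng E e") (simp_all add: PB_def)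
qed

text \<open>Here the lifts of \<open>e\<close> start at \<open>u\<close> instead of ending there, so
  uniqueness fails: \<open>e'\<close> may accompany \<open>e\<close> or \<open>f^e\<close>. The sum
  replaces the single lift of \<open>A_Q\<close> and \<open>Q_B\<close>.\<close>

lemma B_Q_Q_A:
  assumes e: "e \<in> edges E" and u: "u \<in> verts P"
  shows "B e * Q u = (\<Sum>x\<in>{x \<in> emits P u. base_edge x = e}. PB x)"
    "Q u * A e = (\<Sum>x\<in>{x \<in> emits P u. base_edge x = e}. PA x)"
proof -
  \<comment> \<open>Both identities follow from the sum of the range idempotents alone; it turns out
    to be \<open>0\<close>, a value of \<open>loc\<close>, or \<open>Qw\<close> of the shortened
    path.\<close>
  let ?R = "\<Sum>x\<in>{x \<in> emits P u. base_edge x = e}. Q (rng P x)"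
  have "(\<Sum>x\<in>{x \<in> emits P u. base_edge x = e}. PB x) = ?R * B e"
    "(\<Sum>x\<in>{x \<in> emits P u. base_edge x = e}. PA x) = A e * ?R"
    by (auto simp: PA_def PB_def sum_distrib_left sum_distrib_right)
  moreover have "B e * Q u = ?R * B e \<and> Q u * A e = A e * ?R"
  proof (cases u)
    case (PrimeV v)
    then show ?thesis using u e by (simp add: emits_PrimeV B_gapH gapH_A)
  next
    case (WV p)
    then have "p \<in> porc" using u by simp
    then show ?thesis
    proof (cases rule: porc_cases)
      case (single f)
      have "{x \<in> emits P u. base_edge x = e} =
          (if e = f then insert (FE [f]) (if rng E f \<in> primed then {PrimeE f} else {}) else {})"
        unfolding WV single(1) emits_WV_single[OF single(2)] by auto
      then have "?R = (if e = f then loc (rng E f) else 0)"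
        by (simp add: loc_split)
      then show ?thesis unfolding WV single(1)
        using B_Qw_single[OF e single(2)] Qw_A_single[OF e single(2)] by simp
    next
      case (Cons f g r)
      have "{x \<in> emits P u. base_edge x = e} = (if e = f then {FE (f # g # r)} else {})"
        unfolding WV Cons(1) emits_WV_Cons[OF Cons(5)] by auto
      then have "?R = (if e = f then Qw (g # r) else 0)"
        by simp
      then show ?thesis unfolding WV Cons(1)
        using B_Qw_Cons[OF e Cons(5)] Qw_A_Cons[OF e Cons(5)] by simp
    qed
  next
    case (OldV v)
    then have v: "v \<in> old" using u by simp
    have em: "x \<in> emits P u \<and> base_edge x = e \<longleftrightarrow>
        src E e = v \<and> rng E e \<in> G - H \<and> (x = OldE e \<or> x = PrimeE e \<and> rng E e \<in> primed)" for x
      using e old_verts(2)[OF primedD(1), of "rng E e"]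
      by (cases x) (auto simp: OldV emits_OldV[OF v] emits_edge)
    show ?thesis
    proof (cases "src E e = v \<and> rng E e \<in> G - H")
      case True
      then have "{x \<in> emits P u. base_edge x = e} = insert (OldE e) (if rng E e \<in> primed then {PrimeE e} else {})"
        using em e by auto
      then have "?R = V (rng E e)" using True loc_split[of "rng E e"] by (auto simp: loc_def)
      then show ?thesis using OldV v e True AV[OF e] VB[OF e] by (simp add: Qo_A B_Qo)
    next
      case False
      then have "{x \<in> emits P u. base_edge x = e} = {}"
        using em e by auto
      then have "?R = 0" by (simp only: sum.empty)
      then show ?thesis using OldV v e False AB_H[OF e] by (auto simp: Qo_A B_Qo)
    qed
  qed
  ultimately show "B e * Q u = (\<Sum>x\<in>{x \<in> emits P u. base_edge x = e}. PB x)"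
    "Q u * A e = (\<Sum>x\<in>{x \<in> emits P u. base_edge x = e}. PA x)" by auto
qed

lemma V_G:
  assumes "v \<in> G"
  shows "V v = (if v \<in> H then 0 else Q (OldV v) + (if v \<in> primed then Q (PrimeV v) else 0))"
  using assms loc_split[of v] V_H by (auto simp: loc_def)

text \<open>A vertex of both \<open>S\<close> and \<open>T\<close> is not a vertex of
  \<open>P\<close>. There \<open>v^H = 0\<close> turns \<open>v^G\<close> into the sum of
  \<open>A e * B e\<close> over the finitely many edges into \<open>G - H\<close>, and each such
  \<open>e\<close> is in F1 because \<open>v\<close> is not old.\<close>

lemma gap_T:
  assumes "v \<in> T"
  shows "gap G v = (if v \<in> S then (\<Sum>e\<in>{e \<in> emits E v. rng E e \<in> G - H}. Q (WV [e]))
    else Q (OldV v) + (if v \<in> primed then Q (PrimeV v) else 0))"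
proof (cases "v \<in> S")
  case False
  then show ?thesis using assms loc_split[of v] TD(2)[of v] by (auto simp: loc_def)
next
  case True
  let ?X = "{e \<in> emits E v. rng E e \<in> G - H}"
  have fin: "finite {e \<in> emits E v. rng E e \<in> verts E - H}" using SD[OF True] by simp
  have X: "finite ?X" by (rule finite_subset[OF _ fin]) (use G_verts in auto)
  have "{e \<in> emits E v. rng E e \<in> verts E - H} = {e \<in> emits E v. rng E e \<in> verts E - G} \<union> ?X"
    using src_rng_verts HG by (auto simp: emits_edge)
  moreover have "sAB ({e \<in> emits E v. rng E e \<in> verts E - G} \<union> ?X) =
      sAB {e \<in> emits E v. rng E e \<in> verts E - G} + sAB ?X"
    using TD(5)[OF assms] X by (intro sAB_Un) auto
  ultimately have "gap G v = sAB ?X" using gap_S[OF True] by (simp add: gap_def)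
  also have "\<dots> = (\<Sum>e\<in>?X. Q (WV [e]))" unfolding sAB_def
    using AV by (intro sum.cong) (auto simp: loc_def emits_edge)
  finally show ?thesis using True by simp
qed

lemma gap_T_porc: "v \<in> T \<Longrightarrow> v \<in> S \<Longrightarrow> e \<in> emits E v \<Longrightarrow> rng E e \<in> G - H \<Longrightarrow> [e] \<in> porc"
  using TD(2) by (auto simp: porc_single old_def emits_edge)

end

subsection \<open>Injectivity: \<open>E\<close> acts on modules over the porcupine-quotient graph\<close>

context leavitt_family
begin

definition gsrc :: "('v,'e) gen \<Rightarrow> 'v" where
  "gsrc g = (case g of GV v \<Rightarrow> v | GE e \<Rightarrow> src E e | GS e \<Rightarrow> rng E e)"

definition grng :: "('v,'e) gen \<Rightarrow> 'v" where
  "grng g = (case g of GV v \<Rightarrow> v | GE e \<Rightarrow> rng E e | GS e \<Rightarrow> src E e)"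

lemma gsrc: "gen_ok E g \<Longrightarrow> gsrc g \<in> verts E" "gen_ok E g \<Longrightarrow> V (gsrc g) * gval g = gval g"
  and grng: "gen_ok E g \<Longrightarrow> grng g \<in> verts E" "gen_ok E g \<Longrightarrow> gval g * V (grng g) = gval g"
  by (auto simp: gen_ok_def gsrc_def grng_def gval_def VV VA VB AV BV src_rng_verts split: gen.splits)

lemma sum_V_comm: "W \<subseteq> verts E \<Longrightarrow> (\<Sum>v\<in>W. V v) * sc c = sc c * (\<Sum>v\<in>W. V v)"
  unfolding sum_distrib_left sum_distrib_right by (intro sum.cong) (auto simp: comm)

lemma sum_V_V:
  "finite W \<Longrightarrow> W \<subseteq> verts E \<Longrightarrow> u \<in> W \<Longrightarrow> (\<Sum>v\<in>W. V v) * V u = V u"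
  "finite W \<Longrightarrow> W \<subseteq> verts E \<Longrightarrow> u \<in> W \<Longrightarrow> V u * (\<Sum>v\<in>W. V v) = V u"
proof -
  assume W: "finite W" "W \<subseteq> verts E" "u \<in> W"
  have u: "V v * V u = (if v = u then V u else 0)" "V u * V v = (if v = u then V u else 0)"
    if "v \<in> W" for v
    using VV[of v u] VV[of u v] subsetD[OF W(2) that] subsetD[OF W(2,3)] by auto
  have "(\<Sum>v\<in>W. V v) * V u = (\<Sum>v\<in>W. if v = u then V u else 0)"
    unfolding sum_distrib_right by (rule sum.cong[OF refl]) (rule u(1))
  then show "(\<Sum>v\<in>W. V v) * V u = V u" using W by simp
  have "V u * (\<Sum>v\<in>W. V v) = (\<Sum>v\<in>W. if v = u then V u else 0)"
    unfolding sum_distrib_left by (rule sum.cong[OF refl]) (rule u(2))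
  then show "V u * (\<Sum>v\<in>W. V v) = V u" using W by simp
qed

text \<open>The vertices at both ends of the finitely many words in the support suffice: they are
  orthogonal idempotents, and each word absorbs the ones at its own ends.\<close>

lemma local_unit:
  assumes f: "f \<in> free_carrier E"
  obtains W where "finite W" "W \<subseteq> verts E" "(\<Sum>v\<in>W. V v) * ev f = ev f" "ev f * (\<Sum>v\<in>W. V v) = ev f"
proof -
  define W where "W = (\<lambda>w. gsrc (hd w)) ` {w. f w \<noteq> 0} \<union> (\<lambda>w. grng (last w)) ` {w. f w \<noteq> 0}"
  have ok: "w \<noteq> []" "gen_ok E (hd w)" "gen_ok E (last w)" if "f w \<noteq> 0" for w
  proof -
    show "w \<noteq> []" using that f by (auto simp: free_carrier_def)
    then show "gen_ok E (hd w)" "gen_ok E (last w)" using that f by (auto simp: free_carrier_def)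
  qed
  have W: "finite W" "W \<subseteq> verts E"
    using f ok gsrc(1) grng(1) by (auto simp: W_def free_carrier_def)
  let ?s = "\<Sum>v\<in>W. V v"
  have unit: "?s * wval w = wval w" "wval w * ?s = wval w" if w: "f w \<noteq> 0" for w
  proof -
    have in_W: "gsrc (hd w) \<in> W" "grng (last w) \<in> W" using w by (auto simp: W_def)
    have "wval w = gval (hd w) * wval (tl w)" using ok(1)[OF w] by (cases w) (auto simp: wval_def)
    then have *: "V (gsrc (hd w)) * wval w = wval w"
      using gsrc(2)[OF ok(2)[OF w]] by (simp add: mult.assoc[symmetric])
    have "?s * wval w = ?s * V (gsrc (hd w)) * wval w" by (simp only: mult.assoc *)
    then show "?s * wval w = wval w" by (simp only: sum_V_V(1)[OF W in_W(1)] *)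
    have "wval w = wval (butlast w) * gval (last w)"
      using ok(1)[OF w] by (cases w rule: rev_cases) (auto simp: wval_def)
    then have **: "wval w * V (grng (last w)) = wval w"
      using grng(2)[OF ok(3)[OF w]] by (simp add: mult.assoc)
    have "wval w * ?s = wval w * (V (grng (last w)) * ?s)" by (simp only: mult.assoc[symmetric] **)
    then show "wval w * ?s = wval w" by (simp only: sum_V_V(2)[OF W in_W(2)] **)
  qed
  have l: "?s * (sc (f w) * wval w) = sc (f w) * wval w" if "f w \<noteq> 0" for w
    using arg_cong[OF unit(1)[OF that], of "(*) (sc (f w))"]
    by (simp only: mult.assoc[symmetric] sum_V_comm[OF W(2)])
  have r: "(sc (f w) * wval w) * ?s = sc (f w) * wval w" if "f w \<noteq> 0" for w
    using unit(2)[OF that] by (simp add: mult.assoc)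
  have "?s * ev f = (\<Sum>w\<in>{w. f w \<noteq> 0}. ?s * (sc (f w) * wval w))"
    unfolding ev_def by (rule sum_distrib_left)
  also have "\<dots> = ev f" unfolding ev_def by (rule sum.cong[OF refl]) (rule l, simp)
  finally have L: "?s * ev f = ev f" .
  have "ev f * ?s = (\<Sum>w\<in>{w. f w \<noteq> 0}. (sc (f w) * wval w) * ?s)"
    unfolding ev_def by (rule sum_distrib_right)
  also have "\<dots> = ev f" unfolding ev_def by (rule sum.cong[OF refl]) (rule r, simp)
  finally show ?thesis using that W L by blast
qed

lemma ev_zero_if_V_zero:
  assumes f: "f \<in> free_carrier E" and 0: "\<And>v. v \<in> verts E \<Longrightarrow> V v * ev f = 0"
  shows "ev f = 0"
proof -
  obtain W where W: "finite W" "W \<subseteq> verts E" "(\<Sum>v\<in>W. V v) * ev f = ev f"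
      "ev f * (\<Sum>v\<in>W. V v) = ev f"
    by (rule local_unit[OF f])
  have "(\<Sum>v\<in>W. V v) * ev f = 0"
    unfolding sum_distrib_right using W 0 by (intro sum.neutral) auto
  then show ?thesis using W by simp
qed

end

locale porcupine_module =
  porcupine E H S G T + R: leavitt_family "pq_graph E H S G T" sc V A B
  for E :: "('v,'e) graph" and H S G T and sc :: "'k::field \<Rightarrow> 'r::{ring,monoid_mult}" and V A B
begin

definition msc :: "'k \<Rightarrow> (('v,'e) pq_vert \<Rightarrow> 'r) endo" where
  "msc c = Endo (\<lambda>m u. sc c * m u)"

definition mV :: "'v \<Rightarrow> (('v,'e) pq_vert \<Rightarrow> 'r) endo" where
  "mV v = Endo (\<lambda>m u. if u \<in> verts P \<and> base_vert E u = v then V u * m u else 0)"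

text \<open>Only lifts with a prescribed end are unique, so \<open>mB\<close> evaluates one lift
  while \<open>mA\<close> sums over all lifts starting at \<open>t\<close>. The functions are
  unrestricted; \<open>mV\<close> cuts the value at \<open>u\<close> down by
  \<open>V u\<close>.\<close>

definition mA :: "'e \<Rightarrow> (('v,'e) pq_vert \<Rightarrow> 'r) endo" where
  "mA e = Endo (\<lambda>m t. \<Sum>x\<in>{x \<in> emits P t. base_edge x = e}. A x * m (rng P x))"

definition mB :: "'e \<Rightarrow> (('v,'e) pq_vert \<Rightarrow> 'r) endo" where
  "mB e = Endo (\<lambda>m u. if u \<in> verts P \<and> base_vert E u = rng E e
     then B (lift e u) * m (src P (lift e u)) else 0)"

lemma app_msc: "app (msc c) m u = sc c * m u"
  unfolding msc_def by (subst app_Endo) (auto simp: fun_eq_iff algebra_simps)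

lemma app_mV: "app (mV v) m u = (if u \<in> verts P \<and> base_vert E u = v then V u * m u else 0)"
  unfolding mV_def by (subst app_Endo) (auto simp: fun_eq_iff algebra_simps)

lemma app_mA: "app (mA e) m t = (\<Sum>x\<in>{x \<in> emits P t. base_edge x = e}. A x * m (rng P x))"
  unfolding mA_def by (subst app_Endo) (auto simp: fun_eq_iff algebra_simps sum.distrib)

lemma app_mB: "app (mB e) m u = (if u \<in> verts P \<and> base_vert E u = rng E e
     then B (lift e u) * m (src P (lift e u)) else 0)"
  unfolding mB_def by (subst app_Endo) (auto simp: fun_eq_iff algebra_simps)

lemma mod_eqI: "(\<And>m t. app f m t = app g m t) \<Longrightarrow> f = (g :: (('v,'e) pq_vert \<Rightarrow> 'r) endo)"
  by (rule endo_eqI) (rule ext)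

lemma lifts_edges:
  assumes "x \<in> {x \<in> emits P t. base_edge x = e}"
  shows "x \<in> edges P" "src P x = t" "base_edge x = e" "t \<in> verts P" "rng P x \<in> verts P" "e \<in> edges E"
    "base_vert E t = src E e" "base_vert E (rng P x) = rng E e" "lift e (rng P x) = x"
  using assms edge_props[of x] lift_unique[of x] by (auto simp: emits_def)

lemma app_mA_mB: "app (mA e) (app (mB e) m) t = (\<Sum>x\<in>{x \<in> emits P t. base_edge x = e}. A x * (B x * m t))"
  unfolding app_mA
proof (rule sum.cong)
  fix x assume x: "x \<in> {x \<in> emits P t. base_edge x = e}"
  note l = lifts_edges[OF x]
  show "A x * app (mB e) m (rng P x) = A x * (B x * m t)"
    unfolding app_mB using l by simp
qed simp

lemma finite_lifts': "finite {x \<in> emits P t. base_edge x = e}"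
proof (cases "t \<in> verts P")
  case False
  then have "{x \<in> emits P t. base_edge x = e} = {}" using edge_props by (auto simp: emits_def)
  then show ?thesis by (simp only: finite.emptyI)
qed (rule finite_lifts)

lemma app_sum_mA_mB:
  assumes D: "finite D"
  shows "app (\<Sum>e\<in>D. mA e * mB e) m t = (\<Sum>x\<in>{x \<in> emits P t. base_edge x \<in> D}. A x * (B x * m t))"
    "finite {x \<in> emits P t. base_edge x \<in> D}"
proof -
  let ?X = "{x \<in> emits P t. base_edge x \<in> D}"
  have "?X = (\<Union>e\<in>D. {x \<in> emits P t. base_edge x = e})" by auto
  then show X: "finite ?X" using D finite_lifts' by simp
  have "app (\<Sum>e\<in>D. mA e * mB e) m t =
      (\<Sum>e\<in>D. \<Sum>x\<in>{x \<in> emits P t. base_edge x = e}. A x * (B x * m t))"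
    by (simp add: app_sum sum_fun_apply app_mA_mB)
  also have "\<dots> = (\<Sum>e\<in>D. \<Sum>x\<in>{x \<in> ?X. base_edge x = e}. A x * (B x * m t))"
    by (intro sum.cong) auto
  also have "\<dots> = (\<Sum>x\<in>?X. A x * (B x * m t))"
    by (rule sum.group) (use X D in auto)
  finally show "app (\<Sum>e\<in>D. mA e * mB e) m t = (\<Sum>x\<in>?X. A x * (B x * m t))" .
qed

lemma CK_app:
  assumes "t \<in> verts P" "finite (emits P t)" "emits P t \<noteq> {}"
  shows "(\<Sum>x\<in>emits P t. A x * (B x * y)) = V t * y"
  using R.CK[OF assms] by (simp add: sum_distrib_right mult.assoc)

text \<open>The Cuntz-Krieger relation of \<open>P\<close> is available at a vertex only if it is
  not a sink.\<close>

lemma emits_ne: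
  assumes t: "t \<in> verts P" and D: "{e \<in> emits E (base_vert E t). rng E e \<in> verts E - H} \<noteq> {}"
    and not_prime: "\<And>v. t \<noteq> PrimeV v" and T: "\<And>v. t = OldV v \<Longrightarrow> v \<in> G"
  shows "emits P t \<noteq> {}"
proof (cases t)
  case (OldV v)
  with D obtain e where "e \<in> emits E v" "rng E e \<in> verts E - H" by auto
  then have "OldE e \<in> emits P t" using OldV t T[OF OldV] G_edge by (auto simp: emits_def)
  then show ?thesis by auto
next
  case (WV p)
  then have "FE p \<in> emits P t" using t by (auto simp: emits_def)
  then show ?thesis by auto
qed (use not_prime in auto)

text \<open>No edge of \<open>P\<close> ends over \<open>H\<close>, so all edges at a vertex over
  \<open>v\<close> lie over \<open>D\<close>. That vertex is then regular in \<open>P\<close>, and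
  its Cuntz-Krieger relation is the claim there. It serves both for the relation at regular vertices
  of \<open>E\<close> and for \<open>v^H = 0\<close> with \<open>v\<close> in
  \<open>S\<close>.\<close>

lemma mV_eq_sum:
  assumes v: "v \<in> verts E" and D: "finite D" "D \<subseteq> emits E v" "{e \<in> emits E v. rng E e \<notin> H} \<subseteq> D"
    and ne: "\<And>t. t \<in> verts P \<Longrightarrow> base_vert E t = v \<Longrightarrow> emits P t \<noteq> {}"
  shows "mV v = (\<Sum>e\<in>D. mA e * mB e)"
proof (rule mod_eqI)
  fix m t
  note * = app_sum_mA_mB[where t = t, OF D(1)]
  show "app (mV v) m t = app (\<Sum>e\<in>D. mA e * mB e) m t"
  proof (cases "t \<in> verts P \<and> base_vert E t = v")
    case True
    have "base_edge x \<in> D" if "x \<in> emits P t" for x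
      using edge_props[of x] base_vert_verts[of "rng P x"] D(3) that True by (auto simp: emits_def)
    then have "{x \<in> emits P t. base_edge x \<in> D} = emits P t" by auto
    then show ?thesis using True * CK_app[of t] ne[of t] by (simp add: app_mV)
  next
    case False
    have "{x \<in> emits P t. base_edge x \<in> D} = {}"
    proof (rule ccontr)
      assume "{x \<in> emits P t. base_edge x \<in> D} \<noteq> {}"
      then obtain x where "x \<in> emits P t" "base_edge x \<in> D" by auto
      then show False using False edge_props[of x] D(2) by (auto simp: emits_def)
    qed
    then have "app (\<Sum>e\<in>D. mA e * mB e) m t = 0" unfolding *(1) by (simp only: sum.empty)
    then show ?thesis using False by (simp only: app_mV if_False)
  qed
qed

lemma family_m: "leavitt_family E msc mV mA mB"
proof
  show "wf_graph E" by (rule wf)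
  show "scalars msc"
    unfolding scalars_def
    by (intro conjI allI mod_eqI) (simp_all add: app_msc scalars_simps[OF R.scalars] distrib_right mult.assoc)
next
  fix v c assume "v \<in> verts E"
  show "mV v * msc c = msc c * mV v"
  proof (rule mod_eqI)
    show "app (mV v * msc c) m t = app (msc c * mV v) m t" for m t
      using R.comm(1)[of t c] by (simp add: app_mV app_msc mult.assoc[symmetric])
  qed
next
  fix e c assume "e \<in> edges E"
  show "mA e * msc c = msc c * mA e"
  proof (rule mod_eqI)
    show "app (mA e * msc c) m t = app (msc c * mA e) m t" for m t
      unfolding app_ops app_mA app_msc sum_distrib_left
    proof (rule sum.cong)
      fix x assume x: "x \<in> {x \<in> emits P t. base_edge x = e}"
      show "A x * (sc c * m (rng P x)) = sc c * (A x * m (rng P x))"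
        using R.comm(2)[OF lifts_edges(1)[OF x], of c] by (simp add: mult.assoc[symmetric])
    qed simp
  qed
next
  fix e c assume e: "e \<in> edges E"
  show "mB e * msc c = msc c * mB e"
  proof (rule mod_eqI)
    show "app (mB e * msc c) m t = app (msc c * mB e) m t" for m t
      using R.comm(3)[OF lift_props(1)[OF e], of t c] by (simp add: app_mB app_msc mult.assoc[symmetric])
  qed
next
  fix v u assume "v \<in> verts E" "u \<in> verts E"
  show "mV v * mV u = (if v = u then mV v else 0)"
    by (rule mod_eqI) (auto simp: app_mV mult.assoc[symmetric] R.VV)
next
  fix e assume e: "e \<in> edges E"
  show "mV (src E e) * mA e = mA e"
  proof (rule mod_eqI)
    fix m t
    have "app (mV (src E e)) (app (mA e) m) t = app (mA e) m t"
    proof (cases "{x \<in> emits P t. base_edge x = e} = {}")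
      case True
      then show ?thesis unfolding app_mV app_mA by (simp only: sum.empty mult_zero_right if_cancel)
    next
      case False
      then obtain x where x: "x \<in> {x \<in> emits P t. base_edge x = e}" by blast
      have "app (mV (src E e)) (app (mA e) m) t = V t * (\<Sum>x\<in>{x \<in> emits P t. base_edge x = e}. A x * m (rng P x))"
        unfolding app_mV app_mA using lifts_edges[OF x] by (simp only: simp_thms if_True)
      also have "\<dots> = (\<Sum>x\<in>{x \<in> emits P t. base_edge x = e}. A x * m (rng P x))"
        unfolding sum_distrib_left
      proof (rule sum.cong)
        fix x assume x: "x \<in> {x \<in> emits P t. base_edge x = e}"
        show "V t * (A x * m (rng P x)) = A x * m (rng P x)"
          using R.VA[of x] lifts_edges[OF x] by (simp add: mult.assoc[symmetric])
      qed simp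
      finally show ?thesis unfolding app_mA .
    qed
    then show "app (mV (src E e) * mA e) m t = app (mA e) m t" by simp
  qed
  show "mA e * mV (rng E e) = mA e"
  proof (rule mod_eqI)
    show "app (mA e * mV (rng E e)) m t = app (mA e) m t" for m t
      unfolding app_ops app_mA
    proof (rule sum.cong)
      fix x assume x: "x \<in> {x \<in> emits P t. base_edge x = e}"
      show "A x * app (mV (rng E e)) m (rng P x) = A x * m (rng P x)"
        using R.AV[of x] lifts_edges[OF x] by (simp add: app_mV mult.assoc[symmetric])
    qed simp
  qed
  show "mV (rng E e) * mB e = mB e"
  proof (rule mod_eqI)
    show "app (mV (rng E e) * mB e) m t = app (mB e) m t" for m t
      using R.VB[of "lift e t"] lift_props[OF e, of t] by (auto simp: app_mV app_mB mult.assoc[symmetric])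
  qed
  show "mB e * mV (src E e) = mB e"
  proof (rule mod_eqI)
    show "app (mB e * mV (src E e)) m t = app (mB e) m t" for m t
      using R.BV[of "lift e t"] lift_props[OF e, of t] edge_props[of "lift e t"]
      by (auto simp: app_mV app_mB mult.assoc[symmetric])
  qed
next
  fix e f assume e: "e \<in> edges E" and f: "f \<in> edges E"
  show "mB e * mA f = (if e = f then mV (rng E e) else 0)"
  proof (rule mod_eqI)
    fix m t
    show "app (mB e * mA f) m t = app (if e = f then mV (rng E e) else 0) m t"
    proof (cases "t \<in> verts P \<and> base_vert E t = rng E e")
      case True
      then have t: "t \<in> verts P" "base_vert E t = rng E e" by auto
      let ?x = "lift e t"
      note l = lift_props[OF e t]
      let ?Y = "{y \<in> emits P (src P ?x). base_edge y = f}"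
      have "app (mB e * mA f) m t = (\<Sum>y\<in>?Y. B ?x * (A y * m (rng P y)))"
        using t by (simp add: app_mB app_mA sum_distrib_left)
      also have "\<dots> = (\<Sum>y\<in>?Y. if y = ?x then V t * m t else 0)"
      proof (rule sum.cong)
        fix y assume y: "y \<in> ?Y"
        show "B ?x * (A y * m (rng P y)) = (if y = ?x then V t * m t else 0)"
          using R.BA[OF l(1) lifts_edges(1)[OF y]] l by (auto simp: mult.assoc[symmetric])
      qed simp
      \<comment> \<open>\<open>?x\<close> lies over \<open>e\<close>, so it occurs among the lifts
        of \<open>f\<close> exactly when \<open>e = f\<close>.\<close>
      also have "\<dots> = (if e = f then V t * m t else 0)"
        using finite_lifts'[of "src P ?x" f] l by (auto simp: emits_def)
      finally show ?thesis using t by (simp add: app_mV)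
    qed (auto simp: app_mB app_mV)
  qed
next
  fix v assume v: "v \<in> verts E" "finite (emits E v)" "emits E v \<noteq> {}"
  show "mV v = (\<Sum>e\<in>emits E v. mA e * mB e)"
  proof (rule mV_eq_sum)
    fix t assume t: "t \<in> verts P" "base_vert E t = v"
    \<comment> \<open>By saturation a regular vertex outside \<open>H\<close> has an edge not ending
      in \<open>H\<close>; as a finite emitter it is neither primed nor in \<open>T\<close>.\<close>
    then have "v \<notin> H" using base_vert_verts by auto
    then have "\<not> rng E ` emits E v \<subseteq> H"
      using HS v by (auto simp: admissible_def saturated_def)
    then have "{e \<in> emits E (base_vert E t). rng E e \<in> verts E - H} \<noteq> {}"
      using t wfE by (auto simp: emits_def)
    then show "emits P t \<noteq> {}"
    proof (rule emits_ne[OF t(1)])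
      show "t \<noteq> PrimeV w" for w using t v(2) primed_iff[of w] by auto
      show "w \<in> G" if "t = OldV w" for w using t v(2) TD(4)[of w] that by (auto simp: old_def)
    qed
  qed (use v in auto)
qed

text \<open>No vertex of \<open>P\<close> lies over \<open>H\<close>. A vertex of \<open>S\<close>
  is not primed, and it is old only if it is in \<open>G\<close>, so nothing over it is a sink and
  \<open>mV_eq_sum\<close> applies.\<close>

lemma porcupine_family_m: "porcupine_family E H S G T msc mV mA mB"
proof -
  interpret M: leavitt_family E msc mV mA mB by (rule family_m)
  show ?thesis
  proof
    fix v assume "v \<in> H"
    then show "mV v = 0" using base_vert_verts by (intro mod_eqI) (auto simp: app_mV)
  next
    fix v assume v: "v \<in> S"
    have "mV v = (\<Sum>e\<in>{e \<in> emits E v. rng E e \<in> verts E - H}. mA e * mB e)"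
    proof (rule mV_eq_sum)
      fix t assume t: "t \<in> verts P" "base_vert E t = v"
      then have "{e \<in> emits E (base_vert E t). rng E e \<in> verts E - H} \<noteq> {}"
        using SD(5)[OF v] by simp
      then show "emits P t \<noteq> {}"
      proof (rule emits_ne[OF t(1)])
        show "t \<noteq> PrimeV w" for w using t v primedD(2)[of w] by auto
        show "w \<in> G" if "t = OldV w" for w using t v that by (auto simp: old_def)
      qed
    qed (use SD[OF v] wfE in \<open>auto simp: emits_def\<close>)
    then show "M.gap H v = 0" by (simp add: M.gap_def M.sAB_def)
  qed
qed

section \<open>Action of the induced family of \<open>P\<close> on the module\<close>

sublocale M: porcupine_family E H S G T msc mV mA mB
  by (rule porcupine_family_m)

sublocale MP: leavitt_family P msc M.Q M.PA M.PB
  by (rule M.family_P)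

text \<open>At \<open>t\<close> the subtracted sum runs over the edges of \<open>P\<close> lying
  over edges that leave \<open>X\<close>. If there are none, \<open>V t\<close> remains; if these
  are all edges at \<open>t\<close>, the relation at \<open>t\<close> cancels it.\<close>

lemma app_gap:
  assumes fin: "finite {e \<in> emits E v. rng E e \<in> verts E - X}"
  shows "\<not> (t \<in> verts P \<and> base_vert E t = v) \<Longrightarrow> app (M.gap X v) m t = 0"
    and "t \<in> verts P \<Longrightarrow> base_vert E t = v \<Longrightarrow> (\<And>x. x \<in> emits P t \<Longrightarrow> rng E (base_edge x) \<in> X) \<Longrightarrow>
      app (M.gap X v) m t = V t * m t"
    and "t \<in> verts P \<Longrightarrow> base_vert E t = v \<Longrightarrow> (\<And>x. x \<in> emits P t \<Longrightarrow> rng E (base_edge x) \<notin> X) \<Longrightarrow>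
      emits P t \<noteq> {} \<Longrightarrow> app (M.gap X v) m t = 0"
proof -
  let ?D = "{e \<in> emits E v. rng E e \<in> verts E - X}"
  let ?Y = "{x \<in> emits P t. base_edge x \<in> ?D}"
  note * = app_sum_mA_mB[where t = t, OF fin]
  have gap: "app (M.gap X v) m t = app (mV v) m t - (\<Sum>x\<in>?Y. A x * (B x * m t))"
    unfolding M.gap_def M.sAB_def by (simp only: app_ops fun_diff_def *(1))
  show "app (M.gap X v) m t = 0" if "\<not> (t \<in> verts P \<and> base_vert E t = v)"
  proof -
    have "x \<notin> ?Y" for x using that edge_props[of x] by (auto simp: emits_def)
    then have "?Y = {}" by blast
    then show ?thesis using that gap by (simp only: sum.empty app_mV if_False diff_self)
  qed
  assume t: "t \<in> verts P" "base_vert E t = v"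
  show "app (M.gap X v) m t = V t * m t" if "\<And>x. x \<in> emits P t \<Longrightarrow> rng E (base_edge x) \<in> X"
  proof -
    have "?Y = {}" using that by blast
    then show ?thesis using gap t by (simp only: sum.empty app_mV simp_thms if_True diff_zero)
  qed
  show "app (M.gap X v) m t = 0"
    if nX: "\<And>x. x \<in> emits P t \<Longrightarrow> rng E (base_edge x) \<notin> X" and ne: "emits P t \<noteq> {}"
  proof -
    have "base_edge x \<in> ?D" if x: "x \<in> emits P t" for x
    proof -
      have "x \<in> edges P" "src P x = t" using x by (auto simp: emits_def)
      then show ?thesis using edge_props[of x] t(2) wfE(2) nX[OF x] by (auto simp: emits_def)
    qed
    then have "?Y = emits P t" by blast
    then show ?thesis using gap t *(2) CK_app[OF t(1) _ ne, of "m t"]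
      by (simp only: app_mV simp_thms if_True diff_self)
  qed
qed

lemma WV_emits:
  assumes "WV p \<in> verts P"
  shows "emits P (WV p) \<noteq> {}" "finite (emits P (WV p))" "x \<in> emits P (WV p) \<Longrightarrow> base_edge x = hd p"
proof -
  have p: "p \<in> porc" using assms by simp
  then have "emits P (WV p) \<noteq> {} \<and> finite (emits P (WV p)) \<and> (\<forall>x\<in>emits P (WV p). base_edge x = hd p)"
    by (cases rule: M.porc_cases) (auto simp: emits_WV_single emits_WV_Cons)
  then show "emits P (WV p) \<noteq> {}" "finite (emits P (WV p))" "x \<in> emits P (WV p) \<Longrightarrow> base_edge x = hd p"
    by auto
qed

text \<open>Edges of \<open>P\<close> never end over \<open>H\<close>, so at each emitting vertex
  over \<open>v\<close> the relation of \<open>P\<close> cancels everything and only the sink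
  \<open>v'\<close> survives.\<close>

lemma app_gapH:
  assumes v: "v \<in> primed"
  shows "app (M.gap H v) m t = (if t = PrimeV v then V t * m t else 0)"
proof (cases "t \<in> verts P \<and> base_vert E t = v")
  case True
  then have t: "t \<in> verts P" "base_vert E t = v" by auto
  note gap = app_gap[OF primedD(5)[OF v], of t m]
  have nH: "rng E (base_edge x) \<notin> H" if "x \<in> emits P t" for x
    using that edge_props[of x] base_vert_verts[of "rng P x"] by (auto simp: emits_def)
  show ?thesis
  proof (cases t)
    case (PrimeV w)
    then show ?thesis using gap(2)[OF t] t by (simp add: emits_PrimeV)
  next
    case (WV p)
    then show ?thesis using gap(3)[OF t nH] t WV_emits(1) by simp
  next
    case (OldV w)
    obtain e where "e \<in> emits E v" "rng E e \<in> G - H" using primedD(4)[OF v] by auto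
    then have "OldE e \<in> emits P t" using OldV t by (auto simp: emits_def)
    then show ?thesis using gap(3)[OF t nH] OldV by auto
  qed
next
  case False
  then show ?thesis using app_gap(1)[OF primedD(5)[OF v] False, of m] v by auto
qed

lemma app_loc:
  assumes v: "v \<in> old"
  shows "app (M.loc v) m t = (if t = OldV v \<or> t = PrimeV v \<and> v \<in> primed then V t * m t else 0)"
proof (cases "v \<in> G")
  case True
  have "base_vert E t \<noteq> v" if "t \<in> verts P" "t = WV p" for p
    using that porc_src[of p] True by auto
  then show ?thesis using v True by (cases t) (auto simp: M.loc_def app_mV)
next
  case False
  note gap = app_gap[OF M.old_fin[OF v False], of t m]
  show ?thesis
  proof (cases "t \<in> verts P \<and> base_vert E t = v")
    case True
    then have t: "t \<in> verts P" "base_vert E t = v" by auto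
    show ?thesis
    proof (cases t)
      case (PrimeV w)
      then show ?thesis using gap(2)[OF t] t False by (simp add: emits_PrimeV M.loc_def)
    next
      case (WV p)
      have "rng E (hd p) \<notin> G" using porc_rng[of p] t WV v by auto
      then show ?thesis using gap(3)[OF t] t WV WV_emits[of p] False by (simp add: M.loc_def)
    next
      case (OldV w)
      then have "rng E (base_edge x) \<in> G" if "x \<in> emits P t" for x
        using that t by (auto simp: emits_OldV)
      then show ?thesis using gap(2)[OF t] t OldV False by (simp add: M.loc_def)
    qed
  next
    case F: False
    then show ?thesis using gap(1)[OF F] v False by (auto simp: M.loc_def)
  qed
qed

text \<open>The action of the range idempotent enters as a hypothesis, because for
  \<open>w^p\<close> it becomes known only by induction along \<open>p\<close>.\<close>

lemma app_PA_PB: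
  assumes x: "x \<in> edges P"
    and Q: "\<And>m t. app (M.Q (rng P x)) m t = (if t = rng P x then V t * m t else 0)"
  shows "app (M.PA x) m t = (if t = src P x then A x * m (rng P x) else 0)"
    "app (M.PB x) m t = (if t = rng P x then B x * m (src P x) else 0)"
proof -
  note e = edge_props[OF x]
  let ?Y = "{y \<in> emits P t. base_edge y = base_edge x}"
  have "app (M.PA x) m t = (\<Sum>y\<in>?Y. A y * app (M.Q (rng P x)) m (rng P y))"
    by (simp add: M.PA_def app_mA)
  also have "\<dots> = (\<Sum>y\<in>?Y. if y = x then A x * m (rng P x) else 0)"
  proof (rule sum.cong)
    fix y assume y: "y \<in> ?Y"
    then have "rng P y = rng P x \<longleftrightarrow> y = x" using edge_eqI[OF lifts_edges(1)[OF y] x] by auto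
    then show "A y * app (M.Q (rng P x)) m (rng P y) = (if y = x then A x * m (rng P x) else 0)"
      using R.AV[OF x] by (auto simp: Q mult.assoc[symmetric])
  qed simp
  also have "\<dots> = (if t = src P x then A x * m (rng P x) else 0)"
    using finite_lifts'[of t "base_edge x"] x by (auto simp: emits_def)
  finally show "app (M.PA x) m t = (if t = src P x then A x * m (rng P x) else 0)" .
  show "app (M.PB x) m t = (if t = rng P x then B x * m (src P x) else 0)"
    using e R.VB[OF x] lift_unique[OF x] by (simp add: M.PB_def Q app_mB mult.assoc[symmetric])
qed

text \<open>The Cuntz-Krieger relation of the induced family writes \<open>Q(w^p)\<close> through
  edges whose range idempotents are already understood; the relation of the given family then
  reassembles the result.\<close>

lemma app_Q_WV:
  assumes u: "WV p \<in> verts P"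
    and Q: "\<And>x m t. x \<in> emits P (WV p) \<Longrightarrow> app (M.Q (rng P x)) m t = (if t = rng P x then V t * m t else 0)"
  shows "app (M.Q (WV p)) m t = (if t = WV p then V t * m t else 0)"
proof -
  note w = WV_emits[OF u]
  have x: "app (M.PA x) (app (M.PB x) m) t = (if t = WV p then A x * (B x * m (WV p)) else 0)"
    if "x \<in> emits P (WV p)" for x
  proof -
    have "x \<in> edges P" "src P x = WV p" using that by (auto simp: emits_def)
    then show ?thesis using app_PA_PB[OF _ Q[OF that]] by simp
  qed
  have "app (M.Q (WV p)) m t = (\<Sum>x\<in>emits P (WV p). app (M.PA x) (app (M.PB x) m) t)"
    by (simp add: M.PA_PB_sum[OF u w(2,1)] app_sum sum_fun_apply del: M.Q_simps)
  also have "\<dots> = (\<Sum>x\<in>emits P (WV p). if t = WV p then A x * (B x * m (WV p)) else 0)"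
    by (rule sum.cong) (simp_all add: x)
  also have "\<dots> = (if t = WV p then V t * m t else 0)"
    using CK_app[OF u w(2,1)] by simp
  finally show ?thesis .
qed

lemma app_Qo: "v \<in> old \<Longrightarrow> app (M.Qo v) m t = (if t = OldV v then V t * m t else 0)"
  by (auto simp: M.Qo_def app_loc app_gapH)

lemma app_Q:
  assumes u: "u \<in> verts P"
  shows "app (M.Q u) m t = (if t = u then V t * m t else 0)"
proof (cases u)
  case (OldV v)
  then show ?thesis using u by (simp add: app_Qo)
next
  case (PrimeV v)
  then show ?thesis using u by (simp add: app_gapH)
next
  case (WV p)
  have "p \<in> porc \<Longrightarrow> app (M.Q (WV p)) m t = (if t = WV p then V t * m t else 0)" for m t
  proof (induction p arbitrary: m t rule: porc_induct)
    case (single e)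
    then show ?case
      using M.porc_rng_old[OF single]
      by (intro app_Q_WV) (auto simp: emits_WV_single app_Qo app_gapH split: if_splits)
  next
    case (Cons e f q)
    then show ?case
      by (intro app_Q_WV) (auto simp: emits_WV_Cons simp del: M.Q_simps)
  qed
  then show ?thesis using u WV by simp
qed

text \<open>The element \<open>r\<close> spread over its components \<open>V t * r\<close>. On such
  vectors the induced family acts as left multiplication; applying an operator to
  \<open>mvec 1\<close> recovers all components of the corresponding element.\<close>

definition mvec :: "'r \<Rightarrow> ('v,'e) pq_vert \<Rightarrow> 'r" where
  "mvec r t = (if t \<in> verts P then V t * r else 0)"

lemma app_gval:
  assumes "gen_ok P g"
  shows "app (MP.gval g) (mvec r) = mvec (R.gval g * r)"
proof
  fix t
  show "app (MP.gval g) (mvec r) t = mvec (R.gval g * r) t"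
  proof (cases g)
    case (GV u)
    then show ?thesis using assms
      by (auto simp: MP.gval_def R.gval_def gen_ok_def app_Q mvec_def mult.assoc[symmetric] R.VV)
  next
    case (GE x)
    then have x: "x \<in> edges P" using assms by (simp add: gen_ok_def)
    have "V t * (A x * r) = (if src P x = t then A x * r else 0)" if "t \<in> verts P"
      using R.V_A[OF that x] by (simp add: mult.assoc[symmetric])
    moreover have "A x * (V (rng P x) * r) = A x * r"
      using R.AV[OF x] by (simp add: mult.assoc[symmetric])
    ultimately show ?thesis using GE edge_props[OF x] app_PA_PB(1)[OF x app_Q]
      by (auto simp: MP.gval_def R.gval_def mvec_def)
  next
    case (GS x)
    then have x: "x \<in> edges P" using assms by (simp add: gen_ok_def)
    have "V t * (B x * r) = (if rng P x = t then B x * r else 0)" if "t \<in> verts P"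
      using R.V_B[OF that x] by (simp add: mult.assoc[symmetric])
    moreover have "B x * (V (src P x) * r) = B x * r"
      using R.BV[OF x] by (simp add: mult.assoc[symmetric])
    ultimately show ?thesis using GS edge_props[OF x] app_PA_PB(2)[OF x app_Q]
      by (auto simp: MP.gval_def R.gval_def mvec_def)
  qed
qed

lemma app_wval: "\<forall>g\<in>set w. gen_ok P g \<Longrightarrow> app (MP.wval w) (mvec r) = mvec (R.wval w * r)"
  by (induction w) (auto simp: MP.wval_def R.wval_def app_gval mult.assoc)

lemma app_ev:
  assumes "f \<in> free_carrier P"
  shows "app (MP.ev f) (mvec 1) t = mvec (R.ev f) t"
proof -
  have *: "app (MP.wval w) (mvec 1) = mvec (R.wval w)" if "f w \<noteq> 0" for w
    using app_wval[of w 1] assms that by (auto simp: free_carrier_def)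
  have "app (MP.ev f) (mvec 1) t = (\<Sum>w\<in>{w. f w \<noteq> 0}. sc (f w) * mvec (R.wval w) t)"
    by (simp add: MP.ev_def app_sum sum_fun_apply app_msc *)
  also have "\<dots> = mvec (R.ev f) t"
    using R.comm(1)[of t]
    by (auto simp: mvec_def R.ev_def sum_distrib_left mult.assoc[symmetric] intro!: sum.cong)
  finally show ?thesis .
qed

lemma ev_zero:
  assumes f: "f \<in> free_carrier P" and 0: "MP.ev f = 0"
  shows "R.ev f = 0"
proof (rule R.ev_zero_if_V_zero[OF f])
  fix u assume "u \<in> verts P"
  then show "V u * R.ev f = 0" using app_ev[OF f, of u] 0 by (simp add: mvec_def)
qed

end

subsection \<open>The grading\<close>

definition homog :: "int \<Rightarrow> (('v,'e) gen list \<Rightarrow> 'k::field) \<Rightarrow> bool" where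
  "homog d f \<longleftrightarrow> (\<forall>w. f w \<noteq> 0 \<longrightarrow> wdeg w = d)"

definition hcomp :: "int \<Rightarrow> (('v,'e) gen list \<Rightarrow> 'k::field) \<Rightarrow> ('v,'e) gen list \<Rightarrow> 'k" where
  "hcomp d f = (\<lambda>w. if wdeg w = d then f w else 0)"

lemma wdeg_append: "wdeg (u @ w) = wdeg u + wdeg w"
  by (simp add: wdeg_def)

lemma homog_ops:
  "homog d 0" "homog d (\<lambda>w. 0)" "homog d f \<Longrightarrow> homog d g \<Longrightarrow> homog d (f + g)"
  "homog d f \<Longrightarrow> homog d g \<Longrightarrow> homog d (fsub f g)" "homog d f \<Longrightarrow> homog d (\<lambda>w. c * f w)"
  "(\<And>i. i \<in> I \<Longrightarrow> homog d (F i)) \<Longrightarrow> homog d (\<lambda>w. \<Sum>i\<in>I. F i w)"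
proof -
  show "homog d f \<Longrightarrow> homog d g \<Longrightarrow> homog d (f + g)"
    unfolding homog_def plus_fun_apply by (metis add_0)
  show "homog d f \<Longrightarrow> homog d g \<Longrightarrow> homog d (fsub f g)"
    unfolding homog_def fsub_def by (metis diff_0_right)
  show "(\<And>i. i \<in> I \<Longrightarrow> homog d (F i)) \<Longrightarrow> homog d (\<lambda>w. \<Sum>i\<in>I. F i w)"
    unfolding homog_def by (metis sum.neutral)
qed (auto simp: homog_def)

lemma homog_mult: "homog d f \<Longrightarrow> homog d' g \<Longrightarrow> homog (d + d') (fmul f g)"
  unfolding homog_def by (auto elim!: fmul_nonzeroD simp: wdeg_append)

lemma homog_gens: "homog 0 (gv v)" "homog 1 (ge e)" "homog (- 1) (gs e)" "homog (wdeg w) (wel w)"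
  by (auto simp: homog_def gv_def ge_def gs_def wel_def wdeg_def gdeg_def)

lemma homog_vH: "homog 0 (vH E X v)"
  unfolding vH_def
  by (intro homog_ops homog_gens) (use homog_mult[OF homog_gens(2,3)] in simp)

lemma homog_lpa_rels: "r \<in> lpa_rels E \<Longrightarrow> \<exists>d. homog d r"
proof -
  note m = homog_mult[OF homog_gens(1) homog_gens(1), simplified]
    homog_mult[OF homog_gens(1) homog_gens(2), simplified] homog_mult[OF homog_gens(2) homog_gens(1), simplified]
    homog_mult[OF homog_gens(1) homog_gens(3), simplified] homog_mult[OF homog_gens(3) homog_gens(1), simplified]
    homog_mult[OF homog_gens(3) homog_gens(2), simplified] homog_mult[OF homog_gens(2) homog_gens(3), simplified]
  have "homog 0 (fsub (fmul (gv v) (gv u)) (if v = u then gv v else (\<lambda>w. 0)))"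
    "homog 1 (fsub (fmul (gv (src E e)) (ge e)) (ge e))"
    "homog 1 (fsub (fmul (ge e) (gv (rng E e))) (ge e))"
    "homog (- 1) (fsub (fmul (gv (rng E e)) (gs e)) (gs e))"
    "homog (- 1) (fsub (fmul (gs e) (gv (src E e))) (gs e))"
    "homog 0 (fsub (fmul (gs e) (ge f)) (if e = f then gv (rng E e) else (\<lambda>w. 0)))"
    "homog 0 (fsub (gv v) (\<lambda>w. \<Sum>e\<in>emits E v. fmul (ge e) (gs e) w))" for v u e f
    by (cases "v = u"; cases "e = f"; simp add: homog_ops m homog_gens)+
  then show "r \<in> lpa_rels E \<Longrightarrow> \<exists>d. homog d r"
    unfolding lpa_rels_def by (elim UnE CollectE exE conjE) blast+
qed

lemma hcomp_carrier: "f \<in> free_carrier E \<Longrightarrow> hcomp d f \<in> free_carrier E"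
  unfolding free_carrier_def hcomp_def by (auto intro: rev_finite_subset)

lemma hcomp_homog: "homog d f \<Longrightarrow> hcomp d' f = (if d = d' then f else 0)"
  by (auto simp: homog_def hcomp_def fun_eq_iff)

lemma hcomp_add: "hcomp d (f + g) = hcomp d f + hcomp d g"
  by (auto simp: hcomp_def fun_eq_iff)

lemma hcomp_zero: "hcomp d 0 = 0"
  by (auto simp: hcomp_def fun_eq_iff)

lemma hcomp_scale: "hcomp d (\<lambda>w. c * f w) = (\<lambda>w. c * hcomp d f w)"
  by (auto simp: hcomp_def fun_eq_iff)

text \<open>Only cuts whose left part has degree \<open>m\<close> contribute, which forces the
  degree of the right part.\<close>

lemma hcomp_fmul_left:
  assumes "homog m a"
  shows "hcomp n (fmul a b) = fmul a (hcomp (n - m) b)"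
proof
  fix w
  have *: "wdeg (drop i w) = wdeg w - m" if "a (take i w) \<noteq> 0" for i
  proof -
    have "wdeg (take i w) + wdeg (drop i w) = wdeg w" by (simp flip: wdeg_append)
    moreover have "wdeg (take i w) = m" using assms that by (simp add: homog_def)
    ultimately show ?thesis by simp
  qed
  show "hcomp n (fmul a b) w = fmul a (hcomp (n - m) b) w"
  proof (cases "wdeg w = n")
    case True
    then have "a (take i w) * b (drop i w) = a (take i w) * hcomp (n - m) b (drop i w)" for i
      using *[of i] by (cases "a (take i w) = 0") (simp_all add: hcomp_def)
    then have "fmul a b w = fmul a (hcomp (n - m) b) w" unfolding fmul_def by (simp only:)
    then show ?thesis using True by (simp add: hcomp_def[of n])
  next
    case False
    then have "a (take i w) * hcomp (n - m) b (drop i w) = 0" for i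
      using *[of i] by (cases "a (take i w) = 0") (simp_all add: hcomp_def)
    then have "(\<Sum>i\<le>length w. a (take i w) * hcomp (n - m) b (drop i w)) = 0"
      by (simp only: sum.neutral_const)
    then show ?thesis using False by (simp add: hcomp_def fmul_def)
  qed
qed

lemma hcomp_fmul_right:
  assumes "homog m b"
  shows "hcomp n (fmul a b) = fmul (hcomp (n - m) a) b"
proof
  fix w
  have *: "wdeg (take i w) = wdeg w - m" if "b (drop i w) \<noteq> 0" for i
  proof -
    have "wdeg (take i w) + wdeg (drop i w) = wdeg w" by (simp flip: wdeg_append)
    moreover have "wdeg (drop i w) = m" using assms that by (simp add: homog_def)
    ultimately show ?thesis by simp
  qed
  show "hcomp n (fmul a b) w = fmul (hcomp (n - m) a) b w"
  proof (cases "wdeg w = n")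
    case True
    then have "a (take i w) * b (drop i w) = hcomp (n - m) a (take i w) * b (drop i w)" for i
      using *[of i] by (cases "b (drop i w) = 0") (simp_all add: hcomp_def)
    then have "fmul a b w = fmul (hcomp (n - m) a) b w" unfolding fmul_def by (simp only:)
    then show ?thesis using True by (simp add: hcomp_def[of n])
  next
    case False
    then have "hcomp (n - m) a (take i w) * b (drop i w) = 0" for i
      using *[of i] by (cases "b (drop i w) = 0") (simp_all add: hcomp_def)
    then have "(\<Sum>i\<le>length w. hcomp (n - m) a (take i w) * b (drop i w)) = 0"
      by (simp only: sum.neutral_const)
    then show ?thesis using False by (simp add: hcomp_def fmul_def)
  qed
qed

lemma hcomp_sum:
  assumes "f \<in> free_carrier E"
  shows "f = (\<lambda>w. \<Sum>d\<in>wdeg ` {w. f w \<noteq> 0}. hcomp d f w)"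
proof
  fix w
  have "finite (wdeg ` {w. f w \<noteq> 0})" using assms by (auto simp: free_carrier_def)
  then show "f w = (\<Sum>d\<in>wdeg ` {w. f w \<noteq> 0}. hcomp d f w)"
    by (auto simp: hcomp_def)
qed

definition adm_gens :: "('v,'e) graph \<Rightarrow> 'v set \<Rightarrow> 'v set \<Rightarrow> (('v,'e) gen list \<Rightarrow> 'k::field) set" where
  "adm_gens E H S = {gv v | v. v \<in> H} \<union> {vH E H v | v. v \<in> S}"

text \<open>The preimage of \<open>I(H,S)\<close> in the free algebra, where ideal membership can be
  handled without classes.\<close>

definition adm_free_ideal :: "('v,'e) graph \<Rightarrow> 'v set \<Rightarrow> 'v set \<Rightarrow> (('v,'e) gen list \<Rightarrow> 'k::field) set" where
  "adm_free_ideal E H S = ideal_gen (free_alg E) (lpa_rels E \<union> adm_gens E H S)"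

lemma vH_carrier: "wf_graph E \<Longrightarrow> v \<in> verts E \<Longrightarrow> vH E X v \<in> free_carrier E"
  unfolding vH_def wf_graph_def
  by (intro free_carrier_fsub gen_carrier free_carrier_sum free_carrier_mult) (auto simp: emits_def)

lemma adm_gens_carrier:
  "wf_graph E \<Longrightarrow> H \<subseteq> verts E \<Longrightarrow> S \<subseteq> verts E \<Longrightarrow> adm_gens E H S \<subseteq> free_carrier E"
  unfolding adm_gens_def by (auto intro: gen_carrier vH_carrier)

subsection \<open>The image of the homomorphism\<close>

locale porcupine_hom = porcupine_family E H S G T sc V A B
  for E :: "('v,'e) graph" and H S G T and sc :: "'k::field \<Rightarrow> 'r::{ring,monoid_mult}" and V A B +
  fixes h :: "(('v,'e) gen list \<Rightarrow> 'k) \<Rightarrow> 'r"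
  assumes hom: "alg_hom (free_alg E) sc h"
    and h_gens: "h (gv v) = V v" "h (ge e) = A e" "h (gs e) = B e"
begin

sublocale FP: leavitt_family P sc Q PA PB
  by (rule family_P)

abbreviation J :: "(('v,'e) gen list \<Rightarrow> 'k) set" where
  "J \<equiv> adm_free_ideal E G T"

text \<open>The degree \<open>n\<close> parts, inside one ring, of the images of \<open>L(P)\<close>
  (\<open>Dn\<close>), \<open>L(E)\<close> (\<open>Hn\<close>) and \<open>I(G,T)\<close>
  (\<open>In\<close>); the goal is \<open>Dn n = In n\<close>.\<close>

definition Dn :: "int \<Rightarrow> 'r set" where "Dn n = FP.ev ` {f \<in> free_carrier P. homog n f}"
definition Hn :: "int \<Rightarrow> 'r set" where "Hn n = h ` {a \<in> free_carrier E. homog n a}"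
definition In :: "int \<Rightarrow> 'r set" where "In n = h ` {a \<in> free_carrier E. homog n a \<and> a \<in> J}"

lemma J_closed:
  "0 \<in> J" "a \<in> J \<Longrightarrow> b \<in> J \<Longrightarrow> a + b \<in> J" "a \<in> J \<Longrightarrow> (\<lambda>w. c * a w) \<in> J"
  "a \<in> free_carrier E \<Longrightarrow> b \<in> J \<Longrightarrow> fmul a b \<in> J" "a \<in> free_carrier E \<Longrightarrow> b \<in> J \<Longrightarrow> fmul b a \<in> J"
  using ideal_gen.intros(2-6)[where A = "free_alg E" and X = "lpa_rels E \<union> adm_gens E G T"]
  unfolding adm_free_ideal_def free_alg_simps by blast+

lemma J_carrier: "a \<in> J \<Longrightarrow> a \<in> free_carrier E"
  unfolding adm_free_ideal_def using ideal_gen_carrier[OF hom] by simp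

lemma J_gens: "v \<in> G \<Longrightarrow> gv v \<in> J" "v \<in> T \<Longrightarrow> vH E G v \<in> J"
  unfolding adm_free_ideal_def
  by (rule ideal_gen.base; use G_verts TD(1) wf in \<open>auto simp: adm_gens_def intro: gen_carrier vH_carrier\<close>)+

lemmas h_vH = hom_vH[OF hom h_gens]

lemma In_zero: "0 \<in> In n"
  unfolding In_def
  by (rule image_eqI[where f = h and x = 0, OF hom_zero[OF hom, symmetric]]) (intro CollectI conjI free_carrier_closed(1) homog_ops(1) J_closed(1))

lemma In_add: "x \<in> In n \<Longrightarrow> y \<in> In n \<Longrightarrow> x + y \<in> In n"
proof -
  assume "x \<in> In n" "y \<in> In n"
  then obtain a b where "a \<in> free_carrier E" "homog n a" "a \<in> J" "x = h a"
    "b \<in> free_carrier E" "homog n b" "b \<in> J" "y = h b" by (auto simp: In_def)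
  then show ?thesis unfolding In_def
    by (rule_tac x = "a + b" in image_eqI)
       (simp_all add: hom_add[OF hom] homog_ops free_carrier_closed J_closed del: plus_fun_apply)
qed

lemma In_scale: "x \<in> In n \<Longrightarrow> sc c * x \<in> In n"
proof -
  assume "x \<in> In n"
  then obtain a where "a \<in> free_carrier E" "homog n a" "a \<in> J" "x = h a" by (auto simp: In_def)
  then show ?thesis unfolding In_def
    by (rule_tac x = "\<lambda>w. c * a w" in image_eqI)
       (simp_all add: hom_scale[OF hom] homog_ops free_carrier_closed J_closed)
qed

lemma In_diff: "x \<in> In n \<Longrightarrow> y \<in> In n \<Longrightarrow> x - y \<in> In n"
  using In_add[of x n "sc (-1) * y"] In_scale[of y n "-1"] by (simp add: scalars_simps[OF scalars])

lemma Hn_In: "x \<in> Hn m \<Longrightarrow> y \<in> In n \<Longrightarrow> x * y \<in> In (m + n)"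
  and In_Hn: "x \<in> Hn m \<Longrightarrow> y \<in> In n \<Longrightarrow> y * x \<in> In (n + m)"
proof -
  assume "x \<in> Hn m" "y \<in> In n"
  then obtain a b where ab: "a \<in> free_carrier E" "homog m a" "x = h a"
    "b \<in> free_carrier E" "homog n b" "b \<in> J" "y = h b" by (auto simp: In_def Hn_def)
  then have "fmul a b \<in> {a \<in> free_carrier E. homog (m + n) a \<and> a \<in> J}"
    "fmul b a \<in> {a \<in> free_carrier E. homog (n + m) a \<and> a \<in> J}"
    using homog_mult free_carrier_mult J_closed(4,5) by blast+
  moreover have "x * y = h (fmul a b)" "y * x = h (fmul b a)"
    using ab by (simp_all add: hom_mult[OF hom])
  ultimately show "x * y \<in> In (m + n)" "y * x \<in> In (n + m)" unfolding In_def by blast+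
qed

lemma In_Hn_subset: "x \<in> In n \<Longrightarrow> x \<in> Hn n"
  by (auto simp: In_def Hn_def)

lemma Hn_gens:
  "e \<in> edges E \<Longrightarrow> A e \<in> Hn 1" "e \<in> edges E \<Longrightarrow> B e \<in> Hn (- 1)" "v \<in> verts E \<Longrightarrow> gap X v \<in> Hn 0"
proof -
  show "A e \<in> Hn 1" if "e \<in> edges E"
    unfolding Hn_def using that by (intro image_eqI[of _ h "ge e"]) (simp_all add: h_gens homog_gens gen_carrier)
  show "B e \<in> Hn (- 1)" if "e \<in> edges E"
    unfolding Hn_def using that by (intro image_eqI[of _ h "gs e"]) (simp_all add: h_gens homog_gens gen_carrier)
  show "gap X v \<in> Hn 0" if "v \<in> verts E"
    unfolding Hn_def using that vH_carrier[OF wf that]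
    by (intro image_eqI[of _ h "vH E X v"]) (simp_all add: h_vH homog_vH)
qed

lemma In_loc: "v \<in> old \<Longrightarrow> loc v \<in> In 0"
proof (cases "v \<in> G")
  case True
  then show ?thesis unfolding In_def loc_def
    using J_gens(1) G_verts by (auto intro!: image_eqI[of _ h "gv v"] homog_gens gen_carrier simp: h_gens)
next
  case False
  assume "v \<in> old"
  with False have "v \<in> T" by (auto simp: old_def)
  then have "vH E G v \<in> J" "vH E G v \<in> free_carrier E" "gap G v = h (vH E G v)"
    using J_gens(2) vH_carrier[OF wf] TD(1) h_vH by auto
  then show ?thesis unfolding In_def loc_def using False homog_vH by (auto intro!: image_eqI[of _ h "vH E G v"])
qed

text \<open>\<open>v^H\<close> is not among the generators of \<open>I(G,T)\<close>, but it lies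
  below \<open>loc v\<close>, which belongs to that ideal.\<close>

lemma In_gapH: "v \<in> primed \<Longrightarrow> gap H v \<in> In 0"
  using Hn_In[OF Hn_gens(3) In_loc, of v v H] primedD(1)[of v] old_verts(1)[of v] gapH_loc[of v] by simp

lemma In_Q: "u \<in> verts P \<Longrightarrow> Q u \<in> In 0"
proof (cases u)
  case (OldV v)
  then show "u \<in> verts P \<Longrightarrow> ?thesis"
    by (auto simp: Qo_def intro!: In_diff In_loc In_gapH)
next
  case (PrimeV v)
  then show "u \<in> verts P \<Longrightarrow> ?thesis" by (simp add: In_gapH)
next
  case (WV p)
  have AxB: "A e * x * B e \<in> In 0" if "e \<in> edges E" "x \<in> In 0" for e x
    using In_Hn[OF Hn_gens(2) Hn_In[OF Hn_gens(1) that(2)]] that(1) by simp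
  have "p \<in> porc \<Longrightarrow> Qw p \<in> In 0"
    by (induction rule: porc_induct) (auto simp: porc_single intro!: AxB In_loc dest: porc_rng_old, auto simp: old_def)
  then show "u \<in> verts P \<Longrightarrow> ?thesis" using WV by simp
qed

lemma In_gval: "gen_ok P g \<Longrightarrow> FP.gval g \<in> In (gdeg g)"
  using In_Q Hn_In[OF Hn_gens(1) In_Q] In_Hn[OF Hn_gens(2) In_Q] edge_props
  by (auto simp: FP.gval_def gen_ok_def gdeg_def PA_def PB_def split: gen.splits)

lemma In_wval: "w \<noteq> [] \<Longrightarrow> \<forall>g\<in>set w. gen_ok P g \<Longrightarrow> FP.wval w \<in> In (wdeg w)"
proof (induction w)
  case (Cons g w)
  then show ?case
    using In_gval[of g] Hn_In[OF In_Hn_subset[OF In_gval], of g "FP.wval w" "wdeg w"]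
    by (cases "w = []") (auto simp: FP.wval_def wdeg_def)
qed simp

lemma ev_hcomp_In: "f \<in> free_carrier P \<Longrightarrow> FP.ev (hcomp n f) \<in> In n"
proof (induction f rule: free_carrier_induct)
  case zero
  show ?case unfolding hcomp_zero FP.ev_zero by (rule In_zero)
next
  case (add f g)
  then show ?case unfolding hcomp_add by (simp only: FP.ev_add hcomp_carrier In_add)
next
  case (wel c w)
  have w: "wel w \<in> free_carrier P" by (rule free_carrier_closed(6)[OF wel])
  show ?case
    unfolding hcomp_scale hcomp_homog[OF homog_gens(4)]
  proof (cases "wdeg w = n")
    case True
    then show "FP.ev (\<lambda>u. c * (if wdeg w = n then wel w else 0) u) \<in> In n"
      using FP.ev_scale[OF w, of c] In_scale In_wval[OF wel] by (simp add: FP.ev_wel)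
  next
    case False
    then have "(\<lambda>u. c * (if wdeg w = n then wel w else 0) u) = (0 :: _ \<Rightarrow> 'k)" by (simp add: fun_eq_iff)
    then show "FP.ev (\<lambda>u. c * (if wdeg w = n then wel w else 0) u) \<in> In n"
      using FP.ev_zero In_zero by simp
  qed
qed

lemma Dn_In: "Dn n \<subseteq> In n"
proof
  fix x assume "x \<in> Dn n"
  then obtain f where "f \<in> free_carrier P" "homog n f" "x = FP.ev f" by (auto simp: Dn_def)
  then show "x \<in> In n" using ev_hcomp_In[of f n] hcomp_homog[of n f n] by simp
qed

lemma Dn_zero: "0 \<in> Dn n"
  unfolding Dn_def
  by (rule image_eqI[where f = FP.ev and x = 0, OF FP.ev_zero[symmetric]]) (intro CollectI conjI free_carrier_closed(1) homog_ops(1))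

lemma Dn_add: "x \<in> Dn n \<Longrightarrow> y \<in> Dn n \<Longrightarrow> x + y \<in> Dn n"
proof -
  assume "x \<in> Dn n" "y \<in> Dn n"
  then obtain a b where "a \<in> free_carrier P" "homog n a" "x = FP.ev a"
    "b \<in> free_carrier P" "homog n b" "y = FP.ev b" by (auto simp: Dn_def)
  then show ?thesis unfolding Dn_def
    by (rule_tac x = "a + b" in image_eqI)
       (simp_all add: FP.ev_add homog_ops free_carrier_closed del: plus_fun_apply)
qed

lemma Dn_sum: "(\<And>i. i \<in> I \<Longrightarrow> x i \<in> Dn n) \<Longrightarrow> sum x I \<in> Dn n"
  by (induction I rule: infinite_finite_induct) (auto simp: Dn_zero Dn_add)

lemma Dn_scale: "x \<in> Dn n \<Longrightarrow> sc c * x \<in> Dn n"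
proof -
  assume "x \<in> Dn n"
  then obtain a where "a \<in> free_carrier P" "homog n a" "x = FP.ev a" by (auto simp: Dn_def)
  then show ?thesis unfolding Dn_def
    by (rule_tac x = "\<lambda>w. c * a w" in image_eqI)
       (simp_all add: FP.ev_scale homog_ops free_carrier_closed)
qed

lemma Dn_mult: "x \<in> Dn m \<Longrightarrow> y \<in> Dn n \<Longrightarrow> x * y \<in> Dn (m + n)"
proof -
  assume "x \<in> Dn m" "y \<in> Dn n"
  then obtain a b where "a \<in> free_carrier P" "homog m a" "x = FP.ev a"
    "b \<in> free_carrier P" "homog n b" "y = FP.ev b" by (auto simp: Dn_def)
  then show ?thesis unfolding Dn_def
    by (rule_tac x = "fmul a b" in image_eqI) (simp_all add: FP.ev_mult homog_mult free_carrier_mult)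
qed

lemma Dn_gens: "u \<in> verts P \<Longrightarrow> Q u \<in> Dn 0" "x \<in> edges P \<Longrightarrow> PA x \<in> Dn 1" "x \<in> edges P \<Longrightarrow> PB x \<in> Dn (- 1)"
proof -
  show "Q u \<in> Dn 0" if "u \<in> verts P"
    unfolding Dn_def using that FP.ev_gens(1)[of u]
    by (intro image_eqI[of _ FP.ev "gv u"]) (simp_all add: homog_gens gen_carrier del: Q_simps)
  show "PA x \<in> Dn 1" if "x \<in> edges P"
    unfolding Dn_def using that FP.ev_gens(2)[of x]
    by (intro image_eqI[of _ FP.ev "ge x"]) (simp_all add: homog_gens gen_carrier)
  show "PB x \<in> Dn (- 1)" if "x \<in> edges P"
    unfolding Dn_def using that FP.ev_gens(3)[of x]
    by (intro image_eqI[of _ FP.ev "gs x"]) (simp_all add: homog_gens gen_carrier)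
qed

lemma gval_Q:
  assumes g: "gen_ok E g" and u: "u \<in> verts P"
  shows "gval g * Q u \<in> Dn (gdeg g)" "Q u * gval g \<in> Dn (gdeg g)"
  using g u lift_props(1)
  by (auto simp: gval_def gen_ok_def gdeg_def V_Q' Q_V' A_Q Q_B B_Q_Q_A emits_def
      intro!: Dn_gens Dn_zero Dn_sum split: gen.splits)

text \<open>A local unit of \<open>P\<close> inserted next to \<open>y\<close> reduces the claim to
  products of a generator of \<open>E\<close> with a single \<open>Q u\<close>.\<close>

lemma gval_Dn:
  assumes g: "gen_ok E g" and y: "y \<in> Dn n"
  shows "gval g * y \<in> Dn (gdeg g + n)" "y * gval g \<in> Dn (n + gdeg g)"
proof -
  from y obtain f where f: "f \<in> free_carrier P" "y = FP.ev f" by (auto simp: Dn_def)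
  obtain W where W: "finite W" "W \<subseteq> verts P" "(\<Sum>u\<in>W. Q u) * y = y" "y * (\<Sum>u\<in>W. Q u) = y"
    unfolding f(2) by (rule FP.local_unit[OF f(1)])
  have "gval g * y = (\<Sum>u\<in>W. gval g * Q u) * y"
    unfolding sum_distrib_left[symmetric] mult.assoc W(3) ..
  also have "\<dots> \<in> Dn (gdeg g + n)"
    using W g y by (intro Dn_mult Dn_sum gval_Q) auto
  finally show "gval g * y \<in> Dn (gdeg g + n)" .
  have "y * gval g = y * (\<Sum>u\<in>W. Q u * gval g)"
    unfolding sum_distrib_right[symmetric] mult.assoc[symmetric] W(4) ..
  also have "\<dots> \<in> Dn (n + gdeg g)"
    using W g y by (intro Dn_mult Dn_sum gval_Q) auto
  finally show "y * gval g \<in> Dn (n + gdeg g)" .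
qed

lemma wval_Dn:
  "\<forall>g\<in>set w. gen_ok E g \<Longrightarrow> y \<in> Dn n \<Longrightarrow> wval w * y \<in> Dn (wdeg w + n)"
  "\<forall>g\<in>set w. gen_ok E g \<Longrightarrow> y \<in> Dn n \<Longrightarrow> y * wval w \<in> Dn (n + wdeg w)"
proof -
  show "\<forall>g\<in>set w. gen_ok E g \<Longrightarrow> y \<in> Dn n \<Longrightarrow> wval w * y \<in> Dn (wdeg w + n)"
    by (induction w) (auto simp: wval_def wdeg_def mult.assoc add.assoc gval_Dn)
  show "\<forall>g\<in>set w. gen_ok E g \<Longrightarrow> y \<in> Dn n \<Longrightarrow> y * wval w \<in> Dn (n + wdeg w)"
  proof (induction w arbitrary: y n)
    case (Cons g w)
    then have "(y * gval g) * wval w \<in> Dn ((n + gdeg g) + wdeg w)"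
      by (intro Cons.IH gval_Dn) auto
    then show ?case by (simp add: wval_def wdeg_def mult.assoc add.assoc)
  qed (simp add: wval_def wdeg_def)
qed

text \<open>The target ring has no grading, so components are taken in the free algebra before
  \<open>h\<close> is applied. Speaking of all components at once is what survives multiplication by
  an inhomogeneous \<open>a\<close>.\<close>

lemma h_hcomp_mult:
  assumes a: "a \<in> free_carrier E" and x: "x \<in> free_carrier E" and D: "\<And>n. h (hcomp n x) \<in> Dn n"
  shows "h (hcomp n (fmul a x)) \<in> Dn n \<and> h (hcomp n (fmul x a)) \<in> Dn n"
  using a
proof (induction a rule: free_carrier_induct)
  case zero
  show ?case unfolding fmul_zero_left fmul_zero_right hcomp_zero hom_zero[OF hom] using Dn_zero by blast
next
  case (add f g)
  then show ?case
    unfolding fmul_add_left fmul_add_right hcomp_add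
    using hom_add[OF hom hcomp_carrier hcomp_carrier] free_carrier_mult x Dn_add by metis
next
  case (wel c w)
  have w: "wel w \<in> free_carrier E" by (rule free_carrier_closed(6)[OF wel])
  have hx: "hcomp d x \<in> free_carrier E" for d using x by (rule hcomp_carrier)
  have "h (hcomp n (fmul (\<lambda>u. c * wel w u) x)) = sc c * (wval w * h (hcomp (n - wdeg w) x))"
    unfolding fmul_scale_left hcomp_scale hcomp_fmul_left[OF homog_gens(4)]
    by (simp add: hom_scale[OF hom] hom_mult[OF hom] hom_wel[OF hom h_gens wel] free_carrier_mult w hx)
  moreover have "h (hcomp n (fmul x (\<lambda>u. c * wel w u))) = sc c * (h (hcomp (n - wdeg w) x) * wval w)"
    unfolding fmul_scale_right hcomp_scale hcomp_fmul_right[OF homog_gens(4)]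
    by (simp add: hom_scale[OF hom] hom_mult[OF hom] hom_wel[OF hom h_gens wel] free_carrier_mult w hx)
  ultimately show ?case
    using Dn_scale[OF wval_Dn(1)[OF wel(2) D[of "n - wdeg w"]], of c]
      Dn_scale[OF wval_Dn(2)[OF wel(2) D[of "n - wdeg w"]], of c] by simp
qed

lemma Dn_homog:
  assumes "homog d a" "h a \<in> Dn d"
  shows "h (hcomp n a) \<in> Dn n"
  using assms hcomp_homog[OF assms(1), of n] hom_zero[OF hom] Dn_zero by (cases "d = n") simp_all

lemma Dn_Q_prime: "v \<in> old \<Longrightarrow> Q (OldV v) + (if v \<in> primed then Q (PrimeV v) else 0) \<in> Dn 0"
  using Dn_gens(1)[of "OldV v"] Dn_gens(1)[of "PrimeV v"] by (auto simp del: Q_simps intro!: Dn_add)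

text \<open>Induction on the generation of the ideal: its generators are homogeneous, and
  \<open>Dn\<close> absorbs them and is stable under the operations. This yields surjectivity onto
  \<open>I(G,T)\<close> and compatibility with degrees together.\<close>

lemma J_Dn:
  assumes rels: "\<And>r. r \<in> lpa_rels E \<Longrightarrow> h r = 0" and a: "a \<in> J"
  shows "h (hcomp n a) \<in> Dn n"
  using a unfolding adm_free_ideal_def
proof (induction arbitrary: n rule: ideal_gen.induct)
  case (base x)
  then consider "x \<in> lpa_rels E" | v where "v \<in> G" "x = gv v" | v where "v \<in> T" "x = vH E G v"
    by (auto simp: adm_gens_def)
  then show ?case
  proof cases
    case 1
    then obtain d where "homog d x" using homog_lpa_rels by blast
    then show ?thesis using rels[OF 1] Dn_zero by (intro Dn_homog) simp_all
  next
    case 2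
    then have "V v \<in> Dn 0" using V_G[of v] Dn_zero Dn_Q_prime[of v] by (auto simp: old_def simp del: Q_simps)
    then show ?thesis using 2 homog_gens(1)[of v] h_gens by (intro Dn_homog[of 0]) simp_all
  next
    case 3
    have "gap G v \<in> Dn 0"
    proof (cases "v \<in> S")
      case True
      then show ?thesis using gap_T[OF 3(1)] gap_T_porc[OF 3(1)]
        by (simp del: Q_simps) (intro Dn_sum Dn_gens; simp)
    next
      case False
      then show ?thesis using gap_T[OF 3(1)] Dn_Q_prime[of v] 3(1) by (simp del: Q_simps add: old_def)
    qed
    then show ?thesis using 3 homog_vH h_vH TD(1) by (intro Dn_homog[of 0]) simp_all
  qed
next
  case zero
  show ?case unfolding free_alg_simps hcomp_zero hom_zero[OF hom] by (rule Dn_zero)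
next
  case (add x y)
  then have "x \<in> free_carrier E" "y \<in> free_carrier E" using ideal_gen_carrier[OF hom] by auto
  then show ?case unfolding free_alg_simps hcomp_add
    using add.IH by (simp only: hom_add[OF hom] hcomp_carrier Dn_add)
next
  case (smul x c)
  then have "x \<in> free_carrier E" using ideal_gen_carrier[OF hom] by auto
  then show ?case unfolding free_alg_simps hcomp_scale
    using smul.IH by (simp only: hom_scale[OF hom] hcomp_carrier Dn_scale)
next
  case (lmul a x)
  then have "x \<in> free_carrier E" "a \<in> free_carrier E" using ideal_gen_carrier[OF hom] by auto
  then show ?case unfolding free_alg_simps using lmul.IH h_hcomp_mult by blast
next
  case (rmul a x)
  then have "x \<in> free_carrier E" "a \<in> free_carrier E" using ideal_gen_carrier[OF hom] by auto
  then show ?case unfolding free_alg_simps using rmul.IH h_hcomp_mult by blast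
qed

lemma Dn_eq_In:
  assumes rels: "\<And>r. r \<in> lpa_rels E \<Longrightarrow> h r = 0"
  shows "Dn n = In n"
proof
  show "In n \<subseteq> Dn n"
  proof
    fix x assume "x \<in> In n"
    then obtain a where "homog n a" "a \<in> J" "x = h a" by (auto simp: In_def)
    then show "x \<in> Dn n" using J_Dn[OF rels, of a n] hcomp_homog[of n a n] by simp
  qed
qed (rule Dn_In)

text \<open>Both images are closed under sums, so equality follows from the homogeneous
  components.\<close>

lemma image_ev_eq:
  assumes rels: "\<And>r. r \<in> lpa_rels E \<Longrightarrow> h r = 0"
  shows "FP.ev ` free_carrier P = h ` J"
proof (intro equalityI subsetI)
  fix x assume "x \<in> FP.ev ` free_carrier P"
  then obtain f where f: "f \<in> free_carrier P" "x = FP.ev f" by auto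
  have "x = (\<Sum>d\<in>wdeg ` {w. f w \<noteq> 0}. FP.ev (hcomp d f))"
    using arg_cong[OF hcomp_sum[OF f(1)], of FP.ev] hcomp_carrier[OF f(1)] f(2)
    by (simp add: hom_sum[OF FP.ev_hom])
  moreover have "FP.ev (hcomp d f) \<in> h ` J" for d
    using ev_hcomp_In[OF f(1), of d] by (auto simp: In_def)
  moreover have "sum y I \<in> h ` J" if y: "\<And>i. y i \<in> h ` J" for y and I :: "int set"
  proof (induction I rule: infinite_finite_induct)
    case (insert i I)
    obtain a b where "a \<in> J" "y i = h a" "b \<in> J" "sum y I = h b" using y[of i] insert.IH by auto
    then have "y i + sum y I = h (a + b)" "a + b \<in> J" using J_carrier J_closed(2) hom_add[OF hom] by auto
    then show ?case using insert.hyps by auto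
  qed (use image_eqI[where f = h and x = 0, OF hom_zero[OF hom, symmetric] J_closed(1)] in simp_all)
  ultimately show "x \<in> h ` J" by simp
next
  fix x assume "x \<in> h ` J"
  then obtain a where a: "a \<in> J" "x = h a" by auto
  have "x = (\<Sum>d\<in>wdeg ` {w. a w \<noteq> 0}. h (hcomp d a))"
    using arg_cong[OF hcomp_sum[OF J_carrier[OF a(1)]], of h] hcomp_carrier[OF J_carrier[OF a(1)]] a(2)
    by (simp add: hom_sum[OF hom])
  moreover have "h (hcomp d a) \<in> FP.ev ` free_carrier P" for d
    using J_Dn[OF rels a(1), of d] by (auto simp: Dn_def)
  moreover have "sum y I \<in> FP.ev ` free_carrier P" if y: "\<And>i. y i \<in> FP.ev ` free_carrier P" for y and I :: "int set"
  proof (induction I rule: infinite_finite_induct)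
    case (insert i I)
    obtain a b where "a \<in> free_carrier P" "y i = FP.ev a" "b \<in> free_carrier P" "sum y I = FP.ev b"
      using y[of i] insert.IH by auto
    then have "y i + sum y I = FP.ev (a + b)" "a + b \<in> free_carrier P"
      using free_carrier_closed(2) FP.ev_add by auto
    then show ?case using insert.hyps by auto
  qed (use image_eqI[where f = FP.ev and x = 0, OF FP.ev_zero[symmetric] free_carrier_closed(1)] in simp_all)
  ultimately show "x \<in> FP.ev ` free_carrier P" by simp
qed

end

subsection \<open>Ideals of Leavitt path algebras and of free algebras\<close>

lemma lpa_ideal_hom:
  fixes E :: "('v,'e) graph"
  assumes "wf_graph E"
  shows "\<exists>(sc :: 'k::field \<Rightarrow> (('v,'e) gen list \<Rightarrow> 'k) endo) h.
    alg_hom (free_alg E) sc h \<and> (\<forall>c a. h a * sc c = sc c * h a) \<and>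
    (\<forall>a\<in>free_carrier E. a \<in> lpa_ideal E \<longleftrightarrow> h a = 0)"
  by (rule exists_alg_hom_with_kernel[OF lpa_ideal_def lpa_rels_carrier[OF assms]])

lemma lpa_rels_subset: "wf_graph E \<Longrightarrow> r \<in> lpa_rels E \<Longrightarrow> r \<in> lpa_ideal E"
  unfolding lpa_ideal_def by (rule ideal_gen.base) (use lpa_rels_carrier in auto)

lemma alg_hom_LPA:
  fixes E :: "('v,'e) graph" and h :: "(('v,'e) gen list \<Rightarrow> 'k::field) \<Rightarrow> 'r::{ring,monoid_mult}"
  assumes h: "alg_hom (free_alg E) sc h" and rels: "\<And>r. r \<in> lpa_rels E \<Longrightarrow> h r = 0"
  shows "alg_hom (LPA E) sc (h \<circ> rep)" "a \<in> free_carrier E \<Longrightarrow> h (rep (lcls E a)) = h a"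
proof -
  have I: "h x = 0" if "x \<in> lpa_ideal E" for x
    using alg_hom_ideal_gen_zero[OF h rels] that unfolding lpa_ideal_def by blast
  have refl: "aadd (free_alg E) x (asmul (free_alg E) (- 1) x) \<in> lpa_ideal E" for x :: "('v,'e) gen list \<Rightarrow> 'k"
  proof -
    have "aadd (free_alg E) x (asmul (free_alg E) (- 1) x) = 0" by (simp add: fun_eq_iff)
    then show ?thesis using ideal_gen.zero[of "free_alg E" "lpa_rels E"] by (simp add: lpa_ideal_def)
  qed
  show "alg_hom (LPA E) sc (h \<circ> rep)" unfolding LPA_def
    by (rule alg_hom_quot(3)[OF h I refl])
  show "a \<in> free_carrier E \<Longrightarrow> h (rep (lcls E a)) = h a" unfolding lcls_def
    by (rule alg_hom_quot(2)[OF h I refl]) simp_all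
qed

lemma LPA_carrier: "acarrier (LPA E) = lcls E ` free_carrier E"
  by (simp add: LPA_def quot_def lcls_def[abs_def])

lemma LPA_homog: "ahomog (LPA E) n = lcls E ` {f \<in> free_carrier E. homog n f}"
  by (simp add: LPA_def quot_def lcls_def[abs_def] homog_def)

text \<open>The operations go through chosen representatives; a homomorphism with kernel exactly
  \<open>lpa_ideal E\<close> decides equality of classes and makes the choice invisible.\<close>

lemma lcls_ops:
  fixes a b :: "('v,'e) gen list \<Rightarrow> 'k::field"
  assumes wf: "wf_graph E" and a: "a \<in> free_carrier E" and b: "b \<in> free_carrier E"
  shows "aadd (LPA E) (lcls E a) (lcls E b) = lcls E (a + b)"
    "amul (LPA E) (lcls E a) (lcls E b) = lcls E (fmul a b)"
    "asmul (LPA E) c (lcls E a) = lcls E (\<lambda>w. c * a w)"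
    "lcls E a = lcls E b \<longleftrightarrow> a - b \<in> lpa_ideal E"
proof -
  obtain sc :: "'k \<Rightarrow> (('v,'e) gen list \<Rightarrow> 'k) endo" and h where
    h: "alg_hom (free_alg E) sc h" and ker': "\<forall>a\<in>free_carrier E. a \<in> lpa_ideal E \<longleftrightarrow> h a = 0"
    using lpa_ideal_hom[OF wf] by metis
  note ker = bspec[OF ker']
  have rels: "h r = 0" if "r \<in> lpa_rels E" for r
    using that ker[of r] lpa_rels_subset[OF wf] lpa_rels_carrier[OF wf] by auto
  note hom = alg_hom_LPA[OF h rels]
  have eq: "lcls E x = lcls E y \<longleftrightarrow> h x = h y" if "x \<in> free_carrier E" "y \<in> free_carrier E" for x y
    unfolding lcls_def by (rule alg_hom_quot_inj(4)[OF h]) (use that ker in auto)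
  have cls: "rep (lcls E x) \<in> free_carrier E" if "x \<in> free_carrier E" for x :: "('v,'e) gen list \<Rightarrow> 'k"
  proof -
    have "rep (lcls E x) \<in> acarrier (free_alg E)" unfolding lcls_def
    proof (rule alg_hom_quot(1)[OF h])
      fix y :: "('v,'e) gen list \<Rightarrow> 'k" assume y: "y \<in> acarrier (free_alg E)"
      show "aadd (free_alg E) y (asmul (free_alg E) (- 1) y) \<in> lpa_ideal E"
        using ker alg_hom_diff[OF h y y] by simp
    qed (use ker that in simp_all)
    then show ?thesis by simp
  qed
  show "aadd (LPA E) (lcls E a) (lcls E b) = lcls E (a + b)"
    using eq[of "rep (lcls E a) + rep (lcls E b)" "a + b"] a b cls
    by (simp add: LPA_def quot_def lcls_def[symmetric] free_carrier_closed hom_add[OF h] hom(2) del: plus_fun_apply)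
  show "amul (LPA E) (lcls E a) (lcls E b) = lcls E (fmul a b)"
    using eq[of "fmul (rep (lcls E a)) (rep (lcls E b))" "fmul a b"] a b cls
    by (simp add: LPA_def quot_def lcls_def[symmetric] free_carrier_mult hom_mult[OF h] hom(2))
  show "asmul (LPA E) c (lcls E a) = lcls E (\<lambda>w. c * a w)"
    using eq[of "\<lambda>w. c * rep (lcls E a) w" "\<lambda>w. c * a w"] a cls
    by (simp add: LPA_def quot_def lcls_def[symmetric] free_carrier_closed hom_scale[OF h] hom(2))
  show "lcls E a = lcls E b \<longleftrightarrow> a - b \<in> lpa_ideal E"
    using eq[OF a b] ker[OF free_carrier_diff[OF a b]] hom_diff[OF h a b] by simp
qed

lemma LPA_zero: "azero (LPA E) = lcls E 0"
  by (simp add: LPA_def quot_def lcls_def)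

text \<open>From left to right, a homomorphism whose kernel is the ideal on the right factors
  through \<open>LPA E\<close> and kills the generators there. Conversely the generation of the
  ideal is repeated on classes, the relations becoming zero.\<close>

lemma lcls_mem_ideal_iff:
  fixes X :: "(('v,'e) gen list \<Rightarrow> 'k::field) set"
  assumes wf: "wf_graph E" and X: "X \<subseteq> free_carrier E" and a: "a \<in> free_carrier E"
  shows "lcls E a \<in> ideal_gen (LPA E) (lcls E ` X) \<longleftrightarrow> a \<in> ideal_gen (free_alg E) (lpa_rels E \<union> X)"
proof
  have RX: "lpa_rels E \<union> X \<subseteq> free_carrier E" using lpa_rels_carrier[OF wf] X by auto
  obtain sc :: "'k \<Rightarrow> (('v,'e) gen list \<Rightarrow> 'k) endo" and h where
    h: "alg_hom (free_alg E) sc h" and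
    ker': "\<forall>a\<in>free_carrier E. a \<in> ideal_gen (free_alg E) (lpa_rels E \<union> X) \<longleftrightarrow> h a = 0"
    using exists_alg_hom_with_kernel[OF refl RX] by metis
  note ker = bspec[OF ker']
  have gens: "h r = 0" if "r \<in> lpa_rels E \<union> X" for r
    using that ker[of r] RX ideal_gen.base[of r "lpa_rels E \<union> X" "free_alg E"] by auto
  have rels: "h r = 0" if "r \<in> lpa_rels E" for r using that gens by blast
  note hom = alg_hom_LPA(1)[OF h rels]
  have hom2: "h (rep (lcls E x)) = h x" if "x \<in> free_carrier E" for x
    by (rule alg_hom_LPA(2)[OF h]) (use rels that in auto)
  show "a \<in> ideal_gen (free_alg E) (lpa_rels E \<union> X)" if "lcls E a \<in> ideal_gen (LPA E) (lcls E ` X)"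
  proof -
    have "(h \<circ> rep) (lcls E a) = 0"
      by (rule alg_hom_ideal_gen_zero[OF hom _ that]) (use X gens hom2 in auto)
    then show ?thesis using ker[OF a] hom2[OF a] by simp
  qed
  show "lcls E a \<in> ideal_gen (LPA E) (lcls E ` X)" if "a \<in> ideal_gen (free_alg E) (lpa_rels E \<union> X)"
    using that
  proof (induction rule: ideal_gen.induct)
    case (base x)
    then have x: "x \<in> free_carrier E" by simp
    show ?case
    proof (cases "x \<in> X")
      case True
      then show ?thesis using x by (intro ideal_gen.base) (auto simp: LPA_carrier)
    next
      case False
      then have "x - 0 \<in> lpa_ideal E" using base lpa_rels_subset[OF wf] by auto
      then have "lcls E x = azero (LPA E)"
        unfolding LPA_zero using lcls_ops(4)[OF wf x free_carrier_closed(1)] by blast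
      then show ?thesis by (simp add: ideal_gen.zero)
    qed
  next
    case zero
    show ?case unfolding free_alg_simps LPA_zero[symmetric] by (rule ideal_gen.zero)
  next
    case (add x y)
    then have xy: "x \<in> free_carrier E" "y \<in> free_carrier E" using ideal_gen_carrier[OF h] by auto
    show ?case
      using ideal_gen.add[OF add.IH] unfolding free_alg_simps lcls_ops(1)[OF wf xy] .
  next
    case (smul x c)
    then have x: "x \<in> free_carrier E" using ideal_gen_carrier[OF h] by auto
    show ?case
      using ideal_gen.smul[OF smul.IH, of c] unfolding free_alg_simps lcls_ops(3)[OF wf x x] .
  next
    case (lmul b x)
    then have bx: "b \<in> free_carrier E" "x \<in> free_carrier E" using ideal_gen_carrier[OF h] by auto
    then have "lcls E b \<in> acarrier (LPA E)" by (simp add: LPA_carrier)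
    from ideal_gen.lmul[OF this lmul.IH] show ?case
      unfolding free_alg_simps lcls_ops(2)[OF wf bx] .
  next
    case (rmul b x)
    then have bx: "x \<in> free_carrier E" "b \<in> free_carrier E" using ideal_gen_carrier[OF h] by auto
    then have "lcls E b \<in> acarrier (LPA E)" by (simp add: LPA_carrier)
    from ideal_gen.rmul[OF this rmul.IH] show ?case
      unfolding free_alg_simps lcls_ops(2)[OF wf bx] .
  qed
qed

lemma adm_ideal_iff:
  assumes "wf_graph E" "H \<subseteq> verts E" "S \<subseteq> verts E" "a \<in> free_carrier E"
  shows "lcls E a \<in> adm_ideal E H S \<longleftrightarrow> a \<in> adm_free_ideal E H S"
  using lcls_mem_ideal_iff[OF assms(1) adm_gens_carrier[OF assms(1-3)] assms(4)]
  by (simp add: adm_ideal_def adm_free_ideal_def adm_gens_def)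

lemma alg_hom_restr:
  assumes h: "alg_hom A sc h"
  shows "alg_hom (restr A (ideal_gen A X)) sc h"
proof -
  note c = ideal_gen_carrier[OF h]
  show ?thesis
    unfolding alg_hom_def restr_def
    using alg_homD[OF h] c ideal_gen.intros(2-6)[where A = A and X = X] by auto
qed

subsection \<open>Functoriality of the induced family\<close>

text \<open>\<open>Q\<close>, \<open>PA\<close> and \<open>PB\<close> arise from the given family by
  ring operations alone, so they commute with the projection. Thus the second component of a product
  can test injectivity on \<open>L(P)\<close>.\<close>

lemma snd_family:
  assumes "porcupine_family E H S G T sc V A B" and "porcupine_family E H S G T sc' V' A' B'"
    and sc: "\<And>c. snd (sc c) = sc' c" and VAB: "\<And>v. snd (V v) = V' v" "\<And>e. snd (A e) = A' e" "\<And>e. snd (B e) = B' e"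
  shows "snd (leavitt_family.ev sc (porcupine_family.Q E H S G T V A B) (porcupine_family.PA E H S G T V A B)
      (porcupine_family.PB E H S G T V A B) f) =
    leavitt_family.ev sc' (porcupine_family.Q E H S G T V' A' B') (porcupine_family.PA E H S G T V' A' B')
      (porcupine_family.PB E H S G T V' A' B') f"
proof -
  interpret F: porcupine_family E H S G T sc V A B by fact
  interpret F': porcupine_family E H S G T sc' V' A' B' by fact
  interpret FP: leavitt_family F.P sc F.Q F.PA F.PB by (rule F.family_P)
  interpret FP': leavitt_family F.P sc' F'.Q F'.PA F'.PB by (rule F'.family_P)
  have gap: "snd (F.gap X v) = F'.gap X v" for X v
    by (simp add: F.gap_def F'.gap_def F.sAB_def F'.sAB_def VAB snd_sum)
  have loc: "snd (F.loc v) = F'.loc v" for v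
    by (simp add: F.loc_def F'.loc_def gap VAB)
  have Qw: "snd (F.Qw p) = F'.Qw p" for p
    by (induction p rule: F.Qw.induct) (simp_all add: loc VAB)
  have Q: "snd (F.Q u) = F'.Q u" for u
    by (cases u) (simp_all add: F.Qo_def F'.Qo_def gap loc Qw)
  have gval: "snd (FP.gval g) = FP'.gval g" for g
    by (cases g) (simp_all add: FP.gval_def FP'.gval_def Q F.PA_def F.PB_def F'.PA_def F'.PB_def VAB)
  have wval: "snd (FP.wval w) = FP'.wval w" for w
    by (induction w) (simp_all add: FP.wval_def FP'.wval_def gval)
  show ?thesis by (simp add: FP.ev_def FP'.ev_def snd_sum wval sc)
qed

context porcupine_module
begin

text \<open>The product of a family that is faithful modulo \<open>I(H,S)\<close> with the module family: the first factor
  controls the kernel on the side of \<open>E\<close>, the second one the kernel on the side of \<open>P\<close>.\<close>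

lemma product_hom:
  fixes sc1 :: "'k \<Rightarrow> 's::{ring,monoid_mult}"
  assumes h: "alg_hom (free_alg E) sc1 h" and comm: "\<forall>c a. h a * sc1 c = sc1 c * h a"
    and ker': "\<forall>a\<in>free_carrier E. a \<in> adm_free_ideal E H S \<longleftrightarrow> h a = 0"
    and sc2_def: "sc2 = (\<lambda>c. (sc1 c, msc c))" and k_def: "k = (\<lambda>a. (h a, M.ev a))"
  shows "porcupine_hom E H S G T sc2 (\<lambda>v. k (gv v)) (\<lambda>e. k (ge e)) (\<lambda>e. k (gs e)) k"
    "\<And>a. a \<in> free_carrier E \<Longrightarrow> a \<in> adm_free_ideal E H S \<longleftrightarrow> k a = 0"
    "\<And>r. r \<in> lpa_rels E \<Longrightarrow> k r = 0"
proof -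
  note ker = bspec[OF ker']
  have ideal: "r \<in> adm_free_ideal E H S" if "r \<in> lpa_rels E \<union> adm_gens E H S" "r \<in> free_carrier E" for r
    unfolding adm_free_ideal_def using that by (intro ideal_gen.base) auto
  have S: "S \<subseteq> verts E" using SD(1) by auto
  have Hv: "H \<subseteq> verts E" using HG G_verts by auto
  have kf: "alg_hom (free_alg E) sc2 k"
    using h M.ev_hom unfolding alg_hom_def scalars_def sc2_def k_def
    by (simp add: prod_eq_iff del: free_alg_simps)
  have vH: "M.ev (vH E H v) = M.gap H v" if "v \<in> verts E" for v
    by (rule M.hom_vH[OF M.ev_hom M.ev_gens that])
  \<comment> \<open>The module family also kills the generators of \<open>I(H,S)\<close>, so pairing
    it with \<open>h\<close> does not shrink the kernel.\<close>
  have ev0: "M.ev r = 0" if "r \<in> lpa_rels E \<union> adm_gens E H S" for r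
    using that M.ev_rels vH S M.gap_S M.V_H by (auto simp: adm_gens_def M.ev_gens)
  have k0: "k r = 0" if "r \<in> lpa_rels E \<union> adm_gens E H S" for r
  proof -
    have "r \<in> free_carrier E"
      using that lpa_rels_carrier[OF wf] adm_gens_carrier[OF wf Hv S] by auto
    then show ?thesis using ker[of r] ideal[OF that] ev0[OF that] by (simp add: k_def prod_eq_iff)
  qed
  then show "\<And>r. r \<in> lpa_rels E \<Longrightarrow> k r = 0" by blast
  show "a \<in> adm_free_ideal E H S \<longleftrightarrow> k a = 0" if a: "a \<in> free_carrier E" for a
  proof
    assume "a \<in> adm_free_ideal E H S"
    then show "k a = 0" using alg_hom_ideal_gen_zero[OF kf k0] unfolding adm_free_ideal_def by blast
  next
    assume "k a = 0"
    then have "h a = 0" by (simp add: k_def prod_eq_iff)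
    then show "a \<in> adm_free_ideal E H S" using ker[OF a] by simp
  qed
  have ev_comm: "M.ev a * msc c = msc c * M.ev a" if "a \<in> free_carrier E" for a c
  proof -
    have w: "M.wval w * msc c = msc c * M.wval w" if "a w \<noteq> 0" for w
      using M.wval_comm \<open>a \<in> free_carrier E\<close> that by (auto simp: free_carrier_def)
    have s: "msc x * msc c = msc c * msc x" for x
      using scalars_simps(3)[OF M.scalars] by (metis mult.commute)
    have "msc (a w) * M.wval w * msc c = msc c * (msc (a w) * M.wval w)" if "a w \<noteq> 0" for w
    proof -
      have "msc (a w) * M.wval w * msc c = (msc (a w) * msc c) * M.wval w"
        by (simp only: mult.assoc w[OF that])
      then show ?thesis by (simp only: s[of "a w"] mult.assoc)
    qed
    then show ?thesis
      unfolding M.ev_def sum_distrib_left sum_distrib_right by (intro sum.cong) auto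
  qed
  interpret K: leavitt_family E sc2 "\<lambda>v. k (gv v)" "\<lambda>e. k (ge e)" "\<lambda>e. k (gs e)"
    by (rule leavitt_family_of_hom[OF wf kf _ k0[OF UnI1]])
       (simp_all add: k_def sc2_def prod_eq_iff comm ev_comm)
  have K_vH: "k (vH E H v) = K.gap H v" if "v \<in> verts E" for v
    by (rule K.hom_vH[OF kf refl refl refl that])
  show "porcupine_hom E H S G T sc2 (\<lambda>v. k (gv v)) (\<lambda>e. k (ge e)) (\<lambda>e. k (gs e)) k"
  proof
    show "k (gv v) = 0" if "v \<in> H" for v
      by (rule k0) (use that in \<open>auto simp: adm_gens_def\<close>)
    show "K.gap H v = 0" if "v \<in> S" for v
    proof -
      have "(vH E H v :: ('v,'e) gen list \<Rightarrow> 'k) \<in> adm_gens E H S" using that by (auto simp: adm_gens_def)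
      then have "k (vH E H v) = 0" by (intro k0) simp
      then show ?thesis using K_vH[OF subsetD[OF S that]] by simp
    qed
  qed (use kf in simp_all)
qed

end

theorem theorem3:
  fixes E :: "('v,'e) graph" and H S G T :: "'v set"
  assumes "wf_graph E"
    and "admissible E H S" and "admissible E G T"
    and "adm_le H S G T"
  shows "\<exists>\<phi>. graded_iso (LPA (pq_graph E H S G T) :: ('k::field, _) kalg)
                       (quot (restr (LPA E) (adm_ideal E G T)) (adm_ideal E H S)) \<phi>"
proof -
  interpret porcupine E H S G T by standard fact+
  have carr: "H \<subseteq> verts E" "S \<subseteq> verts E" "G \<subseteq> verts E" "T \<subseteq> verts E"
    using HG G_verts SD(1) TD(1) by auto
  let ?P = "pq_graph E H S G T"
  let ?IG = "adm_ideal E G T :: (('v,'e) gen list \<Rightarrow> 'k) set set"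
  let ?IH = "adm_ideal E H S :: (('v,'e) gen list \<Rightarrow> 'k) set set"
  \<comment> \<open>A faithful representation of \<open>L(P)\<close>; its ring supplies the values
    of the functions that form the module.\<close>
  obtain sc0 :: "'k \<Rightarrow> ((('v,'e) pq_vert, ('v,'e) pq_edge) gen list \<Rightarrow> 'k) endo" and h0 where
    h0': "alg_hom (free_alg ?P) sc0 h0" "\<forall>c a. h0 a * sc0 c = sc0 c * h0 a"
      "\<forall>a\<in>free_carrier ?P. a \<in> lpa_ideal ?P \<longleftrightarrow> h0 a = 0"
    using lpa_ideal_hom[OF wf_P] by metis
  note h0 = h0'(1) h0'(2)[rule_format] h0'(3)[rule_format]
  have h0_rels: "h0 r = 0" if "r \<in> lpa_rels ?P" for r
    using that h0(3)[of r] lpa_rels_subset[OF wf_P] lpa_rels_carrier[OF wf_P] by auto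
  interpret R: leavitt_family ?P sc0 "\<lambda>u. h0 (gv u)" "\<lambda>x. h0 (ge x)" "\<lambda>x. h0 (gs x)"
    by (rule leavitt_family_of_hom[OF wf_P h0(1,2) h0_rels])
  interpret Mod: porcupine_module E H S G T sc0 "\<lambda>u. h0 (gv u)" "\<lambda>x. h0 (ge x)" "\<lambda>x. h0 (gs x)" ..
  have "lpa_rels E \<union> adm_gens E H S \<subseteq> (free_carrier E :: (('v,'e) gen list \<Rightarrow> 'k) set)"
    using lpa_rels_carrier[OF wf] adm_gens_carrier[OF wf carr(1,2)] by auto
  then obtain sc1 :: "'k \<Rightarrow> (('v,'e) gen list \<Rightarrow> 'k) endo" and h1 where
    h1: "alg_hom (free_alg E) sc1 h1" "\<forall>c a. h1 a * sc1 c = sc1 c * h1 a"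
      "\<forall>a\<in>free_carrier E. a \<in> adm_free_ideal E H S \<longleftrightarrow> h1 a = 0"
    using exists_alg_hom_with_kernel[OF adm_free_ideal_def] by metis
  define sc where "sc = (\<lambda>c. (sc1 c, Mod.msc c))"
  define k where "k = (\<lambda>a. (h1 a, Mod.M.ev a))"
  note prod = Mod.product_hom[OF h1 sc_def k_def]
  interpret K: porcupine_hom E H S G T sc "\<lambda>v. k (gv v)" "\<lambda>e. k (ge e)" "\<lambda>e. k (gs e)" k
    by (rule prod(1))
  have snd_ev: "snd (K.FP.ev f) = Mod.MP.ev f" for f
    by (rule snd_family[OF K.porcupine_family_axioms Mod.porcupine_family_m])
       (simp_all add: sc_def k_def Mod.M.ev_gens)
  have ker_P: "f \<in> lpa_ideal ?P \<longleftrightarrow> K.FP.ev f = 0" if f: "f \<in> free_carrier ?P" for f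
  proof
    assume "f \<in> lpa_ideal ?P"
    then show "K.FP.ev f = 0"
      using alg_hom_ideal_gen_zero[OF K.FP.ev_hom K.FP.ev_rels] unfolding lpa_ideal_def by blast
  next
    assume "K.FP.ev f = 0"
    \<comment> \<open>The second component is the module action of \<open>f\<close>, and its
      vanishing forces \<open>f\<close> to vanish in the faithful representation of
      \<open>L(P)\<close>.\<close>
    then have "Mod.MP.ev f = 0" using snd_ev[of f] by simp
    then have "R.ev f = 0" by (rule Mod.ev_zero[OF f])
    moreover have "h0 f = R.ev f" by (rule R.hom_eq_ev[OF h0(1) refl refl refl f])
    ultimately show "f \<in> lpa_ideal ?P" using h0(3)[OF f] by simp
  qed
  have f1: "alg_hom (LPA ?P) sc (K.FP.ev \<circ> rep)" "inj_on (K.FP.ev \<circ> rep) (acarrier (LPA ?P))"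
    unfolding LPA_def by (rule alg_hom_quot_inj[OF K.FP.ev_hom]; use ker_P in simp)+
  have f2: "K.FP.ev (rep (lcls ?P f)) = K.FP.ev f" if "f \<in> free_carrier ?P" for f
    by (rule alg_hom_LPA(2)[OF K.FP.ev_hom]) (use K.FP.ev_rels that in auto)
  have g0: "alg_hom (LPA E) sc (k \<circ> rep)" "\<And>a. a \<in> free_carrier E \<Longrightarrow> k (rep (lcls E a)) = k a"
    using alg_hom_LPA[OF K.hom] prod(3) by auto
  have g1: "alg_hom (restr (LPA E) ?IG) sc (k \<circ> rep)"
    unfolding adm_ideal_def by (rule alg_hom_restr[OF g0(1)])
  have IG: "?IG = lcls E ` adm_free_ideal E G T"
  proof -
    have "X \<in> lcls E ` free_carrier E" if "X \<in> ?IG" for X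
      using ideal_gen_carrier[OF g0(1)] that unfolding adm_ideal_def LPA_carrier by blast
    then show ?thesis using adm_ideal_iff[OF wf carr(3,4)] K.J_carrier by blast
  qed
  have ker_E: "X \<in> ?IH \<longleftrightarrow> (k \<circ> rep) X = 0" if "X \<in> ?IG" for X
  proof -
    obtain a where "a \<in> adm_free_ideal E G T" "X = lcls E a" using \<open>X \<in> ?IG\<close> unfolding IG by blast
    then have a: "a \<in> free_carrier E" "X = lcls E a" using K.J_carrier by auto
    then show ?thesis using adm_ideal_iff[OF wf carr(1,2) a(1)] prod(2)[OF a(1)] g0(2)[OF a(1)] by simp
  qed
  have carrier_restr: "acarrier (restr (LPA E) ?IG) = ?IG" by (simp add: restr_def)
  let ?Q = "quot (restr (LPA E) ?IG) ?IH"
  \<comment> \<open>Elements of \<open>?Q\<close> are classes of classes, hence the two occurrences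
    of \<open>rep\<close>.\<close>
  have g2: "alg_hom ?Q sc (k \<circ> rep \<circ> rep)" "inj_on (k \<circ> rep \<circ> rep) (acarrier ?Q)"
    "\<And>X. X \<in> ?IG \<Longrightarrow> (k \<circ> rep) (rep (qclass (restr (LPA E) ?IG) ?IH X)) = (k \<circ> rep) X"
    by (rule alg_hom_quot_inj[OF g1]; use ker_E carrier_restr in blast)+
  have img: "((k \<circ> rep) \<circ> rep) ` qclass (restr (LPA E) ?IG) ?IH ` lcls E ` Y = k ` Y"
    if "Y \<subseteq> adm_free_ideal E G T" for Y
  proof -
    have "(k \<circ> rep) (rep (qclass (restr (LPA E) ?IG) ?IH (lcls E a))) = k a" if "a \<in> Y" for a
      using g2(3)[of "lcls E a"] g0(2)[of a] K.J_carrier[of a] IG that \<open>Y \<subseteq> _\<close> by auto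
    then show ?thesis by (force simp: image_iff)
  qed
  have "graded_iso (LPA ?P) ?Q (inv_into (acarrier ?Q) ((k \<circ> rep) \<circ> rep) \<circ> (K.FP.ev \<circ> rep))"
  proof (rule graded_iso_if_same_image[OF f1 g2(1)])
    show "inj_on (k \<circ> rep \<circ> rep) (acarrier ?Q)" by (rule g2(2))
    have "acarrier ?Q = qclass (restr (LPA E) ?IG) ?IH ` ?IG" by (simp add: quot_def carrier_restr)
    also have "\<dots> = qclass (restr (LPA E) ?IG) ?IH ` lcls E ` adm_free_ideal E G T"
      by (rule arg_cong[OF IG])
    finally have "acarrier ?Q = qclass (restr (LPA E) ?IG) ?IH ` lcls E ` adm_free_ideal E G T" .
    then show "(K.FP.ev \<circ> rep) ` acarrier (LPA ?P) = (k \<circ> rep \<circ> rep) ` acarrier ?Q"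
      using img[of "adm_free_ideal E G T"] K.image_ev_eq[OF prod(3)] f2
      by (simp add: LPA_carrier image_image)
    fix n
    show "ahomog (LPA ?P) n \<subseteq> acarrier (LPA ?P)" by (auto simp: LPA_carrier LPA_homog)
    have hom: "ahomog (restr (LPA E) ?IG) n =
        lcls E ` {a \<in> free_carrier E. homog n a \<and> a \<in> adm_free_ideal E G T}"
      using adm_ideal_iff[OF wf carr(3,4)] by (auto simp: restr_def LPA_homog)
    show "ahomog ?Q n \<subseteq> acarrier ?Q" by (auto simp: quot_def restr_def)
    have "ahomog ?Q n = qclass (restr (LPA E) ?IG) ?IH ` lcls E `
        {a \<in> free_carrier E. homog n a \<and> a \<in> adm_free_ideal E G T}"
      unfolding hom[symmetric] by (simp add: quot_def)
    also have "(k \<circ> rep \<circ> rep) ` \<dots> = K.In n"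
      unfolding K.In_def by (rule img) blast
    finally have "(k \<circ> rep \<circ> rep) ` ahomog ?Q n = K.In n" .
    moreover have "(K.FP.ev \<circ> rep) ` ahomog (LPA ?P) n = K.Dn n"
      using f2 by (force simp: LPA_homog K.Dn_def image_iff)
    ultimately show "(K.FP.ev \<circ> rep) ` ahomog (LPA ?P) n = (k \<circ> rep \<circ> rep) ` ahomog ?Q n"
      using K.Dn_eq_In[OF prod(3)] by simp
  qed
  then show ?thesis by blast
qed

end
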